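(* Let $\Omega_1,\Omega_2\subset\mathbb{R}^n$ be open, bounded, smooth and uniformly convex sets, and let $\mu=\rho_\mu\mathcal{L}_{\mathbb{R}^n}$ and $\nu=\rho_\nu\mathcal{L}_{\mathbb{R}^n}$ be two probability measures on $\mathbb{R}^n$ with densities $\rho_\mu:\Omega_1\to\mathbb{R}$ and $\rho_\nu:\Omega_2\to\mathbb{R}$ (so $\mu$ is concentrated on $\Omega_1$ and $\nu$ on $\Omega_2$). Assume that there exists $C>1$ such that $C\ge\rho_\mu\ge 1/C$ on $\Omega_1$ and $C\ge\rho_\nu\ge1/C$ on $\Omega_2$, and that $\rho_\mu\in C^\infty(\overline{\Omega}_1,\mathbb{R})$, $\rho_\nu\in C^\infty(\overline{\Omega}_2,\mathbb{R})$. Let $T:\overline{\Omega}_1\to\overline{\Omega}_2$ be the optimal transport map between $\mu$ and $\nu$ (for the squared Euclidean distance cost). Let $F_1,\dots,F_k$ be smooth, Lipschitz-continuous vector fields on $\mathbb{R}^n$ satisfying the Lie algebra strong approximating property. Then, for every $\varepsilon>0$, there exists a control $u\in L^2([0,1],\mathbb{R}^k)$ such that $$\sup_{x\in\Omega_1}|T(x)-\Phi_u(x)|_2\le\varepsilon,$$ where $\Phi_u$ is the final-time flow of the linear-control system $\dot x=\sum_{i=1}^kF_i(x)u_i$ corresponding to $u$.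
   Context: Flow: for $u=(u_1,\dots,u_k)\in L^2([0,1],\mathbb{R}^k)$, $\Phi_u:\mathbb{R}^n\to\mathbb{R}^n$ is defined by $\Phi_u(x):=x_u(1)$, where $x_u:[0,1]\to\mathbb{R}^n$ is the absolutely continuous solution of $\dot x_u(t)=\sum_{i=1}^kF_i(x_u(t))u_i(t)$ for a.e. $t\in[0,1]$, $x_u(0)=x$. Optimal transport map: a Borel map $T$ such that $(\mathrm{Id},T)_\#\mu$ minimizes $\int|x-y|^2\,d\gamma(x,y)$ among all probability measures $\gamma$ on $\mathbb{R}^n\times\mathbb{R}^n$ with marginals $\mu$ and $\nu$. Under the hypotheses it is unique up to $\mu$-a.e. equality; $T:\overline{\Omega}_1\to\overline{\Omega}_2$ denotes its continuous representative. Smooth and uniformly convex domain: a convex domain with $C^\infty$ boundary all of whose principal curvatures are bounded below by a positive constant. Lie algebra strong approximating property: let $\mathrm{Lie}(F_1,\dots,F_k):=\mathrm{span}\{[F_{i_s},[\dots,[F_{i_2},F_{i_1}],\dots]]: s\ge1,\ i_1,\dots,i_s\in\{1,\dots,k\}\}$, where $[\cdot,\cdot]$ is the Lie bracket of vector fields. For a vector field $X$ and a compact set $K\subset\mathbb{R}^n$ let $\|X\|_{1,K}:=\sup_{x\in K}\big(|X(x)|_2+\sum_{i=1}^n|D_{x_i}X(x)|_2\big)$, and for $\delta>0$ let $\mathrm{Lie}^\delta_{1,K}(F_1,\dots,F_k):=\{X\in\mathrm{Lie}(F_1,\dots,F_k):\|X\|_{1,K}\le\delta\}$. The fields satisfy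 the property if there exists $m\ge1$ such that, for every $C^m$-regular vector field $Y:\mathbb{R}^n\to\mathbb{R}^n$ and every compact set $K\subset\mathbb{R}^n$, there exists $\delta>0$ such that $\inf\{\sup_{x\in K}|X(x)-Y(x)|_2: X\in\mathrm{Lie}^\delta_{1,K}(F_1,\dots,F_k)\}=0$. *)

theory Defs
  imports "HOL-Analysis.Analysis" "HOL-Probability.Probability_Measure"
begin

section \<open>Regularity classes\<close>

definition partial_deriv ::
    "'n::finite \<Rightarrow> (real^'n \<Rightarrow> 'b::real_normed_vector) \<Rightarrow> real^'n \<Rightarrow> 'b" where
  "partial_deriv i f x = frechet_derivative f (at x) (axis i 1)"

text \<open>\<open>U\<close> is meant to be open.\<close>

primrec Ck_on ::
    "nat \<Rightarrow> (real^'n::finite \<Rightarrow> 'b::real_normed_vector) \<Rightarrow> (real^'n) set \<Rightarrow> bool" where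
  "Ck_on 0 f U \<longleftrightarrow> continuous_on U f"
| "Ck_on (Suc m) f U \<longleftrightarrow>
     (\<forall>x\<in>U. f differentiable (at x)) \<and> (\<forall>i. Ck_on m (partial_deriv i f) U)"

definition smooth_on ::
    "(real^'n::finite \<Rightarrow> 'b::real_normed_vector) \<Rightarrow> (real^'n) set \<Rightarrow> bool" where
  "smooth_on f U \<longleftrightarrow> (\<forall>m. Ck_on m f U)"

text \<open>The class \<open>C\<^sup>\<infinity>(closure U)\<close> for open \<open>U\<close>: smooth functions on \<open>U\<close> all of whose iterated
  partial derivatives (the empty list giving the function itself) extend continuously to the closure.
  Only the values of \<open>f\<close> on \<open>U\<close> matter.\<close>

definition smooth_upto_closure ::
    "(real^'n::finite \<Rightarrow> 'b::real_normed_vector) \<Rightarrow> (real^'n) set \<Rightarrow> bool" where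
  "smooth_upto_closure f U \<longleftrightarrow> smooth_on f U \<and>
     (\<forall>is. \<exists>g. continuous_on (closure U) g \<and> (\<forall>x\<in>U. g x = foldr partial_deriv is f x))"


section \<open>Smooth uniformly convex domains\<close>

definition gradient :: "(real^'n::finite \<Rightarrow> real) \<Rightarrow> real^'n \<Rightarrow> real^'n" where
  "gradient f x = (\<chi> i. partial_deriv i f x)"

definition local_defining_function ::
    "(real^'n::finite) set \<Rightarrow> real^'n \<Rightarrow> (real^'n) set \<Rightarrow> (real^'n \<Rightarrow> real) \<Rightarrow> bool" where
  "local_defining_function \<Omega> p U \<phi> \<longleftrightarrow>
     open U \<and> p \<in> U \<and> smooth_on \<phi> U \<and> (\<forall>x\<in>U. gradient \<phi> x \<noteq> 0) \<and>
     \<Omega> \<inter> U = {x\<in>U. \<phi> x < 0} \<and> frontier \<Omega> \<inter> U = {x\<in>U. \<phi> x = 0}"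

definition smooth_boundary :: "(real^'n::finite) set \<Rightarrow> bool" where
  "smooth_boundary \<Omega> \<longleftrightarrow> (\<forall>p\<in>frontier \<Omega>. \<exists>U \<phi>. local_defining_function \<Omega> p U \<phi>)"

text \<open>On the boundary, \<open>sgn (gradient \<phi> x)\<close> is the outward unit normal; its derivative along the
  tangent space (the orthogonal complement of the gradient) is the shape operator, which does not
  depend on \<open>\<phi>\<close>. Principal curvatures are its eigenvalues. With this sign they are nonnegative for
  convex sets, and a ball of radius \<open>r\<close> has principal curvatures \<open>1 / r\<close>. In dimension 1 there are
  none.\<close>

definition principal_curvature :: "(real^'n::finite) set \<Rightarrow> real^'n \<Rightarrow> real \<Rightarrow> bool" where
  "principal_curvature \<Omega> p \<kappa> \<longleftrightarrow>
     (\<exists>U \<phi> v. local_defining_function \<Omega> p U \<phi> \<and> v \<noteq> 0 \<and> v \<bullet> gradient \<phi> p = 0 \<and>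
        frechet_derivative (\<lambda>x. sgn (gradient \<phi> x)) (at p) v = \<kappa> *\<^sub>R v)"

definition smooth_uniformly_convex :: "(real^'n::finite) set \<Rightarrow> bool" where
  "smooth_uniformly_convex \<Omega> \<longleftrightarrow> convex \<Omega> \<and> smooth_boundary \<Omega> \<and>
     (\<exists>c>0. \<forall>p\<in>frontier \<Omega>. \<forall>\<kappa>. principal_curvature \<Omega> p \<kappa> \<longrightarrow> c \<le> \<kappa>)"


section \<open>Optimal transport\<close>

definition couplings ::
    "(real^'n::finite) measure \<Rightarrow> (real^'n) measure \<Rightarrow> ((real^'n) \<times> (real^'n)) measure set" where
  "couplings \<mu> \<nu> =
     {\<gamma>. sets \<gamma> = sets borel \<and> prob_space \<gamma> \<and>
         distr \<gamma> borel fst = \<mu> \<and> distr \<gamma> borel snd = \<nu>}"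

definition transport_cost :: "((real^'n::finite) \<times> (real^'n)) measure \<Rightarrow> ennreal" where
  "transport_cost \<gamma> = (\<integral>\<^sup>+ (x, y). ennreal ((norm (x - y))\<^sup>2) \<partial>\<gamma>)"

definition optimal_transport_map ::
    "(real^'n::finite) measure \<Rightarrow> (real^'n) measure \<Rightarrow> (real^'n \<Rightarrow> real^'n) \<Rightarrow> bool" where
  "optimal_transport_map \<mu> \<nu> S \<longleftrightarrow>
     S \<in> borel_measurable borel \<and>
     distr \<mu> borel (\<lambda>x. (x, S x)) \<in> couplings \<mu> \<nu> \<and>
     (\<forall>\<gamma>\<in>couplings \<mu> \<nu>. transport_cost (distr \<mu> borel (\<lambda>x. (x, S x))) \<le> transport_cost \<gamma>)"

text \<open>\<open>T\<close> is the representative of the optimal transport map that is continuous as a map from the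
  closure of \<open>A\<close> to the closure of \<open>B\<close>; its values elsewhere are irrelevant.\<close>

definition continuous_optimal_transport_map ::
    "(real^'n::finite) measure \<Rightarrow> (real^'n) measure \<Rightarrow> (real^'n) set \<Rightarrow> (real^'n) set \<Rightarrow>
     (real^'n \<Rightarrow> real^'n) \<Rightarrow> bool" where
  "continuous_optimal_transport_map \<mu> \<nu> A B T \<longleftrightarrow>
     continuous_on (closure A) T \<and> T ` closure A \<subseteq> closure B \<and>
     (\<exists>S. optimal_transport_map \<mu> \<nu> S \<and> (AE x in \<mu>. T x = S x))"


section \<open>The Lie algebra strong approximating property\<close>

definition lie_bracket ::
    "(real^'n::finite \<Rightarrow> real^'n) \<Rightarrow> (real^'n \<Rightarrow> real^'n) \<Rightarrow> real^'n \<Rightarrow> real^'n" where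
  "lie_bracket X Y x =
     frechet_derivative Y (at x) (X x) - frechet_derivative X (at x) (Y x)"

inductive_set iterated_brackets ::
    "('k \<Rightarrow> real^'n::finite \<Rightarrow> real^'n) \<Rightarrow> (real^'n \<Rightarrow> real^'n) set"
  for F :: "'k \<Rightarrow> real^'n::finite \<Rightarrow> real^'n" where
  base: "F i \<in> iterated_brackets F"
| bracket: "X \<in> iterated_brackets F \<Longrightarrow> lie_bracket (F i) X \<in> iterated_brackets F"

definition Lie ::
    "('k \<Rightarrow> real^'n::finite \<Rightarrow> real^'n) \<Rightarrow> (real^'n \<Rightarrow> real^'n) set" where
  "Lie F = {(\<lambda>x. \<Sum>X\<in>B. c X *\<^sub>R X x) | B c. finite B \<and> B \<subseteq> iterated_brackets F}"

text \<open>Suprema of nonnegative quantities are taken in \<^typ>\<open>ennreal\<close>, so that they are meaningful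
  for unbounded functions and vanish on the empty set.\<close>

definition C1_norm :: "(real^'n::finite) set \<Rightarrow> (real^'n \<Rightarrow> real^'n) \<Rightarrow> ennreal" where
  "C1_norm K X = (SUP x\<in>K. ennreal (norm (X x) + (\<Sum>i\<in>UNIV. norm (partial_deriv i X x))))"

definition Lie_bounded ::
    "real \<Rightarrow> (real^'n::finite) set \<Rightarrow> ('k \<Rightarrow> real^'n \<Rightarrow> real^'n) \<Rightarrow> (real^'n \<Rightarrow> real^'n) set" where
  "Lie_bounded \<delta> K F = {X \<in> Lie F. C1_norm K X \<le> ennreal \<delta>}"

definition Lie_strong_approximating :: "('k \<Rightarrow> real^'n::finite \<Rightarrow> real^'n) \<Rightarrow> bool" where
  "Lie_strong_approximating F \<longleftrightarrow>
     (\<exists>m\<ge>1. \<forall>Y :: real^'n \<Rightarrow> real^'n. Ck_on m Y UNIV \<longrightarrow>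
        (\<forall>K. compact K \<longrightarrow>
          (\<exists>\<delta>>0. (INF X\<in>Lie_bounded \<delta> K F. SUP x\<in>K. ennreal (norm (X x - Y x))) = 0)))"


section \<open>Flows of linear-control systems\<close>

text \<open>The elements of a division are compact intervals \<open>k = {Inf k..Sup k}\<close> with pairwise disjoint
  interiors, so this is the usual \<open>\<epsilon>\<close>-\<open>\<delta>\<close> definition.\<close>

definition absolutely_continuous_on :: "real set \<Rightarrow> (real \<Rightarrow> 'a::real_normed_vector) \<Rightarrow> bool" where
  "absolutely_continuous_on S f \<longleftrightarrow>
     (\<forall>\<epsilon>>0. \<exists>\<delta>>0. \<forall>d t. d division_of t \<and> t \<subseteq> S \<and> (\<Sum>k\<in>d. Sup k - Inf k) < \<delta> \<longrightarrow>
        (\<Sum>k\<in>d. norm (f (Sup k) - f (Inf k))) < \<epsilon>)"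

definition L2_control :: "(real \<Rightarrow> real^'k::finite) \<Rightarrow> bool" where
  "L2_control u \<longleftrightarrow>
     u \<in> borel_measurable (lebesgue_on {0..1}) \<and>
     integrable (lebesgue_on {0..1}) (\<lambda>t. (norm (u t))\<^sup>2)"

definition trajectory ::
    "('k::finite \<Rightarrow> real^'n::finite \<Rightarrow> real^'n) \<Rightarrow> (real \<Rightarrow> real^'k) \<Rightarrow> real^'n \<Rightarrow>
     (real \<Rightarrow> real^'n) \<Rightarrow> bool" where
  "trajectory F u x0 x \<longleftrightarrow>
     absolutely_continuous_on {0..1} x \<and> x 0 = x0 \<and>
     (AE t in lebesgue_on {0..1}.
        (x has_vector_derivative (\<Sum>i\<in>UNIV. (u t $ i) *\<^sub>R F i (x t))) (at t within {0..1}))"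

definition flow ::
    "('k::finite \<Rightarrow> real^'n::finite \<Rightarrow> real^'n) \<Rightarrow> (real \<Rightarrow> real^'k) \<Rightarrow> real^'n \<Rightarrow> real^'n" where
  "flow F u x0 = (THE y. \<exists>x. trajectory F u x0 x \<and> x 1 = y)"

end

(* A continuous optimal map T is monotone: exchanging the targets of x and y wherever
   (T x - T y) . (x - y) < 0 would lower the cost. Mollifying T and adding a small multiple of the
   identity gives a Lipschitz, strongly monotone map S close to T. The segments t |-> x + t (S x - x) stay
   apart, hence their velocities extend to a field v, Lipschitz in time and space. The fields X for which
   Id + h X + o(h) is the final-time flow of a bounded control, locally uniformly, form a closed convex
   cone containing +F_i and -F_i and closed under brackets with them, since conjugating by exp(s F_i)
   replaces X by X + s [F_i, X] + o(s). By the approximating property the cone contains every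
   continuous field, in particular v(t, .), and an Euler scheme along v reaches S up to a small error. *)

theory Submission
  imports Defs
begin

section \<open>Absolutely continuous functions\<close>

text \<open>\<open>flow\<close> is a definite description over absolutely continuous curves that
  solve the equation almost everywhere. Exhibiting one good path is therefore not enough: every
  competitor must be shown to end at the same point, and this calls for a mean value inequality and
  a Gronwall argument at that level of regularity. Brackets are reached in a form linear in the
  step. The conjugation time s is fixed first and only then does h tend to 0, so that subtracting X
  leaves h (s [G, X] + o(s)), and dividing by s gives a bracket step of size h; a commutator of two
  flows of duration h would only give h^2. This order of limits is why errors are recorded as an
  explicit fraction \<open>e\<close> of h: the conjugation must deliver an error
  \<open>e * s\<close> that survives the division. It also asks for steps along -X, which a cone
  does not supply by itself, so both signs travel together through the induction on brackets. The
  target field is constant along the segments to be followed, so the Euler scheme makes no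
  consistency error on them; only the defects of the individual steps accumulate.\<close>

lemma absolutely_continuous_on_subset:
  "absolutely_continuous_on S f \<Longrightarrow> T \<subseteq> S \<Longrightarrow> absolutely_continuous_on T f"
  unfolding absolutely_continuous_on_def by (meson order_trans)

lemma absolutely_continuous_on_diff:
  assumes "absolutely_continuous_on S f" "absolutely_continuous_on S g"
  shows "absolutely_continuous_on S (\<lambda>t. f t - g t)"
  unfolding absolutely_continuous_on_def
proof (intro allI impI)
  fix \<epsilon> :: real assume "\<epsilon> > 0"
  then have "\<epsilon>/2 > 0" by simp
  obtain d1 where d1: "d1 > 0" "\<And>d t. d division_of t \<Longrightarrow> t \<subseteq> S \<Longrightarrow> (\<Sum>k\<in>d. Sup k - Inf k) < d1 \<Longrightarrow>
        (\<Sum>k\<in>d. norm (f (Sup k) - f (Inf k))) < \<epsilon>/2"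
    using assms(1) \<open>\<epsilon>/2 > 0\<close> unfolding absolutely_continuous_on_def by metis
  obtain d2 where d2: "d2 > 0" "\<And>d t. d division_of t \<Longrightarrow> t \<subseteq> S \<Longrightarrow> (\<Sum>k\<in>d. Sup k - Inf k) < d2 \<Longrightarrow>
        (\<Sum>k\<in>d. norm (g (Sup k) - g (Inf k))) < \<epsilon>/2"
    using assms(2) \<open>\<epsilon>/2 > 0\<close> unfolding absolutely_continuous_on_def by metis
  show "\<exists>\<delta>>0. \<forall>d t. d division_of t \<and> t \<subseteq> S \<and> (\<Sum>k\<in>d. Sup k - Inf k) < \<delta> \<longrightarrow>
           (\<Sum>k\<in>d. norm (f (Sup k) - g (Sup k) - (f (Inf k) - g (Inf k)))) < \<epsilon>"
  proof (intro exI[of _ "min d1 d2"] conjI allI impI)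
    fix d t assume *: "d division_of t \<and> t \<subseteq> S \<and> (\<Sum>k\<in>d. Sup k - Inf k) < min d1 d2"
    have "(\<Sum>k\<in>d. norm (f (Sup k) - g (Sup k) - (f (Inf k) - g (Inf k)))) \<le>
       (\<Sum>k\<in>d. norm (f (Sup k) - f (Inf k)) + norm (g (Sup k) - g (Inf k)))"
    proof (intro sum_mono)
      fix k
      have "f (Sup k) - g (Sup k) - (f (Inf k) - g (Inf k)) = (f (Sup k) - f (Inf k)) - (g (Sup k) - g (Inf k))"
        by simp
      then show "norm (f (Sup k) - g (Sup k) - (f (Inf k) - g (Inf k))) \<le>
          norm (f (Sup k) - f (Inf k)) + norm (g (Sup k) - g (Inf k))"
        by (metis norm_triangle_ineq4)
    qed
    also have "\<dots> < \<epsilon>"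
      using d1(2)[of d t] d2(2)[of d t] * by (simp add: sum.distrib)
    finally show "(\<Sum>k\<in>d. norm (f (Sup k) - g (Sup k) - (f (Inf k) - g (Inf k)))) < \<epsilon>" .
  qed (use d1 d2 in auto)
qed

lemma absolutely_continuous_on_lipschitz:
  fixes f :: "real \<Rightarrow> 'a::real_normed_vector"
  assumes "M-lipschitz_on S f"
  shows "absolutely_continuous_on S f"
  unfolding absolutely_continuous_on_def
proof (intro allI impI)
  fix \<epsilon> :: real assume e: "\<epsilon> > 0"
  have M: "M \<ge> 0" using assms lipschitz_on_nonneg by blast
  show "\<exists>\<delta>>0. \<forall>d t. d division_of t \<and> t \<subseteq> S \<and> (\<Sum>k\<in>d. Sup k - Inf k) < \<delta> \<longrightarrow>
           (\<Sum>k\<in>d. norm (f (Sup k) - f (Inf k))) < \<epsilon>"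
  proof (intro exI[of _ "\<epsilon> / (M+1)"] conjI allI impI)
    fix d t assume *: "d division_of t \<and> t \<subseteq> S \<and> (\<Sum>k\<in>d. Sup k - Inf k) < \<epsilon> / (M+1)"
    have "(\<Sum>k\<in>d. norm (f (Sup k) - f (Inf k))) \<le> (\<Sum>k\<in>d. M * (Sup k - Inf k))"
    proof (intro sum_mono)
      fix k assume k: "k \<in> d"
      then obtain a b where ab: "k = cbox a b" "k \<noteq> {}" "k \<subseteq> t"
        using * k division_ofD(2,3,4)[of d t k] by metis
      then have "a \<le> b" by simp
      then have "a \<in> k" "b \<in> k" "Sup k = b" "Inf k = a" using ab by auto
      then show "norm (f (Sup k) - f (Inf k)) \<le> M * (Sup k - Inf k)"
        using lipschitz_onD[OF assms, of b a] * ab \<open>a \<le> b\<close> by (force simp: dist_norm)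
    qed
    also have "\<dots> = M * (\<Sum>k\<in>d. Sup k - Inf k)" by (simp add: sum_distrib_left)
    also have "\<dots> \<le> M * (\<epsilon> / (M+1))" using * M by (intro mult_left_mono) auto
    also have "\<dots> < \<epsilon>" using M e by (simp add: field_simps)
    finally show "(\<Sum>k\<in>d. norm (f (Sup k) - f (Inf k))) < \<epsilon>" .
  qed (use e M in auto)
qed

text \<open>Cousin's lemma: intervals tagged in the exceptional null set are controlled by absolute
  continuity, the others by the derivative bound.\<close>

lemma absolutely_continuous_mean_value:
  fixes f :: "real \<Rightarrow> 'a::real_normed_vector"
  assumes ac: "absolutely_continuous_on {a..b} f" and "a \<le> b" and N: "negligible N"
    and c: "0 \<le> c"
    and der: "\<And>t. t \<in> {a..b} - N \<Longrightarrow>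
               \<exists>D. norm D \<le> c \<and> (f has_vector_derivative D) (at t within {a..b})"
  shows "norm (f b - f a) \<le> c * (b - a)"
proof (rule field_le_epsilon)
  fix e :: real assume "e > 0"
  \<comment> \<open>The slope error sums to at most \<open>e/2\<close> over the whole interval; the
    \<open>+ 1\<close> covers the case \<open>a = b\<close>.\<close>
  define e1 where "e1 = e / (2 * (b - a + 1))"
  have e1: "e1 > 0" "e1 * (b - a) \<le> e/2"
    using \<open>e > 0\<close> \<open>a \<le> b\<close> by (auto simp: e1_def field_simps)
  obtain \<delta> where \<delta>: "\<delta> > 0" "\<And>d t. d division_of t \<Longrightarrow> t \<subseteq> {a..b} \<Longrightarrow> (\<Sum>k\<in>d. Sup k - Inf k) < \<delta> \<Longrightarrow>
        (\<Sum>k\<in>d. norm (f (Sup k) - f (Inf k))) < e/2"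
    using ac \<open>e > 0\<close> unfolding absolutely_continuous_on_def by (meson half_gt_zero)
  have Nl: "N \<in> sets lebesgue" "emeasure lebesgue N = 0"
    using N by (auto simp: negligible_iff_null_sets)
  \<comment> \<open>Intervals tagged in \<open>N\<close> will be confined to \<open>G\<close>, so
    that their total length falls below the \<delta> of absolute continuity.\<close>
  obtain G where G: "open G" "N \<subseteq> G" "(G - N) \<in> lmeasurable" "emeasure lebesgue (G - N) < ennreal \<delta>"
    using sets_lebesgue_outer_open[OF Nl(1) \<delta>(1)] by blast
  have Gm: "G \<in> sets lebesgue" using G(1) by auto
  have "emeasure lebesgue G \<le> emeasure lebesgue N + emeasure lebesgue (G - N)"
    using emeasure_subadditive[of N lebesgue "G - N"] Nl G Gm
    by (metis Diff_partition fmeasurableD)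
  then have Ge: "emeasure lebesgue G < ennreal \<delta>" using G Nl by simp
  have Gl: "G \<in> lmeasurable" using Ge Gm by (simp add: fmeasurable_def order_less_trans)
  have Gd: "measure lebesgue G < \<delta>"
    using Ge \<delta>(1) by (metis emeasure_eq_measure2 Gl ennreal_less_iff measure_nonneg)
  have "\<exists>r>0. \<forall>y\<in>{a..b} \<inter> ball x r. \<exists>D. norm D \<le> c \<and> norm (f y - f x - (y - x) *\<^sub>R D) \<le> e1 * \<bar>y - x\<bar>"
    if x: "x \<in> {a..b} - N" for x
  proof -
    obtain D where D: "norm D \<le> c" "(f has_vector_derivative D) (at x within {a..b})" using der[OF x] by blast
    then obtain r where "r > 0" "\<And>y. y \<in> {a..b} \<Longrightarrow> norm (y - x) < r \<Longrightarrow> norm (f y - f x - (y - x) *\<^sub>R D) \<le> e1 * norm (y - x)"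
      using e1(1) unfolding has_vector_derivative_def has_derivative_within_alt by (metis real_norm_def)
    with D(1) show ?thesis by (intro exI[of _ r]) (auto simp: dist_norm norm_minus_commute abs_minus_commute)
  qed
  then obtain r where r: "\<And>x. x \<in> {a..b} - N \<Longrightarrow> r x > 0"
     "\<And>x y. x \<in> {a..b} - N \<Longrightarrow> y\<in>{a..b} \<inter> ball x (r x) \<Longrightarrow> \<exists>D. norm D \<le> c \<and> norm (f y - f x - (y - x) *\<^sub>R D) \<le> e1 * \<bar>y - x\<bar>"
    by metis
  \<comment> \<open>Outside \<open>{a..b}\<close> there are no tags; the unit ball only completes
    the gauge.\<close>
  define g where "g x = (if x \<in> N then G else if x \<in> {a..b} then ball x (r x) else ball x 1)" for x
  have "gauge g" unfolding gauge_def g_def using G r by auto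
  then obtain p where p: "p tagged_division_of {a..b}" "g fine p"
    using fine_division_exists_real by blast
  have fp: "finite p" using p by blast
  define pN where "pN = {q\<in>p. fst q \<in> N}"
  define pC where "pC = {q\<in>p. fst q \<notin> N}"
  have split: "p = pN \<union> pC" "pN \<inter> pC = {}" "finite pN" "finite pC" using fp by (auto simp: pN_def pC_def)
  have box: "\<exists>u v. k = {u..v} \<and> u \<le> v \<and> a \<le> u \<and> v \<le> b \<and> x \<in> {u..v} \<and> Sup k = v \<and> Inf k = u" if xk: "(x,k) \<in> p" for x k
  proof -
    obtain u v where "k = cbox u v" using tagged_division_ofD(4)[OF p(1) xk] by blast
    moreover have "x \<in> k" "k \<subseteq> {a..b}" using tagged_division_ofD(2,3)[OF p(1) xk] by auto
    ultimately show ?thesis by (intro exI[of _ u] exI[of _ v]) auto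
  qed
  have "f b - f a = (\<Sum>(x,k)\<in>p. f (Sup k) - f (Inf k))"
    using additive_tagged_division_1[OF \<open>a \<le> b\<close> p(1)] by metis
  also have "norm \<dots> \<le> (\<Sum>(x,k)\<in>p. norm (f (Sup k) - f (Inf k)))"
    by (rule sum_norm_le) auto
  also have "\<dots> = (\<Sum>(x,k)\<in>pN. norm (f (Sup k) - f (Inf k))) + (\<Sum>(x,k)\<in>pC. norm (f (Sup k) - f (Inf k)))"
    unfolding split(1) using split by (intro sum.union_disjoint) auto
  also have "(\<Sum>(x,k)\<in>pC. norm (f (Sup k) - f (Inf k))) \<le> (\<Sum>(x,k)\<in>pC. (c + e1) * (Sup k - Inf k))"
  proof (rule sum_mono, clarify)
    fix x k assume "(x,k) \<in> pC"
    then have xk: "(x,k) \<in> p" "x \<notin> N" by (auto simp: pC_def)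
    obtain u v where uv: "k = {u..v}" "u \<le> v" "a \<le> u" "v \<le> b" "x \<in> {u..v}" "Sup k = v" "Inf k = u" using box[OF xk(1)] by blast
    have xab: "x \<in> {a..b} - N" using uv xk by auto
    have "k \<subseteq> ball x (r x)" using fineD[OF p(2) xk(1)] xab by (auto simp: g_def)
    moreover have "u \<in> k" "v \<in> k" using uv by auto
    ultimately have "u \<in> ball x (r x)" "v \<in> ball x (r x)" by blast+
    then have uvb: "u \<in> {a..b} \<inter> ball x (r x)" "v \<in> {a..b} \<inter> ball x (r x)" using uv by auto
    have est: "norm (f y - f x) \<le> (c + e1) * \<bar>y - x\<bar>" if y: "y \<in> {a..b} \<inter> ball x (r x)" for y
    proof -
      obtain D where D: "norm D \<le> c" "norm (f y - f x - (y - x) *\<^sub>R D) \<le> e1 * \<bar>y - x\<bar>" using r(2)[OF xab y] by blast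
      have "norm (f y - f x) \<le> norm (f y - f x - (y - x) *\<^sub>R D) + norm ((y - x) *\<^sub>R D)"
        by (metis norm_triangle_sub add.commute)
      also have "\<dots> \<le> e1 * \<bar>y - x\<bar> + \<bar>y - x\<bar> * c" using D by (simp add: mult_left_mono add_mono)
      finally show ?thesis by (simp add: algebra_simps)
    qed
    \<comment> \<open>The tag lies between the endpoints, so its distances to them add up to the
      length of the interval.\<close>
    have "norm (f v - f u) \<le> norm (f v - f x) + norm (f u - f x)"
      by (metis dist_norm dist_triangle dist_commute)
    also have "\<dots> \<le> (c + e1) * \<bar>v - x\<bar> + (c + e1) * \<bar>u - x\<bar>" using est uvb by (intro add_mono) auto
    also have "\<dots> = (c + e1) * (v - u)" using uv by (simp add: algebra_simps)
    finally show "norm (f (Sup k) - f (Inf k)) \<le> (c + e1) * (Sup k - Inf k)" using uv by simp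
  qed
  also have "(\<Sum>(x,k)\<in>pC. (c + e1) * (Sup k - Inf k)) \<le> (\<Sum>(x,k)\<in>p. (c + e1) * (Sup k - Inf k))"
  proof (rule sum_mono2[OF fp])
    fix q assume "q \<in> p - pC"
    moreover obtain x k where "q = (x,k)" by (cases q)
    ultimately have "Inf k \<le> Sup k" using box[of x k] by auto
    then show "0 \<le> (case q of (x, k) \<Rightarrow> (c + e1) * (Sup k - Inf k))"
      using e1 c \<open>q = (x,k)\<close> by simp
  qed (use split in auto)
  also have "\<dots> = (c + e1) * (\<Sum>(x,k)\<in>p. Sup k - Inf k)" by (simp add: sum_distrib_left case_prod_unfold)
  also have "(\<Sum>(x,k)\<in>p. Sup k - Inf k) = b - a"
    using additive_tagged_division_1[OF \<open>a \<le> b\<close> p(1), of "\<lambda>x. x"] by simp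
  also have "(\<Sum>(x,k)\<in>pN. norm (f (Sup k) - f (Inf k))) < e/2"
  proof -
    have tp: "pN tagged_partial_division_of {a..b}"
      using p(1) tagged_partial_division_subset[of p "{a..b}" pN] split by (auto simp: tagged_division_of_def)
    define U where "U = \<Union>(snd ` pN)"
    have d: "snd ` pN division_of U" unfolding U_def by (rule partial_division_of_tagged_division[OF tp])
    have td: "pN tagged_division_of U" unfolding U_def by (rule tagged_partial_division_of_Union_self[OF tp])
    \<comment> \<open>Distinct tags could in principle share an interval. Passing from tags to
      intervals is possible for a function vanishing on degenerate intervals, whence the value 0 on
      the empty set, where \<open>Sup\<close> and \<open>Inf\<close> carry no information.\<close>
    define w where "w k = (if k = {} then 0 else norm (f (Sup k) - f (Inf k)))" for k
    have "(\<Sum>(x,k)\<in>pN. norm (f (Sup k) - f (Inf k))) = (\<Sum>(x,k)\<in>pN. w k)"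
      using box by (intro sum.cong) (fastforce simp: w_def pN_def)+
    also have "\<dots> = (\<Sum>k\<in>snd ` pN. w k)"
    proof (rule sum.over_tagged_division_lemma[OF td])
      fix u v :: real assume "box u v = {}"
      then show "w (cbox u v) = 0" by (cases "u = v") (auto simp: w_def)
    qed
    also have "\<dots> = (\<Sum>k\<in>snd ` pN. norm (f (Sup k) - f (Inf k)))"
      using division_ofD(3)[OF d] by (intro sum.cong) (auto simp: w_def)
    also have "\<dots> < e/2"
    proof (rule \<delta>(2)[OF d])
      show "U \<subseteq> {a..b}" using tagged_partial_division_ofD(3)[OF tp] unfolding U_def by force
      have "(\<Sum>k\<in>snd ` pN. Sup k - Inf k) = (\<Sum>k\<in>snd ` pN. measure lebesgue k)"
      proof (rule sum.cong[OF refl])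
        fix k assume "k \<in> snd ` pN"
        then obtain x where "(x,k) \<in> p" unfolding pN_def by auto
        then obtain u v where "k = {u..v}" "u \<le> v" using box by meson
        then show "Sup k - Inf k = measure lebesgue k" by simp
      qed
      also have "\<dots> = measure lebesgue U" by (rule content_division[OF d])
      also have "\<dots> \<le> measure lebesgue G"
      proof (rule measure_mono_fmeasurable[OF _ _ Gl])
        have "k \<subseteq> G" if "(x,k) \<in> pN" for x k
          using fineD[OF p(2), of x k] that by (auto simp: pN_def g_def split: if_splits)
        then show "U \<subseteq> G" unfolding U_def by force
        show "U \<in> sets lebesgue" using lmeasurable_division[OF d] by auto
      qed
      finally show "(\<Sum>k\<in>snd ` pN. Sup k - Inf k) < \<delta>" using Gd by simp
    qed
    finally show ?thesis .
  qed
  finally have "norm (f b - f a) \<le> e/2 + (c + e1) * (b - a)" by simp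
  also have "\<dots> \<le> c * (b - a) + e" using e1 by (simp add: algebra_simps)
  finally show "norm (f b - f a) \<le> c * (b - a) + e" .
qed

text \<open>On intervals shorter than \<open>1 / B\<close> the mean value inequality bounds the supremum of
  \<open>norm d\<close> by a proper fraction of itself.\<close>

lemma absolutely_continuous_gronwall_zero:
  fixes d :: "real \<Rightarrow> 'a::real_normed_vector"
  assumes ac: "absolutely_continuous_on {0..1} d" and cont: "continuous_on {0..1} d"
    and N: "negligible N" and d0: "d 0 = 0" and B: "0 \<le> B"
    and der: "\<And>t. t \<in> {0..1} - N \<Longrightarrow>
               \<exists>D. norm D \<le> B * norm (d t) \<and> (d has_vector_derivative D) (at t within {0..1})"
  shows "d 1 = 0"
proof -
  \<comment> \<open>On an interval of length \<open>1 / n\<close> the mean value inequality gains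
    the factor \<open>B / n\<close>, which is below 1; the unit interval is then covered in
    \<open>n\<close> steps.\<close>
  obtain n :: nat where n: "B < real n" using reals_Archimedean2 by blast
  have npos: "0 < real n" using n B by linarith
  have "\<forall>t\<in>{0..real j / real n}. t \<le> 1 \<longrightarrow> d t = 0" for j
  proof (induction j)
    case 0 then show ?case using d0 by auto
  next
    case (Suc j)
    show ?case
    proof (cases "real j / real n < 1")
      case False
      then show ?thesis using Suc by auto
    next
      case True
      define a where "a = real j / real n"
      define b where "b = min 1 (real (Suc j) / real n)"
      have ab: "0 \<le> a" "a \<le> b" "b \<le> 1" "b - a \<le> 1 / real n" "a < 1"
        using npos True by (auto simp: a_def b_def min_def add_divide_distrib diff_divide_distrib)
      have da: "d a = 0" using Suc ab unfolding a_def by auto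
      have "continuous_on {a..b} (\<lambda>t. norm (d t))"
        using ab by (intro continuous_on_norm continuous_on_subset[OF cont]) auto
      then obtain s where s: "s \<in> {a..b}" "\<And>t. t \<in> {a..b} \<Longrightarrow> norm (d t) \<le> norm (d s)"
        using continuous_attains_sup[of "{a..b}" "\<lambda>t. norm (d t)"] ab by auto
      have "norm (d s - d a) \<le> B * norm (d s) * (s - a)"
      proof (rule absolutely_continuous_mean_value[OF _ _ N])
        show "absolutely_continuous_on {a..s} d"
          using s ab by (intro absolutely_continuous_on_subset[OF ac]) auto
        fix t assume t: "t \<in> {a..s} - N"
        then have "t \<in> {0..1} - N" using s ab by auto
        then obtain D where D: "norm D \<le> B * norm (d t)" "(d has_vector_derivative D) (at t within {0..1})" using der by blast
        have "norm D \<le> B * norm (d s)"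
          using D(1) mult_left_mono[OF s(2)[of t] B] t s by auto
        moreover have "(d has_vector_derivative D) (at t within {a..s})"
          using D(2) s ab by (auto intro: has_vector_derivative_within_subset)
        ultimately show "\<exists>D. norm D \<le> B * norm (d s) \<and> (d has_vector_derivative D) (at t within {a..s})" by blast
      qed (use s B in auto)
      also have "\<dots> \<le> B * norm (d s) * (1 / real n)"
        using s ab B by (intro mult_left_mono) auto
      finally have "norm (d s) * real n \<le> norm (d s) * B"
        using da npos by (simp add: field_simps)
      then have "norm (d s) = 0" using n by (metis mult_le_cancel_left_pos not_less norm_ge_zero less_eq_real_def)
      then have "d t = 0" if "t \<in> {a..b}" for t using s(2)[OF that] by simp
      then show ?thesis using Suc unfolding a_def b_def by force
    qed
  qed
  from this[of n] show ?thesis using npos by auto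
qed

lemma absolutely_continuous_imp_continuous_on:
  fixes f :: "real \<Rightarrow> 'a::real_normed_vector"
  assumes "absolutely_continuous_on {a..b} f"
  shows "continuous_on {a..b} f"
  unfolding continuous_on_iff
proof (intro ballI allI impI)
  fix s and e :: real assume s: "s \<in> {a..b}" and "e > 0"
  then obtain \<delta> where \<delta>: "\<delta> > 0" "\<And>d t. d division_of t \<Longrightarrow> t \<subseteq> {a..b} \<Longrightarrow> (\<Sum>k\<in>d. Sup k - Inf k) < \<delta> \<Longrightarrow>
        (\<Sum>k\<in>d. norm (f (Sup k) - f (Inf k))) < e"
    using assms unfolding absolutely_continuous_on_def by meson
  \<comment> \<open>A single interval is a division of itself.\<close>
  have *: "norm (f v - f u) < e" if "a \<le> u" "u \<le> v" "v \<le> b" "v - u < \<delta>" for u v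
    using \<delta>(2)[of "{cbox u v}" "cbox u v"] that by (auto simp: division_of_def)
  show "\<exists>d>0. \<forall>t\<in>{a..b}. dist t s < d \<longrightarrow> dist (f t) (f s) < e"
  proof (intro exI[of _ \<delta>] conjI ballI impI \<delta>(1))
    fix t assume "t \<in> {a..b}" "dist t s < \<delta>"
    with s *[of s t] *[of t s] show "dist (f t) (f s) < e"
      by (cases "s \<le> t") (auto simp: dist_norm norm_minus_commute)
  qed
qed

section \<open>Controls and reachable maps\<close>

text \<open>A stronger notion than \<open>trajectory\<close>, made for constructions: the Lipschitz
  bound and the finite exceptional set both pass to concatenations, where an almost everywhere
  statement would need measure theory each time.\<close>

definition control_path ::
    "('k::finite \<Rightarrow> real^'n::finite \<Rightarrow> real^'n) \<Rightarrow> (real \<Rightarrow> real^'k) \<Rightarrow> (real \<Rightarrow> real^'n) \<Rightarrow> bool" where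
  "control_path F u y \<longleftrightarrow> (\<exists>M. M-lipschitz_on {0..1} y) \<and>
     (\<exists>N. finite N \<and> (\<forall>t\<in>{0<..<1} - N.
        (y has_vector_derivative (\<Sum>i\<in>UNIV. (u t $ i) *\<^sub>R F i (y t))) (at t)))"

text \<open>One control serves all starting points. Boundedness supplies the constant of the
  Gronwall argument and gives square integrability; Borel measurability on the whole line survives
  the changes of time in a concatenation. Avoiding \<open>flow\<close> here lets maps be composed
  without appeal to uniqueness.\<close>

definition reachable ::
    "('k::finite \<Rightarrow> real^'n::finite \<Rightarrow> real^'n) \<Rightarrow> (real^'n \<Rightarrow> real^'n) set" where
  "reachable F = {\<phi>. \<exists>u B. u \<in> borel_measurable borel \<and> (\<forall>t. norm (u t) \<le> B) \<and>
     (\<forall>x. \<exists>y. control_path F u y \<and> y 0 = x \<and> y 1 = \<phi> x)}"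

lemma control_path_imp_trajectory:
  assumes "control_path F u y"
  shows "trajectory F u (y 0) y"
proof -
  obtain M where M: "M-lipschitz_on {0..1} y" using assms unfolding control_path_def by blast
  obtain N where N: "finite N" "\<And>t. t\<in>{0<..<1} - N \<Longrightarrow>
      (y has_vector_derivative (\<Sum>i\<in>UNIV. (u t $ i) *\<^sub>R F i (y t))) (at t)"
    using assms unfolding control_path_def by blast
  have "AE t in lebesgue. t \<in> {0..1} \<longrightarrow>
        (y has_vector_derivative (\<Sum>i\<in>UNIV. (u t $ i) *\<^sub>R F i (y t))) (at t within {0..1})"
  proof (rule AE_I')
    \<comment> \<open>A control path is differentiated at interior times only, so the endpoints join
      the exceptional set.\<close>
    show "N \<union> {0,1} \<in> null_sets lebesgue"
      using N(1) by (simp add: negligible_iff_null_sets[symmetric] negligible_finite)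
    show "{t \<in> space lebesgue. \<not> (t \<in> {0..1} \<longrightarrow>
        (y has_vector_derivative (\<Sum>i\<in>UNIV. (u t $ i) *\<^sub>R F i (y t))) (at t within {0..1}))} \<subseteq> N \<union> {0,1}"
      using N(2) by (fastforce intro: has_vector_derivative_at_within)
  qed
  then show ?thesis
    unfolding trajectory_def using absolutely_continuous_on_lipschitz[OF M]
    by (simp add: AE_restrict_space_iff)
qed

text \<open>The difference of two trajectories has a derivative at most \<open>B\<close> times the
  sum of the Lipschitz constants times its own norm, almost everywhere; Gronwall then makes it
  vanish. This gives the description in \<open>flow\<close> its unique value.\<close>

lemma trajectory_unique:
  fixes F :: "'k::finite \<Rightarrow> real^'n::finite \<Rightarrow> real^'n"
  assumes lip: "\<And>i. \<exists>L. L-lipschitz_on UNIV (F i)" and B: "\<And>t. norm (u t) \<le> B"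
    and y: "trajectory F u x y" and z: "trajectory F u x z"
  shows "y 1 = z 1"
proof -
  obtain L where L: "\<And>i. (L i)-lipschitz_on UNIV (F i)" using lip by metis
  have L0: "L i \<ge> 0" for i using L lipschitz_on_nonneg by blast
  have B0: "B \<ge> 0" using B[of 0] norm_ge_zero order_trans by blast
  let ?f = "\<lambda>t w. (\<Sum>i\<in>UNIV. (u t $ i) *\<^sub>R F i w)"
  have "AE t in lebesgue. t \<in> {0..1} \<longrightarrow> (y has_vector_derivative ?f t (y t)) (at t within {0..1}) \<and>
      (z has_vector_derivative ?f t (z t)) (at t within {0..1})"
    using y z unfolding trajectory_def by (auto simp: AE_restrict_space_iff)
  then obtain N where N: "{t\<in>space lebesgue. \<not> (t \<in> {0..1} \<longrightarrow> (y has_vector_derivative ?f t (y t)) (at t within {0..1}) \<and>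
      (z has_vector_derivative ?f t (z t)) (at t within {0..1}))} \<subseteq> N" "N \<in> null_sets lebesgue"
    by (rule AE_E) (meson null_setsI)
  let ?d = "\<lambda>t. y t - z t"
  have ac: "absolutely_continuous_on {0..1} ?d"
    using y z unfolding trajectory_def by (intro absolutely_continuous_on_diff) auto
  have "?d 1 = 0"
  proof (rule absolutely_continuous_gronwall_zero[OF ac absolutely_continuous_imp_continuous_on[OF ac]])
    show "negligible N" using N(2) by (simp add: negligible_iff_null_sets)
    show "y 0 - z 0 = 0" using y z unfolding trajectory_def by simp
    show "0 \<le> B * (\<Sum>i\<in>UNIV. L i)" using B0 L0 by (simp add: sum_nonneg)
    fix t assume t: "t \<in> {0..1} - N"
    have "(?d has_vector_derivative (?f t (y t) - ?f t (z t))) (at t within {0..1})"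
      using N(1) t by (intro has_vector_derivative_diff) auto
    moreover have "norm (?f t (y t) - ?f t (z t)) \<le> B * (\<Sum>i\<in>UNIV. L i) * norm (?d t)"
    proof -
      have "?f t (y t) - ?f t (z t) = (\<Sum>i\<in>UNIV. (u t $ i) *\<^sub>R (F i (y t) - F i (z t)))"
        by (simp add: sum_subtractf scaleR_diff_right)
      also have "norm \<dots> \<le> (\<Sum>i\<in>UNIV. B * (L i * norm (?d t)))"
      proof (rule sum_norm_le)
        fix i
        have "norm (u t $ i) \<le> B" using Finite_Cartesian_Product.norm_nth_le[of "u t" i] B[of t] by linarith
        moreover have "norm (F i (y t) - F i (z t)) \<le> L i * norm (?d t)"
          using lipschitz_onD[OF L[of i], of "y t" "z t"] by (simp add: dist_norm)
        ultimately show "norm ((u t $ i) *\<^sub>R (F i (y t) - F i (z t))) \<le> B * (L i * norm (?d t))"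
          using B0 by (simp add: mult_mono)
      qed
      also have "\<dots> = B * (\<Sum>i\<in>UNIV. L i) * norm (?d t)"
        by (simp add: sum_distrib_left sum_distrib_right mult.assoc)
      finally show ?thesis .
    qed
    ultimately show "\<exists>D. norm D \<le> B * (\<Sum>i\<in>UNIV. L i) * norm (?d t) \<and> (?d has_vector_derivative D) (at t within {0..1})"
      by blast
  qed
  then show ?thesis by simp
qed

lemma flow_control_path:
  fixes F :: "'k::finite \<Rightarrow> real^'n::finite \<Rightarrow> real^'n"
  assumes "\<And>i. \<exists>L. L-lipschitz_on UNIV (F i)" and "\<And>t. norm (u t) \<le> B"
    and "control_path F u y"
  shows "flow F u (y 0) = y 1"
  unfolding flow_def
proof (rule the_equality)
  show "\<exists>x. trajectory F u (y 0) x \<and> x 1 = y 1"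
    using control_path_imp_trajectory[OF assms(3)] by blast
  fix w assume "\<exists>x. trajectory F u (y 0) x \<and> x 1 = w"
  then obtain z where z: "trajectory F u (y 0) z" "z 1 = w" by blast
  show "w = y 1"
    using trajectory_unique[of F u B, OF assms(1,2) z(1) control_path_imp_trajectory[OF assms(3)]] z by simp
qed

lemma bounded_imp_L2_control:
  assumes u: "u \<in> borel_measurable borel" and B: "\<And>t. norm (u t) \<le> B"
  shows "L2_control u"
  unfolding L2_control_def
proof
  have "u \<in> borel_measurable lebesgue" using u by (simp add: measurable_completion)
  then show m: "u \<in> borel_measurable (lebesgue_on {0..1})" by (simp add: measurable_restrict_space1)
  have B0: "B \<ge> 0" using B[of 0] norm_ge_zero order_trans by blast
  have "finite_measure (lebesgue_on {0..1::real})"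
    by (rule finite_measureI) (simp add: emeasure_restrict_space)
  then show "integrable (lebesgue_on {0..1}) (\<lambda>t. (norm (u t))\<^sup>2)"
    using m B B0 by (intro finite_measure.integrable_const_bound[where B="B\<^sup>2"]) (auto intro!: AE_I2 power_mono)
qed

lemma reachableD:
  fixes F :: "'k::finite \<Rightarrow> real^'n::finite \<Rightarrow> real^'n"
  assumes lip: "\<And>i. \<exists>L. L-lipschitz_on UNIV (F i)" and "\<phi> \<in> reachable F"
  shows "\<exists>u. L2_control u \<and> flow F u = \<phi>"
proof -
  obtain u B where u: "u \<in> borel_measurable borel" "\<And>t. norm (u t) \<le> B"
     "\<And>x. \<exists>y. control_path F u y \<and> y 0 = x \<and> y 1 = \<phi> x"
    using assms(2) unfolding reachable_def by blast
  have "flow F u x = \<phi> x" for x using flow_control_path[of F u B, OF lip u(2)] u(3)[of x] by auto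
  then show ?thesis using bounded_imp_L2_control[of u B, OF u(1,2)] by blast
qed

text \<open>Each path is run at double speed, which doubles the control because the dynamics are
  linear in it. The exceptional set collects the two rescaled ones and the junction
  \<open>1/2\<close>.\<close>

lemma control_path_concat:
  assumes 1: "control_path F u1 y1" and 2: "control_path F u2 y2" and eq: "y1 1 = y2 0"
  shows "control_path F (\<lambda>t. if t < 1/2 then 2 *\<^sub>R u1 (2*t) else 2 *\<^sub>R u2 (2*t-1))
           (\<lambda>t. if t \<le> 1/2 then y1 (2*t) else y2 (2*t-1))" (is "control_path F ?u ?y")
proof -
  obtain M1 where M1: "M1-lipschitz_on {0..1} y1" using 1 unfolding control_path_def by blast
  obtain M2 where M2: "M2-lipschitz_on {0..1} y2" using 2 unfolding control_path_def by blast
  obtain N1 where N1: "finite N1" "\<And>t. t\<in>{0<..<1} - N1 \<Longrightarrow>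
      (y1 has_vector_derivative (\<Sum>i\<in>UNIV. (u1 t $ i) *\<^sub>R F i (y1 t))) (at t)"
    using 1 unfolding control_path_def by blast
  obtain N2 where N2: "finite N2" "\<And>t. t\<in>{0<..<1} - N2 \<Longrightarrow>
      (y2 has_vector_derivative (\<Sum>i\<in>UNIV. (u2 t $ i) *\<^sub>R F i (y2 t))) (at t)"
    using 2 unfolding control_path_def by blast
  define M where "M = 2 * max M1 M2"
  have M0: "M1 \<ge> 0" "M2 \<ge> 0" using M1 M2 lipschitz_on_nonneg by blast+
  have "M-lipschitz_on {0..1/2} (\<lambda>t. y1 (2*t))"
  proof (rule lipschitz_onI)
    fix s t :: real assume "s \<in> {0..1/2}" "t \<in> {0..1/2}"
    then have "dist (y1 (2 * s)) (y1 (2*t)) \<le> M1 * dist (2 * s) (2*t)" by (intro lipschitz_onD[OF M1]) auto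
    also have "\<dots> = (2*M1) * dist s t" by (simp add: dist_real_def abs_if algebra_simps)
    also have "\<dots> \<le> M * dist s t" by (intro mult_right_mono) (auto simp: M_def)
    finally show "dist (y1 (2 * s)) (y1 (2*t)) \<le> M * dist s t" .
  qed (use M0 in \<open>auto simp: M_def\<close>)
  moreover have "M-lipschitz_on {1/2..1} (\<lambda>t. y2 (2*t-1))"
  proof (rule lipschitz_onI)
    fix s t :: real assume "s \<in> {1/2..1}" "t \<in> {1/2..1}"
    then have "dist (y2 (2 * s-1)) (y2 (2*t-1)) \<le> M2 * dist (2 * s-1) (2*t-1)" by (intro lipschitz_onD[OF M2]) auto
    also have "\<dots> = (2*M2) * dist s t" by (simp add: dist_real_def abs_if algebra_simps)
    also have "\<dots> \<le> M * dist s t" by (intro mult_right_mono) (auto simp: M_def)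
    finally show "dist (y2 (2 * s-1)) (y2 (2*t-1)) \<le> M * dist s t" .
  qed (use M0 in \<open>auto simp: M_def\<close>)
  ultimately have "M-lipschitz_on {0..1} ?y"
    using eq by (intro lipschitz_on_concat) auto
  moreover have "\<exists>N. finite N \<and> (\<forall>t\<in>{0<..<1} - N.
        (?y has_vector_derivative (\<Sum>i\<in>UNIV. (?u t $ i) *\<^sub>R F i (?y t))) (at t))"
  proof (intro exI conjI ballI)
    let ?N = "(\<lambda>t. t/2) ` N1 \<union> (\<lambda>t. (t+1)/2) ` N2 \<union> {1/2}"
    show "finite ?N" using N1 N2 by auto
    fix t assume t: "t \<in> {0<..<1} - ?N"
    consider "t < 1/2" | "t > 1/2" using t by fastforce
    then show "(?y has_vector_derivative (\<Sum>i\<in>UNIV. (?u t $ i) *\<^sub>R F i (?y t))) (at t)"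
    proof cases
      case 1
      have "2*t \<in> N1 \<Longrightarrow> t \<in> (\<lambda>t. t/2) ` N1" by (rule image_eqI[of _ _ "2*t"]) auto
      then have "2*t \<notin> N1" using t by blast
      then have "(y1 has_vector_derivative (\<Sum>i\<in>UNIV. (u1 (2*t) $ i) *\<^sub>R F i (y1 (2*t)))) (at (2*t))"
        using t 1 by (intro N1) auto
      moreover have "((\<lambda>t. 2*t) has_vector_derivative 2) (at t)"
        by (auto intro!: derivative_eq_intros simp: has_real_derivative_iff_has_vector_derivative[symmetric])
      ultimately have "(y1 \<circ> (\<lambda>t. 2*t) has_vector_derivative (2::real) *\<^sub>R (\<Sum>i\<in>UNIV. (u1 (2*t) $ i) *\<^sub>R F i (y1 (2*t)))) (at t)"
        by (intro vector_diff_chain_at) auto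
      then have "(?y has_vector_derivative (2::real) *\<^sub>R (\<Sum>i\<in>UNIV. (u1 (2*t) $ i) *\<^sub>R F i (y1 (2*t)))) (at t)"
        by (rule has_vector_derivative_transform_within_open[where S="{..<1/2}"]) (use 1 in auto)
      then show ?thesis using 1 by (simp add: scaleR_sum_right)
    next
      case 2
      have "2*t-1 \<in> N2 \<Longrightarrow> t \<in> (\<lambda>t. (t+1)/2) ` N2" by (rule image_eqI[of _ _ "2*t-1"]) auto
      then have "2*t-1 \<notin> N2" using t by blast
      then have "(y2 has_vector_derivative (\<Sum>i\<in>UNIV. (u2 (2*t-1) $ i) *\<^sub>R F i (y2 (2*t-1)))) (at (2*t-1))"
        using t 2 by (intro N2) auto
      moreover have "((\<lambda>t. 2*t-1) has_vector_derivative 2) (at t)"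
        by (auto intro!: derivative_eq_intros simp: has_real_derivative_iff_has_vector_derivative[symmetric])
      ultimately have "(y2 \<circ> (\<lambda>t. 2*t-1) has_vector_derivative (2::real) *\<^sub>R (\<Sum>i\<in>UNIV. (u2 (2*t-1) $ i) *\<^sub>R F i (y2 (2*t-1)))) (at t)"
        by (intro vector_diff_chain_at) auto
      then have "(?y has_vector_derivative (2::real) *\<^sub>R (\<Sum>i\<in>UNIV. (u2 (2*t-1) $ i) *\<^sub>R F i (y2 (2*t-1)))) (at t)"
        by (rule has_vector_derivative_transform_within_open[where S="{1/2<..}"]) (use 2 in auto)
      then show ?thesis using 2 by (simp add: scaleR_sum_right)
    qed
  qed
  ultimately show ?thesis unfolding control_path_def by blast
qed

lemma reachable_comp:
  assumes "\<phi> \<in> reachable F" "\<psi> \<in> reachable F"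
  shows "\<phi> \<circ> \<psi> \<in> reachable F"
proof -
  obtain u2 B2 where u2: "u2 \<in> borel_measurable borel" "\<And>t. norm (u2 t) \<le> B2"
     "\<And>x. \<exists>y. control_path F u2 y \<and> y 0 = x \<and> y 1 = \<phi> x"
    using assms(1) unfolding reachable_def by blast
  obtain u1 B1 where u1: "u1 \<in> borel_measurable borel" "\<And>t. norm (u1 t) \<le> B1"
     "\<And>x. \<exists>y. control_path F u1 y \<and> y 0 = x \<and> y 1 = \<psi> x"
    using assms(2) unfolding reachable_def by blast
  \<comment> \<open>The inner map \<psi> is performed first, hence its control occupies the first
    half.\<close>
  let ?u = "\<lambda>t. if t < 1/2 then 2 *\<^sub>R u1 (2*t) else 2 *\<^sub>R u2 (2*t-1)"
  have "?u \<in> borel_measurable borel" using u1(1) u2(1) by measurable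
  moreover have "norm (?u t) \<le> 2 * max B1 B2" for t
    using u1(2)[of "2*t"] u2(2)[of "2*t-1"] by auto
  moreover have "\<exists>y. control_path F ?u y \<and> y 0 = x \<and> y 1 = (\<phi> \<circ> \<psi>) x" for x
  proof -
    obtain y1 where y1: "control_path F u1 y1" "y1 0 = x" "y1 1 = \<psi> x" using u1(3) by blast
    obtain y2 where y2: "control_path F u2 y2" "y2 0 = \<psi> x" "y2 1 = \<phi> (\<psi> x)" using u2(3) by blast
    show ?thesis
      using control_path_concat[OF y1(1) y2(1)] y1 y2
      by (intro exI[of _ "\<lambda>t. if t \<le> 1/2 then y1 (2*t) else y2 (2*t-1)"]) auto
  qed
  ultimately show ?thesis unfolding reachable_def by blast
qed

lemma id_reachable: "(\<lambda>x. x) \<in> reachable F"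
proof -
  have "control_path F (\<lambda>t. 0) (\<lambda>t. x)" for x
    unfolding control_path_def
    by (intro conjI exI[of _ "0::real"] exI[of _ "{}"]) (auto intro: lipschitz_onI)
  then show ?thesis
    unfolding reachable_def by (intro CollectI exI[of _ "\<lambda>t. 0"] exI[of _ "0::real"]) auto
qed

text \<open>The bound \<open>1/2\<close> makes the Picard operator a contraction on the whole unit interval.\<close>

lemma lipschitz_ode_solution:
  fixes G :: "'a::euclidean_space \<Rightarrow> 'a"
  assumes L: "L-lipschitz_on UNIV G" and "L \<le> 1/2"
  shows "\<exists>y. y 0 = x \<and> (\<forall>t\<in>{0..1}. (y has_vector_derivative G (y t)) (at t within {0..1}))"
proof -
  \<comment> \<open>Clamping time turns curves on \<open>{0..1}\<close> into bounded continuous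
    functions on the whole line, a complete space on which the Picard operator can be
    iterated.\<close>
  define clamp :: "real \<Rightarrow> real" where "clamp t = max 0 (min 1 t)" for t
  have clamp: "clamp t \<in> {0..1}" "t \<in> {0..1} \<Longrightarrow> clamp t = t" for t by (auto simp: clamp_def)
  have cc: "continuous_on UNIV clamp" unfolding clamp_def by (intro continuous_intros)
  have L0: "L \<ge> 0" using L lipschitz_on_nonneg by blast
  have Gc: "continuous_on UNIV G" using lipschitz_on_continuous_on[OF L] .
  have Gf: "continuous_on S (\<lambda>s. G (apply_bcontfun f s))" for f :: "real \<Rightarrow>\<^sub>C 'a" and S
    by (intro continuous_on_compose2[OF Gc]) auto
  define P where "P f = (\<lambda>t. x + integral {0..clamp t} (\<lambda>s. G (apply_bcontfun f s)))" for f :: "real \<Rightarrow>\<^sub>C 'a"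
  have Pb: "P f \<in> bcontfun" for f
  proof -
    have c1: "continuous_on {0..1} (\<lambda>t. x + integral {0..t} (\<lambda>s. G (apply_bcontfun f s)))"
      by (intro continuous_intros indefinite_integral_continuous_1 integrable_continuous_real Gf)
    have "continuous_on UNIV (P f)"
      unfolding P_def by (rule continuous_on_compose2[OF c1 cc]) (use clamp in auto)
    moreover have "bounded (range (P f))"
    proof (rule bounded_subset)
      show "bounded ((\<lambda>t. x + integral {0..t} (\<lambda>s. G (apply_bcontfun f s))) ` {0..1})"
        by (intro compact_imp_bounded compact_continuous_image c1) auto
      show "range (P f) \<subseteq> (\<lambda>t. x + integral {0..t} (\<lambda>s. G (apply_bcontfun f s))) ` {0..1}"
        using clamp(1) by (auto simp: P_def)
    qed
    ultimately show ?thesis by (simp add: bcontfun_def)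
  qed
  define Q where "Q f = Bcontfun (P f)" for f
  have Q: "apply_bcontfun (Q f) = P f" for f unfolding Q_def using Pb by (simp add: Bcontfun_inverse)
  have "dist (Q f) (Q g) \<le> 1/2 * dist f g" for f g
  proof (rule dist_bound)
    fix t
    have "dist (Q f t) (Q g t) = norm (integral {0..clamp t} (\<lambda>s. G (f s)) - integral {0..clamp t} (\<lambda>s. G (g s)))"
      by (simp add: Q P_def dist_norm)
    also have "\<dots> = norm (integral {0..clamp t} (\<lambda>s. G (f s) - G (g s)))"
      by (subst Henstock_Kurzweil_Integration.integral_diff) (auto intro!: integrable_continuous_real Gf)
    also have "\<dots> \<le> (1/2 * dist f g) * (clamp t - 0)"
    proof (rule integral_bound)
      fix s
      have "norm (G (f s) - G (g s)) \<le> L * dist (f s) (g s)"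
        using lipschitz_onD[OF L, of "f s" "g s"] by (simp add: dist_norm)
      also have "\<dots> \<le> 1/2 * dist f g"
        using \<open>L \<le> 1/2\<close> L0 dist_bounded[of f s g] by (intro mult_mono) auto
      finally show "norm (G (f s) - G (g s)) \<le> 1/2 * dist f g" .
    qed (use clamp(1)[of t] in \<open>auto intro!: continuous_intros Gf\<close>)
    also have "\<dots> \<le> 1/2 * dist f g" using clamp(1)[of t] by (auto intro: mult_left_le)
    finally show "dist (Q f t) (Q g t) \<le> 1/2 * dist f g" .
  qed
  then obtain f where f: "Q f = f" using banach_fix_type[of "1/2" Q] by auto
  have fP: "apply_bcontfun f t = x + integral {0..clamp t} (\<lambda>s. G (apply_bcontfun f s))" for t
    using fun_cong[OF Q[of f], of t] by (simp add: f P_def)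
  show ?thesis
  proof (intro exI conjI ballI)
    show "f 0 = x" by (subst fP) (simp add: clamp_def)
    fix t :: real assume t: "t \<in> {0..1}"
    have "((\<lambda>t. x + integral {0..t} (\<lambda>s. G (apply_bcontfun f s))) has_vector_derivative 0 + G (f t)) (at t within {0..1})"
      using t by (intro derivative_intros integral_has_vector_derivative Gf) auto
    then show "(f has_vector_derivative G (f t)) (at t within {0..1})"
      unfolding add_0_left
      by (rule has_vector_derivative_transform[OF t, rotated]) (use clamp fP in metis)
  qed
qed

section \<open>Flows of the individual control fields\<close>

lemma has_bounded_vector_derivative_imp_lipschitz:
  fixes y :: "real \<Rightarrow> 'a::real_normed_vector"
  assumes "\<And>t. t \<in> {0..1} \<Longrightarrow> (y has_vector_derivative g t) (at t within {0..1})"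
    and "\<And>t. t \<in> {0..1} \<Longrightarrow> norm (g t) \<le> M" "0 \<le> M"
  shows "M-lipschitz_on {0..1} y"
proof (rule bounded_derivative_imp_lipschitz)
  show "onorm (\<lambda>h. h *\<^sub>R g t) \<le> M" if "t \<in> {0..1}" for t
    using assms(2)[OF that] assms(3) by (intro onorm_le) (simp add: mult.commute[of M] mult_left_mono)
qed (use assms in \<open>auto simp: has_vector_derivative_def\<close>)

text \<open>The constant control \<open>axis i s\<close> drives the field \<open>s F_i\<close>.
  Negative \<open>s\<close> is allowed, and this is the source of -F_i. The solution curves are kept
  in the conclusion because the later estimates use the equation along the way and not only the
  endpoint.\<close>

lemma reachable_small_flow:
  fixes F :: "'k::finite \<Rightarrow> real^'n::finite \<Rightarrow> real^'n"
  assumes L: "L-lipschitz_on UNIV (F i)" and s: "\<bar>s\<bar> * L \<le> 1/2"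
  shows "\<exists>\<phi>\<in>reachable F. \<forall>x. \<exists>y. y 0 = x \<and> y 1 = \<phi> x \<and>
           (\<forall>t\<in>{0..1}. (y has_vector_derivative s *\<^sub>R F i (y t)) (at t within {0..1}))"
proof -
  have sL: "(\<bar>s\<bar> * L)-lipschitz_on UNIV (\<lambda>x. s *\<^sub>R F i x)"
    using lipschitz_on_cmult[OF L] by simp
  obtain Y where Y: "\<And>x. Y x 0 = x"
     "\<And>x t. t\<in>{0..1} \<Longrightarrow> (Y x has_vector_derivative s *\<^sub>R F i (Y x t)) (at t within {0..1})"
    using lipschitz_ode_solution[OF sL s] by metis
  have sum: "(\<Sum>j\<in>UNIV. (axis i s $ j) *\<^sub>R F j z) = s *\<^sub>R F i z" for z
    by (subst sum.remove[of _ i]) (auto simp: axis_def intro!: sum.neutral)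
  have "control_path F (\<lambda>t. axis i s) (Y x)" for x
  proof -
    \<comment> \<open>The speed bound found here depends on \<open>x\<close>, as it may: each
      control path has its own Lipschitz constant.\<close>
    have "continuous_on {0..1} (Y x)" using Y(2) has_vector_derivative_continuous unfolding continuous_on_eq_continuous_within by blast
    then have "continuous_on {0..1} (\<lambda>t. s *\<^sub>R F i (Y x t))"
      using continuous_on_compose2[OF lipschitz_on_continuous_on[OF sL], of "{0..1}" "Y x"] by auto
    then have "bounded ((\<lambda>t. s *\<^sub>R F i (Y x t)) ` {0..1})"
      by (intro compact_imp_bounded compact_continuous_image) auto
    then obtain M where "M > 0" "\<And>t. t \<in> {0..1} \<Longrightarrow> norm (s *\<^sub>R F i (Y x t)) \<le> M"
      unfolding bounded_pos by blast
    then have "M-lipschitz_on {0..1} (Y x)"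
      by (intro has_bounded_vector_derivative_imp_lipschitz[OF Y(2)]) auto
    moreover have "(Y x has_vector_derivative s *\<^sub>R F i (Y x t)) (at t)" if "t \<in> {0<..<1}" for t
      using Y(2)[of t x] that at_within_interior[of t "{0..1}"] by auto
    ultimately show ?thesis unfolding control_path_def sum by blast
  qed
  then have "(\<lambda>x. Y x 1) \<in> reachable F"
    unfolding reachable_def using Y(1)
    by (intro CollectI exI[of _ "\<lambda>t. axis i s"] exI[of _ "norm (axis i s)"]) auto
  then show ?thesis proof (rule bexI[rotated], intro allI)
    fix x show "\<exists>y. y 0 = x \<and> y 1 = Y x 1 \<and>
        (\<forall>t\<in>{0..1}. (y has_vector_derivative s *\<^sub>R F i (y t)) (at t within {0..1}))"
      using Y by (intro exI[of _ "Y x"]) auto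
  qed
qed

section \<open>Regularity of vector fields\<close>

lemma frechet_derivative_eq_sum_partial_deriv:
  fixes f :: "real^'n::finite \<Rightarrow> 'b::real_normed_vector"
  assumes "f differentiable (at x)"
  shows "frechet_derivative f (at x) v = (\<Sum>i\<in>UNIV. v $ i *\<^sub>R partial_deriv i f x)"
proof -
  have lin: "linear (frechet_derivative f (at x))" using assms by (rule linear_frechet_derivative)
  have "v = (\<Sum>i\<in>UNIV. v $ i *\<^sub>R axis i 1)"
    by (rule basis_expansion[of v, symmetric, unfolded scalar_mult_eq_scaleR])
  then have "frechet_derivative f (at x) v = frechet_derivative f (at x) (\<Sum>i\<in>UNIV. v $ i *\<^sub>R axis i 1)" by simp
  also have "\<dots> = (\<Sum>i\<in>UNIV. v $ i *\<^sub>R partial_deriv i f x)"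
    by (simp add: linear_sum[OF lin] linear_cmul[OF lin] partial_deriv_def)
  finally show ?thesis .
qed

lemma partial_deriv_eqI:
  "(f has_derivative f') (at x) \<Longrightarrow> partial_deriv i f x = f' (axis i 1)"
  unfolding partial_deriv_def by (metis frechet_derivative_at)

lemma Ck_on_Suc_imp_continuous_on: "Ck_on (Suc m) f UNIV \<Longrightarrow> continuous_on UNIV f"
  by (simp add: continuous_at_imp_continuous_on differentiable_imp_continuous_within)

lemma Ck_on_SucD: "Ck_on (Suc m) f UNIV \<Longrightarrow> Ck_on m f UNIV"
proof (induction m arbitrary: f)
  case 0 then show ?case using Ck_on_Suc_imp_continuous_on[OF 0] by simp
next
  case (Suc m)
  have "Ck_on m (partial_deriv i f) UNIV" for i
    using Suc.IH[of "partial_deriv i f"] Suc.prems by (subst (asm) Ck_on.simps(2)) blast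
  then show ?case using Suc.prems by simp
qed

lemma Ck_on_const: "Ck_on m (\<lambda>x::real^'n::finite. c) UNIV"
proof (induction m arbitrary: c)
  case (Suc m)
  have "partial_deriv i (\<lambda>x. c) = (\<lambda>x. 0)" for i :: 'n
    by (rule ext, rule partial_deriv_eqI[where f'="\<lambda>v. 0"]) simp
  then show ?case using Suc by simp
qed simp

lemma Ck_on_add:
  "Ck_on m f UNIV \<Longrightarrow> Ck_on m g UNIV \<Longrightarrow> Ck_on m (\<lambda>x. f x + g x) UNIV"
proof (induction m arbitrary: f g)
  case (Suc m)
  have d: "(f has_derivative frechet_derivative f (at x)) (at x)"
    "(g has_derivative frechet_derivative g (at x)) (at x)" for x
    using Suc.prems by (auto simp: frechet_derivative_works[symmetric])
  have "partial_deriv i (\<lambda>x. f x + g x) = (\<lambda>x. partial_deriv i f x + partial_deriv i g x)" for i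
    using partial_deriv_eqI[OF has_derivative_add[OF d]] by (auto simp: partial_deriv_def)
  moreover have "(\<lambda>x. f x + g x) differentiable (at x)" for x
    using has_derivative_add[OF d] by (auto simp: differentiable_def)
  moreover have "Ck_on m (\<lambda>x. partial_deriv i f x + partial_deriv i g x) UNIV" for i
    using Suc.prems by (intro Suc.IH) auto
  ultimately show ?case by simp
qed (auto intro: continuous_intros)

lemma Ck_on_scaleR:
  fixes a :: "real^'n::finite \<Rightarrow> real" and f :: "real^'n \<Rightarrow> 'b::real_normed_vector"
  shows "Ck_on m a UNIV \<Longrightarrow> Ck_on m f UNIV \<Longrightarrow> Ck_on m (\<lambda>x. a x *\<^sub>R f x) UNIV"
proof (induction m arbitrary: a f)
  case (Suc m)
  have d: "(a has_derivative frechet_derivative a (at x)) (at x)"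
    "(f has_derivative frechet_derivative f (at x)) (at x)" for x
    using Suc.prems by (auto simp: frechet_derivative_works[symmetric])
  have "partial_deriv i (\<lambda>x. a x *\<^sub>R f x) =
      (\<lambda>x. a x *\<^sub>R partial_deriv i f x + partial_deriv i a x *\<^sub>R f x)" for i
    using partial_deriv_eqI[OF has_derivative_scaleR[OF d]] by (auto simp: partial_deriv_def)
  moreover have "(\<lambda>x. a x *\<^sub>R f x) differentiable (at x)" for x
    using has_derivative_scaleR[OF d] by (auto simp: differentiable_def)
  moreover have "Ck_on m (\<lambda>x. a x *\<^sub>R partial_deriv i f x + partial_deriv i a x *\<^sub>R f x) UNIV" for i
    using Suc.prems Ck_on_SucD[OF Suc.prems(1)] Ck_on_SucD[OF Suc.prems(2)]
    by (intro Ck_on_add Suc.IH) auto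
  ultimately show ?case by simp
qed (auto intro: continuous_intros)

lemma Ck_on_sum:
  "finite I \<Longrightarrow> (\<And>i. i \<in> I \<Longrightarrow> Ck_on m (f i) UNIV) \<Longrightarrow> Ck_on m (\<lambda>x. \<Sum>i\<in>I. f i x) UNIV"
  by (induction rule: finite_induct) (auto intro: Ck_on_const Ck_on_add)

lemma Ck_on_bounded_linear_comp:
  assumes "bounded_linear l"
  shows "Ck_on m f UNIV \<Longrightarrow> Ck_on m (\<lambda>x. l (f x)) UNIV"
proof (induction m arbitrary: f)
  case 0 then show ?case using bounded_linear.continuous_on[OF assms] by simp
next
  case (Suc m)
  have d: "((\<lambda>x. l (f x)) has_derivative (\<lambda>v. l (frechet_derivative f (at x) v))) (at x)" for x
    using Suc.prems by (intro bounded_linear.has_derivative[OF assms]) (auto simp: frechet_derivative_works[symmetric])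
  have "partial_deriv i (\<lambda>x. l (f x)) = (\<lambda>x. l (partial_deriv i f x))" for i
    using partial_deriv_eqI[OF d] by (auto simp: partial_deriv_def)
  then show ?case using Suc d by (auto simp: differentiable_def)
qed

lemma Ck_on_bounded_linear:
  fixes l :: "real^'n::finite \<Rightarrow> 'b::real_normed_vector"
  assumes "bounded_linear l"
  shows "Ck_on m l UNIV"
proof (cases m)
  case 0 then show ?thesis using linear_continuous_on[OF assms] by simp
next
  case (Suc k)
  have d: "(l has_derivative l) (at x)" for x using bounded_linear_imp_has_derivative[OF assms] .
  have "partial_deriv i l = (\<lambda>x. l (axis i 1))" for i using partial_deriv_eqI[OF d] by auto
  then show ?thesis using Suc d Ck_on_const by (auto simp: differentiable_def)
qed

section \<open>Regularity of polynomials and of brackets\<close>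

lemma Ck_on_real_polynomial_function:
  fixes p :: "real^'n::finite \<Rightarrow> real"
  shows "real_polynomial_function p \<Longrightarrow> Ck_on m p UNIV"
proof (induction rule: real_polynomial_function.induct)
  case (mult f g)
  then show ?case using Ck_on_scaleR[of m f g] by simp
qed (auto intro: Ck_on_bounded_linear Ck_on_const Ck_on_add)

text \<open>The approximating property holds for \<open>C^m\<close> fields with an \<open>m\<close>
  that is only known to exist; Weierstrass approximants belong to every such class.\<close>

lemma Ck_on_polynomial_function:
  fixes p :: "real^'n::finite \<Rightarrow> real^'m::finite"
  assumes "polynomial_function p"
  shows "Ck_on m p UNIV"
proof -
  have "Ck_on m (\<lambda>x. \<Sum>j\<in>UNIV. (p x $ j) *\<^sub>R axis j (1::real)) UNIV"
  proof (intro Ck_on_sum Ck_on_scaleR Ck_on_const)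
    fix j
    have "real_polynomial_function ((\<lambda>v. v $ j) \<circ> p)"
      using assms bounded_linear_vec_nth unfolding polynomial_function_def by blast
    then show "Ck_on m (\<lambda>x. p x $ j) UNIV" using Ck_on_real_polynomial_function by (simp add: comp_def)
  qed simp
  moreover have "(\<lambda>x. \<Sum>j\<in>UNIV. (p x $ j) *\<^sub>R axis j (1::real)) = p"
    using basis_expansion[of "p x" for x, unfolded scalar_mult_eq_scaleR] by auto
  ultimately show ?thesis by simp
qed

text \<open>In coordinates the bracket is a combination of products of components and partial
  derivatives. The difference is written with a factor -1 so that the closure rules for sums and
  products apply.\<close>

lemma lie_bracket_eq_sum:
  fixes X Y :: "real^'n::finite \<Rightarrow> real^'n"
  assumes "Ck_on (Suc m) X UNIV" "Ck_on (Suc m) Y UNIV"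
  shows "lie_bracket X Y = (\<lambda>x. (\<Sum>i\<in>UNIV. X x $ i *\<^sub>R partial_deriv i Y x) +
           (-1) *\<^sub>R (\<Sum>i\<in>UNIV. Y x $ i *\<^sub>R partial_deriv i X x))"
proof
  fix x
  have "X differentiable (at x)" "Y differentiable (at x)" using assms by auto
  then show "lie_bracket X Y x = (\<Sum>i\<in>UNIV. X x $ i *\<^sub>R partial_deriv i Y x) +
           (-1) *\<^sub>R (\<Sum>i\<in>UNIV. Y x $ i *\<^sub>R partial_deriv i X x)"
    by (simp add: lie_bracket_def frechet_derivative_eq_sum_partial_deriv)
qed

lemma Ck_on_lie_bracket:
  assumes "Ck_on (Suc m) X UNIV" "Ck_on (Suc m) Y UNIV"
  shows "Ck_on m (lie_bracket X Y) UNIV"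
proof -
  have "Ck_on m (partial_deriv i X) UNIV" "Ck_on m (partial_deriv i Y) UNIV" for i
    using assms by simp_all
  then show ?thesis
    unfolding lie_bracket_eq_sum[OF assms]
    using Ck_on_SucD[OF assms(1)] Ck_on_SucD[OF assms(2)]
    by (intro Ck_on_add Ck_on_scaleR Ck_on_sum Ck_on_const Ck_on_bounded_linear_comp[OF bounded_linear_vec_nth] finite)
qed

lemma smooth_on_iterated_brackets:
  assumes "\<And>i. smooth_on (F i) UNIV" "X \<in> iterated_brackets F"
  shows "smooth_on X UNIV"
  using assms(2)
proof induction
  case (base i)
  then show ?case by (rule assms(1))
next
  case (bracket X i)
  then show ?case
    using assms(1)[of i] unfolding smooth_on_def by (intro allI Ck_on_lie_bracket) blast+
qed

section \<open>Derivative estimates uniform on balls\<close>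

lemma frechet_derivative_bounded_on_ball:
  fixes X :: "real^'n::finite \<Rightarrow> 'b::real_normed_vector"
  assumes "Ck_on 1 X UNIV"
  shows "\<exists>K\<ge>0. \<forall>x v. norm x \<le> r \<longrightarrow> norm (frechet_derivative X (at x) v) \<le> K * norm v"
proof -
  have d: "X differentiable (at x)" and c: "continuous_on UNIV (partial_deriv i X)" for x i
    using assms by auto
  have "bounded ((\<lambda>x. \<Sum>i\<in>UNIV. norm (partial_deriv i X x)) ` cball 0 r)"
    by (intro compact_imp_bounded compact_continuous_image continuous_intros continuous_on_subset[OF c]) auto
  then obtain K where K: "K > 0" "\<And>x. norm x \<le> r \<Longrightarrow> norm (\<Sum>i\<in>UNIV. norm (partial_deriv i X x)) \<le> K"
    unfolding bounded_pos by auto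
  have "norm (frechet_derivative X (at x) v) \<le> K * norm v" if "norm x \<le> r" for x v
  proof -
    have "norm (frechet_derivative X (at x) v) \<le> (\<Sum>i\<in>UNIV. norm v * norm (partial_deriv i X x))"
      unfolding frechet_derivative_eq_sum_partial_deriv[OF d]
      by (rule sum_norm_le) (simp add: mult_right_mono component_le_norm_cart)
    also have "\<dots> = norm v * (\<Sum>i\<in>UNIV. norm (partial_deriv i X x))" by (simp add: sum_distrib_left)
    also have "\<dots> \<le> norm v * K" using K(2)[OF that] by (intro mult_left_mono) auto
    finally show ?thesis by (simp add: mult.commute)
  qed
  then show ?thesis using K(1) by (intro exI[of _ K]) auto
qed

text \<open>The mean value inequality is applied to \<open>X\<close> minus its derivative at
  \<open>x\<close>, a map whose derivative near \<open>x\<close> is small by uniform continuity of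
  the partial derivatives. Two free points \<open>a\<close> and \<open>b\<close> are allowed because
  the curves compared later both move, while the linearisation stays at the fixed point
  \<open>x\<close>.\<close>

lemma uniform_strict_differentiability:
  fixes X :: "real^'n::finite \<Rightarrow> 'b::real_normed_vector"
  assumes "Ck_on 1 X UNIV" and "\<omega> > 0"
  shows "\<exists>\<rho>>0. \<forall>x a b. norm x \<le> r \<longrightarrow> a \<in> ball x \<rho> \<longrightarrow> b \<in> ball x \<rho> \<longrightarrow>
     norm (X a - X b - frechet_derivative X (at x) (a - b)) \<le> \<omega> * norm (a - b)"
proof -
  have d: "X differentiable (at x)" and c: "continuous_on UNIV (partial_deriv i X)" for x i
    using assms by auto
  \<comment> \<open>The tolerance is shared among the \<open>CARD('n)\<close> partial
    derivatives.\<close>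
  define e where "e = \<omega> / real CARD('n)"
  have e: "e > 0" using assms(2) by (simp add: e_def)
  have "\<exists>\<rho>>0. \<forall>x\<in>cball 0 (r+1). \<forall>z\<in>cball 0 (r+1). dist z x < \<rho> \<longrightarrow> dist (partial_deriv i X z) (partial_deriv i X x) < e" for i
    using compact_uniformly_continuous[OF continuous_on_subset[OF c[of i]], of "cball 0 (r+1)"] e
    unfolding uniformly_continuous_on_def by auto
  then obtain \<rho>' where \<rho>': "\<And>i. \<rho>' i > 0" "\<And>i x z. x \<in> cball 0 (r+1) \<Longrightarrow> z \<in> cball 0 (r+1) \<Longrightarrow> dist z x < \<rho>' i \<Longrightarrow>
      dist (partial_deriv i X z) (partial_deriv i X x) < e" by metis
  \<comment> \<open>The cap 1 keeps the balls inside \<open>cball 0 (r+1)\<close>, where uniform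
    continuity was obtained.\<close>
  define \<rho> where "\<rho> = min 1 (Min (range \<rho>'))"
  have \<rho>: "\<rho> > 0" "\<rho> \<le> 1" "\<rho> \<le> \<rho>' i" for i using \<rho>'(1) by (auto simp: \<rho>_def intro: min.coboundedI2 Min_le)
  have "norm (X a - X b - frechet_derivative X (at x) (a - b)) \<le> \<omega> * norm (a - b)"
    if x: "norm x \<le> r" and a: "a \<in> ball x \<rho>" and b: "b \<in> ball x \<rho>" for x a b
  proof -
    let ?D = "\<lambda>z. frechet_derivative X (at z)"
    have lin: "linear (?D x)" using d by (rule linear_frechet_derivative)
    have "norm ((X a - ?D x a) - (X b - ?D x b)) \<le> \<omega> * norm (a - b)"
    proof (rule differentiable_bound[OF convex_ball _ _ a b])
      fix z assume z: "z \<in> ball x \<rho>"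
      have "((\<lambda>z. X z - ?D x z) has_derivative (\<lambda>v. ?D z v - ?D x v)) (at z)"
        using d by (intro derivative_intros) (auto simp: frechet_derivative_works[symmetric]
          intro!: linear_imp_has_derivative lin)
      then show "((\<lambda>z. X z - ?D x z) has_derivative (\<lambda>v. ?D z v - ?D x v)) (at z within ball x \<rho>)"
        by (rule has_derivative_at_withinI)
      have "norm z \<le> norm x + dist x z" by (metis dist_norm norm_triangle_sub norm_minus_commute)
      then have zr: "z \<in> cball 0 (r+1)" "x \<in> cball 0 (r+1)" using x z \<rho>(2) by auto
      have "norm (?D z v - ?D x v) \<le> \<omega> * norm v" for v
      proof -
        have "?D z v - ?D x v = (\<Sum>i\<in>UNIV. v $ i *\<^sub>R (partial_deriv i X z - partial_deriv i X x))"
          unfolding frechet_derivative_eq_sum_partial_deriv[OF d] by (simp add: sum_subtractf scaleR_diff_right)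
        also have "norm \<dots> \<le> (\<Sum>i\<in>(UNIV::'n set). norm v * e)"
        proof (rule sum_norm_le)
          fix i
          have "norm (partial_deriv i X z - partial_deriv i X x) \<le> e"
            using \<rho>'(2)[OF zr(2,1), of i] z \<rho>(3)[of i] by (simp add: dist_norm norm_minus_commute)
          then show "norm (v $ i *\<^sub>R (partial_deriv i X z - partial_deriv i X x)) \<le> norm v * e"
            using e by (simp add: mult_mono component_le_norm_cart)
        qed
        also have "\<dots> = \<omega> * norm v" by (simp add: e_def)
        finally show ?thesis .
      qed
      then show "onorm (\<lambda>v. ?D z v - ?D x v) \<le> \<omega>" by (rule onorm_le)
    qed
    then show ?thesis by (simp add: linear_diff[OF lin] algebra_simps)
  qed
  then show ?thesis using \<rho>(1) by blast
qed

section \<open>Fields generated by Euler steps\<close>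

lemma norm_add3_le: "norm (a + b + c) \<le> norm a + norm b + norm (c::'a::real_normed_vector)"
  using norm_triangle_ineq[of "a + b" c] norm_triangle_ineq[of a b] by linarith

text \<open>One step of length \<open>h\<close> along \<open>X\<close>, with a defect that is a
  fixed fraction \<open>e\<close> of \<open>h\<close>. Fixing \<open>e\<close> and \<open>r\<close>
  makes it possible to state what a conjugation or a sum costs; \<open>generated\<close> lets
  \<open>e\<close> tend to 0 on every ball, which is the o(h) form.\<close>

definition euler_steps :: "('a::real_normed_vector \<Rightarrow> 'a) set \<Rightarrow> ('a \<Rightarrow> 'a) \<Rightarrow> real \<Rightarrow> real \<Rightarrow> bool" where
  "euler_steps R X r e \<longleftrightarrow> (\<exists>h0>0. \<forall>h. 0 < h \<and> h < h0 \<longrightarrow>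
     (\<exists>\<phi>\<in>R. \<forall>x. norm x \<le> r \<longrightarrow> norm (\<phi> x - x - h *\<^sub>R X x) \<le> e * h))"

definition generated :: "('a::real_normed_vector \<Rightarrow> 'a) set \<Rightarrow> ('a \<Rightarrow> 'a) \<Rightarrow> bool" where
  "generated R X \<longleftrightarrow> (\<forall>r e. 0 < e \<longrightarrow> euler_steps R X r e)"

lemma euler_steps_perturb:
  assumes "euler_steps R X r e" and "\<And>x. norm x \<le> r \<Longrightarrow> norm (X x - Y x) \<le> d" and "e + d \<le> e'"
  shows "euler_steps R Y r e'"
proof -
  obtain h0 where h0: "h0 > 0" "\<And>h. 0 < h \<Longrightarrow> h < h0 \<Longrightarrow>
     \<exists>\<phi>\<in>R. \<forall>x. norm x \<le> r \<longrightarrow> norm (\<phi> x - x - h *\<^sub>R X x) \<le> e * h"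
    using assms(1) unfolding euler_steps_def by blast
  have "\<exists>\<phi>\<in>R. \<forall>x. norm x \<le> r \<longrightarrow> norm (\<phi> x - x - h *\<^sub>R Y x) \<le> e' * h" if h: "0 < h" "h < h0" for h
  proof -
    obtain \<phi> where \<phi>: "\<phi> \<in> R" "\<And>x. norm x \<le> r \<Longrightarrow> norm (\<phi> x - x - h *\<^sub>R X x) \<le> e * h"
      using h0(2)[OF h] by blast
    have "norm (\<phi> x - x - h *\<^sub>R Y x) \<le> e' * h" if x: "norm x \<le> r" for x
    proof -
      have "\<phi> x - x - h *\<^sub>R Y x = (\<phi> x - x - h *\<^sub>R X x) + h *\<^sub>R (X x - Y x)" by (simp add: algebra_simps)
      then have "norm (\<phi> x - x - h *\<^sub>R Y x) \<le> norm (\<phi> x - x - h *\<^sub>R X x) + h * norm (X x - Y x)"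
        using h by (metis norm_triangle_ineq norm_scaleR abs_of_pos)
      also have "\<dots> \<le> e * h + h * d" using \<phi>(2)[OF x] assms(2)[OF x] h by (intro add_mono mult_left_mono) auto
      also have "\<dots> = (e + d) * h" by (simp add: algebra_simps)
      also have "\<dots> \<le> e' * h" using assms(3) h by (intro mult_right_mono) auto
      finally show ?thesis .
    qed
    then show ?thesis using \<phi>(1) by blast
  qed
  then show ?thesis unfolding euler_steps_def using h0(1) by blast
qed

text \<open>A step of length \<open>h\<close> along \<open>X\<close> is a step of length
  \<open>h / c\<close> along \<open>c X\<close>, so the admissible defect scales with
  \<open>c\<close>.\<close>

lemma euler_steps_scale:
  assumes "euler_steps R (\<lambda>x. c *\<^sub>R X x) r (c * e)" and c: "c > 0"
  shows "euler_steps R X r e"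
proof -
  obtain h0 where h0: "h0 > 0" "\<And>h. 0 < h \<Longrightarrow> h < h0 \<Longrightarrow>
     \<exists>\<phi>\<in>R. \<forall>x. norm x \<le> r \<longrightarrow> norm (\<phi> x - x - h *\<^sub>R (c *\<^sub>R X x)) \<le> c * e * h"
    using assms(1) unfolding euler_steps_def by blast
  have "\<exists>\<phi>\<in>R. \<forall>x. norm x \<le> r \<longrightarrow> norm (\<phi> x - x - h *\<^sub>R X x) \<le> e * h" if h: "0 < h" "h < c * h0" for h
  proof -
    have "0 < h / c" "h / c < h0" using h c by (auto simp: pos_divide_less_eq mult.commute)
    from h0(2)[OF this] show ?thesis using c by simp
  qed
  then show ?thesis unfolding euler_steps_def using h0(1) c by (intro exI[of _ "c * h0"]) simp
qed

text \<open>The larger radius leaves room for the displacement by the first step.\<close>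

lemma euler_steps_add:
  fixes X Y :: "'a::euclidean_space \<Rightarrow> 'a"
  assumes comp: "\<And>\<phi> \<psi>. \<phi> \<in> R \<Longrightarrow> \<psi> \<in> R \<Longrightarrow> \<phi> \<circ> \<psi> \<in> R"
    and X: "euler_steps R X (r+1) e1" "continuous_on UNIV X"
    and Y: "euler_steps R Y r e2" "continuous_on UNIV Y"
    and e: "e1 + e2 < e" "0 \<le> e2"
  shows "euler_steps R (\<lambda>x. X x + Y x) r e"
proof -
  \<comment> \<open>The slack left by \<open>e1 + e2 < e\<close> pays for evaluating
    \<open>X\<close> at the point reached by the first step instead of the starting point.\<close>
  define d where "d = e - e1 - e2"
  have d: "d > 0" using e by (simp add: d_def)
  obtain h1 where h1: "h1 > 0" "\<And>h. 0 < h \<Longrightarrow> h < h1 \<Longrightarrow>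
     \<exists>\<phi>\<in>R. \<forall>x. norm x \<le> r+1 \<longrightarrow> norm (\<phi> x - x - h *\<^sub>R X x) \<le> e1 * h"
    using X(1) unfolding euler_steps_def by blast
  obtain h2 where h2: "h2 > 0" "\<And>h. 0 < h \<Longrightarrow> h < h2 \<Longrightarrow>
     \<exists>\<phi>\<in>R. \<forall>x. norm x \<le> r \<longrightarrow> norm (\<phi> x - x - h *\<^sub>R Y x) \<le> e2 * h"
    using Y(1) unfolding euler_steps_def by blast
  have "bounded (Y ` cball 0 r)"
    using continuous_on_subset[OF Y(2)] by (intro compact_imp_bounded compact_continuous_image) auto
  then obtain M where M: "M > 0" "\<And>x. norm x \<le> r \<Longrightarrow> norm (Y x) \<le> M"
    unfolding bounded_pos by auto
  have "uniformly_continuous_on (cball 0 (r+1)) X"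
    using continuous_on_subset[OF X(2)] by (intro compact_uniformly_continuous) auto
  then obtain \<rho> where \<rho>: "\<rho> > 0" "\<And>x z. norm x \<le> r+1 \<Longrightarrow> norm z \<le> r+1 \<Longrightarrow> norm (z - x) < \<rho> \<Longrightarrow> norm (X z - X x) < d"
    unfolding uniformly_continuous_on_def using d by (auto simp: dist_norm)
  \<comment> \<open>\<open>h * (M + e2)\<close> bounds the displacement by the first step: below 1
    it stays in the larger ball, below \<rho> it respects the modulus of continuity of
    \<open>X\<close>.\<close>
  define h0 where "h0 = min (min h1 h2) (min 1 \<rho> / (M + e2))"
  have Me: "M + e2 > 0" using M e by simp
  have h0p: "h0 > 0" using h1 h2 \<rho> Me by (auto simp: h0_def)
  have "\<exists>\<phi>\<in>R. \<forall>x. norm x \<le> r \<longrightarrow> norm (\<phi> x - x - h *\<^sub>R (X x + Y x)) \<le> e * h" if h: "0 < h" "h < h0" for h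
  proof -
    have hM: "h * (M + e2) < 1" "h * (M + e2) < \<rho>"
      using h Me by (auto simp: h0_def pos_less_divide_eq)
    obtain \<phi> where \<phi>: "\<phi> \<in> R" "\<And>x. norm x \<le> r+1 \<Longrightarrow> norm (\<phi> x - x - h *\<^sub>R X x) \<le> e1 * h"
      using h1(2)[of h] h unfolding h0_def by auto
    obtain \<psi> where \<psi>: "\<psi> \<in> R" "\<And>x. norm x \<le> r \<Longrightarrow> norm (\<psi> x - x - h *\<^sub>R Y x) \<le> e2 * h"
      using h2(2)[of h] h unfolding h0_def by auto
    have "norm ((\<phi> \<circ> \<psi>) x - x - h *\<^sub>R (X x + Y x)) \<le> e * h" if x: "norm x \<le> r" for x
    proof -
      define z where "z = \<psi> x"
      have z1: "norm (z - x - h *\<^sub>R Y x) \<le> e2 * h" using \<psi>(2)[OF x] by (simp add: z_def)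
      have "norm (z - x) \<le> norm (z - x - h *\<^sub>R Y x) + norm (h *\<^sub>R Y x)"
        using norm_triangle_ineq[of "z - x - h *\<^sub>R Y x" "h *\<^sub>R Y x"] by simp
      also have "\<dots> \<le> e2 * h + h * M" using z1 M(2)[OF x] h by (intro add_mono) (auto simp: mult_left_mono)
      finally have zx: "norm (z - x) \<le> h * (M + e2)" by (simp add: algebra_simps)
      have "norm z \<le> norm x + norm (z - x)" by (rule norm_triangle_sub)
      then have zr: "norm z \<le> r + 1" using zx hM x by linarith
      have Xd: "norm (X z - X x) \<le> d" using \<rho>(2)[of x z] zr x zx hM by simp
      have "(\<phi> \<circ> \<psi>) x - x - h *\<^sub>R (X x + Y x) = (\<phi> z - z - h *\<^sub>R X z) + (z - x - h *\<^sub>R Y x) + h *\<^sub>R (X z - X x)"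
        by (simp add: z_def algebra_simps)
      then have "norm ((\<phi> \<circ> \<psi>) x - x - h *\<^sub>R (X x + Y x)) \<le> norm (\<phi> z - z - h *\<^sub>R X z) + norm (z - x - h *\<^sub>R Y x) + norm (h *\<^sub>R (X z - X x))"
        by (metis norm_add3_le)
      also have "\<dots> \<le> e1 * h + e2 * h + h * d"
        using \<phi>(2)[OF zr] z1 Xd h by (intro add_mono) (auto simp: mult_left_mono)
      also have "\<dots> = e * h" by (simp add: d_def algebra_simps)
      finally show ?thesis .
    qed
    then show ?thesis using comp[OF \<phi>(1) \<psi>(1)] by blast
  qed
  then show ?thesis unfolding euler_steps_def using h0p by blast
qed

section \<open>Closure properties of the generated fields\<close>

lemma generated_add:
  fixes X Y :: "'a::euclidean_space \<Rightarrow> 'a"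
  assumes "\<And>\<phi> \<psi>. \<phi> \<in> R \<Longrightarrow> \<psi> \<in> R \<Longrightarrow> \<phi> \<circ> \<psi> \<in> R"
    and "generated R X" "generated R Y" "continuous_on UNIV X" "continuous_on UNIV Y"
  shows "generated R (\<lambda>x. X x + Y x)"
  unfolding generated_def
proof (intro allI impI)
  fix r e :: real assume "e > 0"
  then show "euler_steps R (\<lambda>x. X x + Y x) r e"
    using assms(2,3) unfolding generated_def
    by (intro euler_steps_add[where ?e1.0="e/3" and ?e2.0="e/3"] assms) auto
qed

lemma generated_scale:
  assumes "generated R X" and c: "c > 0"
  shows "generated R (\<lambda>x. c *\<^sub>R X x)"
  unfolding generated_def
proof (intro allI impI)
  fix r e :: real assume "e > 0"
  then have "euler_steps R X r (inverse c * e)" using assms unfolding generated_def by simp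
  then show "euler_steps R (\<lambda>x. c *\<^sub>R X x) r e"
    using c euler_steps_scale[of R "inverse c" "\<lambda>x. c *\<^sub>R X x" r e] by simp
qed

lemma generated_limit:
  assumes "\<And>r e. 0 < e \<Longrightarrow> \<exists>X. generated R X \<and> (\<forall>x. norm x \<le> r \<longrightarrow> norm (X x - Y x) \<le> e)"
  shows "generated R Y"
  unfolding generated_def
proof (intro allI impI)
  fix r e :: real assume "e > 0"
  then obtain X where "generated R X" "\<And>x. norm x \<le> r \<Longrightarrow> norm (X x - Y x) \<le> e/2"
    using assms[of "e/2" r] by auto
  with \<open>e > 0\<close> show "euler_steps R Y r e"
    by (intro euler_steps_perturb[of R X r "e/2" Y "e/2"]) (auto simp: generated_def)
qed

lemma generated_zero:
  assumes "(\<lambda>x. x) \<in> R"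
  shows "generated R (\<lambda>x. 0)"
  unfolding generated_def euler_steps_def
  by (intro allI impI exI[of _ "1::real"] conjI bexI[OF _ assms]) auto

lemma generated_sum:
  fixes X :: "'i \<Rightarrow> 'a::euclidean_space \<Rightarrow> 'a"
  assumes comp: "\<And>\<phi> \<psi>. \<phi> \<in> R \<Longrightarrow> \<psi> \<in> R \<Longrightarrow> \<phi> \<circ> \<psi> \<in> R" and id: "(\<lambda>x. x) \<in> R"
  shows "finite I \<Longrightarrow> (\<And>i. i \<in> I \<Longrightarrow> generated R (X i) \<and> continuous_on UNIV (X i)) \<Longrightarrow>
    generated R (\<lambda>x. \<Sum>i\<in>I. X i x)"
proof (induction rule: finite_induct)
  case empty then show ?case using generated_zero[OF id] by simp
next
  case (insert i I)
  then have "generated R (\<lambda>x. X i x + (\<Sum>i\<in>I. X i x))"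
    by (intro generated_add[OF comp] continuous_on_sum) auto
  then show ?case using insert.hyps by simp
qed

text \<open>A solution of \<open>p' = s G p\<close> is compared with a perturbed solution run backwards from its
  endpoint; \<open>D\<close> plays the role of the derivative of \<open>G\<close> at \<open>p 0\<close>.\<close>

lemma backward_flow_estimate:
  fixes p q :: "real \<Rightarrow> 'a::euclidean_space"
  assumes L: "L-lipschitz_on UNIV G" and s: "0 < s" "s * L \<le> 1/2"
    and p: "\<And>t. t \<in> {0..1} \<Longrightarrow> (p has_vector_derivative s *\<^sub>R G (p t)) (at t within {0..1})"
    and q: "\<And>t. t \<in> {0..1} \<Longrightarrow> (q has_vector_derivative (-s) *\<^sub>R G (q t)) (at t within {0..1})"
    and D: "linear D" "\<And>v. norm (D v) \<le> K * norm v" "0 \<le> K"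
    and strict: "\<And>a b. a \<in> ball x \<rho> \<Longrightarrow> b \<in> ball x \<rho> \<Longrightarrow> norm (G a - G b - D (a - b)) \<le> \<omega> * norm (a - b)"
    and \<omega>: "0 \<le> \<omega>"
    and ball: "\<And>t. t \<in> {0..1} \<Longrightarrow> norm (p t - x) + 2 * norm (q 0 - p 1) < \<rho>"
  shows "norm (q 1 - p 0 - (q 0 - p 1) + s *\<^sub>R D (q 0 - p 1)) \<le> s * (2 * \<omega> + 2 * s * K * L) * norm (q 0 - p 1)"
proof -
  have L0: "L \<ge> 0" using L lipschitz_on_nonneg by blast
  \<comment> \<open>Reversed in time, \<open>p\<close> solves the same equation as \<open>q\<close>;
    \<open>d\<close> is their difference and starts from the perturbation
    \<open>q 0 - p 1\<close>.\<close>
  define d where "d t = q t - p (1 - t)" for t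
  define w where "w = d 0"
  have w: "w = q 0 - p 1" by (simp add: w_def d_def)
  have p': "((\<lambda>t. p (1 - t)) has_vector_derivative (-1) *\<^sub>R (s *\<^sub>R G (p (1 - t)))) (at t within {0..1})" if t: "t \<in> {0..1}" for t
  proof -
    have "((\<lambda>t. 1 - t) has_vector_derivative -1) (at t within {0..1})"
      by (auto intro!: derivative_eq_intros simp: has_real_derivative_iff_has_vector_derivative[symmetric])
    moreover have "(\<lambda>t. 1 - t) ` {0..1} = {0..1::real}" by simp
    ultimately show ?thesis
      using vector_diff_chain_within[of "\<lambda>t. 1 - t" "-1" t "{0..1}" p "s *\<^sub>R G (p (1 - t))"] p[of "1 - t"] t
      by (auto simp: comp_def)
  qed
  have d': "(d has_vector_derivative (-s) *\<^sub>R (G (q t) - G (p (1 - t)))) (at t within {0..1})" if t: "t \<in> {0..1}" for t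
    using has_vector_derivative_diff[OF q[OF t] p'[OF t]] by (simp add: d_def[abs_def] scaleR_diff_right)
  have Gd: "norm (G (q t) - G (p (1 - t))) \<le> L * norm (d t)" for t
    using lipschitz_onD[OF L, of "q t" "p (1 - t)"] by (simp add: dist_norm d_def)
  have "continuous_on {0..1} d" using d' has_vector_derivative_continuous unfolding continuous_on_eq_continuous_within by blast
  then obtain t0 where t0: "t0 \<in> {0..1}" "\<And>t. t \<in> {0..1} \<Longrightarrow> norm (d t) \<le> norm (d t0)"
    using continuous_attains_sup[of "{0..1}" "\<lambda>t. norm (d t)", OF _ _ continuous_on_norm] by auto
  \<comment> \<open>Absorption at the time \<open>t0\<close> of largest distance: since
    \<open>s * L\<close> is at most 1/2, the growth of \<open>d\<close> is at most half its maximum,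
    so \<open>d\<close> never exceeds twice its initial size.\<close>
  have lip: "(1/2 * norm (d t0))-lipschitz_on {0..1} d"
  proof (rule has_bounded_vector_derivative_imp_lipschitz[OF d'])
    fix t :: real assume t: "t \<in> {0..1}"
    have "norm ((-s) *\<^sub>R (G (q t) - G (p (1 - t)))) \<le> s * (L * norm (d t))" using s Gd[of t] by (simp add: mult_left_mono)
    also have "\<dots> \<le> 1/2 * norm (d t0)" using s L0 t0(2)[OF t] mult_mono[of "s * L" "1/2" "norm (d t)" "norm (d t0)"] by (simp add: mult.assoc)
    finally show "norm ((-s) *\<^sub>R (G (q t) - G (p (1 - t)))) \<le> 1/2 * norm (d t0)" .
  qed auto
  have "norm (d t0 - w) \<le> 1/2 * norm (d t0) * \<bar>t0\<bar>"
    using lipschitz_onD[OF lip, of t0 0] t0(1) by (simp add: dist_norm w_def)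
  also have "\<dots> \<le> 1/2 * norm (d t0)" using t0(1) by (intro mult_left_le) auto
  finally have "norm (d t0) \<le> 2 * norm w" using norm_triangle_sub[of "d t0" w] by linarith
  then have dw: "norm (d t) \<le> 2 * norm w" if "t \<in> {0..1}" for t using t0(2)[OF that] by linarith
  \<comment> \<open>With this bound, \<open>d\<close> moves away from its initial value by only
    O(s).\<close>
  have lip2: "(s * L * (2 * norm w))-lipschitz_on {0..1} d"
  proof (rule has_bounded_vector_derivative_imp_lipschitz[OF d'])
    fix t :: real assume t: "t \<in> {0..1}"
    have "norm ((-s) *\<^sub>R (G (q t) - G (p (1 - t)))) \<le> s * (L * norm (d t))" using s Gd[of t] by (simp add: mult_left_mono)
    also have "\<dots> \<le> s * L * (2 * norm w)" using s L0 dw[OF t] by (simp add: mult_left_mono mult.assoc)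
    finally show "norm ((-s) *\<^sub>R (G (q t) - G (p (1 - t)))) \<le> s * L * (2 * norm w)" .
  qed (use s L0 in auto)
  have ddw: "norm (d t - w) \<le> s * L * (2 * norm w)" if t: "t \<in> {0..1}" for t
  proof -
    have "norm (d t - w) \<le> s * L * (2 * norm w) * \<bar>t\<bar>"
      using lipschitz_onD[OF lip2, of t 0] t by (simp add: dist_norm w_def)
    also have "\<dots> \<le> s * L * (2 * norm w)" using t s L0 by (intro mult_left_le) auto
    finally show ?thesis .
  qed
  \<comment> \<open>Adding \<open>t s D w\<close> cancels the leading part of the derivative of
    \<open>d\<close>. What remains is the error of linearising \<open>G\<close> and that of
    replacing \<open>d t\<close> by \<open>w\<close>; comparing the times 0 and 1 gives the
    claim.\<close>
  have "(s * (2 * \<omega> + 2 * s * K * L) * norm w)-lipschitz_on {0..1} (\<lambda>t. d t + t *\<^sub>R (s *\<^sub>R D w))"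
  proof (rule has_bounded_vector_derivative_imp_lipschitz)
    fix t :: real assume t: "t \<in> {0..1}"
    show "((\<lambda>t. d t + t *\<^sub>R (s *\<^sub>R D w)) has_vector_derivative (-s) *\<^sub>R (G (q t) - G (p (1 - t))) + s *\<^sub>R D w) (at t within {0..1})"
      by (intro has_vector_derivative_add d'[OF t]) (auto intro!: derivative_eq_intros)
    have pb: "p (1 - t) \<in> ball x \<rho>" and qb: "q t \<in> ball x \<rho>"
    proof -
      have *: "norm (p (1 - t) - x) + 2 * norm w < \<rho>" using ball[of "1 - t"] t w by auto
      then have "norm (p (1 - t) - x) < \<rho>" using norm_ge_zero[of w] by linarith
      then show "p (1 - t) \<in> ball x \<rho>" by (simp add: dist_norm norm_minus_commute)
      have "norm (q t - x) \<le> norm (d t) + norm (p (1 - t) - x)"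
        using norm_triangle_ineq[of "d t" "p (1 - t) - x"] by (simp add: d_def)
      then have "norm (q t - x) < \<rho>" using * dw[OF t] by linarith
      then show "q t \<in> ball x \<rho>" by (simp add: dist_norm norm_minus_commute)
    qed
    have "(-s) *\<^sub>R (G (q t) - G (p (1 - t))) + s *\<^sub>R D w = (-s) *\<^sub>R ((G (q t) - G (p (1 - t)) - D (q t - p (1 - t))) + D (d t - w))"
      by (simp add: d_def linear_diff[OF D(1)] linear_add[OF D(1)] algebra_simps)
    also have "norm \<dots> = s * norm ((G (q t) - G (p (1 - t)) - D (q t - p (1 - t))) + D (d t - w))"
      using s by simp
    also have "\<dots> \<le> s * (\<omega> * (2 * norm w) + K * (s * L * (2 * norm w)))"
    proof (intro mult_left_mono order_trans[OF norm_triangle_ineq] add_mono)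
      have "norm (G (q t) - G (p (1 - t)) - D (q t - p (1 - t))) \<le> \<omega> * norm (d t)"
        using strict[OF qb pb] by (simp add: d_def)
      also have "\<dots> \<le> \<omega> * (2 * norm w)" using dw[OF t] \<omega> by (rule mult_left_mono)
      finally show "norm (G (q t) - G (p (1 - t)) - D (q t - p (1 - t))) \<le> \<omega> * (2 * norm w)" .
      show "norm (D (d t - w)) \<le> K * (s * L * (2 * norm w))"
        using D(2)[of "d t - w"] mult_left_mono[OF ddw[OF t] D(3)] by linarith
    qed (use s in auto)
    also have "\<dots> = s * (2 * \<omega> + 2 * s * K * L) * norm w" by (simp add: algebra_simps)
    finally show "norm ((-s) *\<^sub>R (G (q t) - G (p (1 - t))) + s *\<^sub>R D w) \<le> s * (2 * \<omega> + 2 * s * K * L) * norm w" .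
  qed (use s L0 D(3) \<omega> in auto)
  from lipschitz_onD[OF this, of 1 0] show ?thesis
    by (simp add: dist_norm w_def d_def algebra_simps)
qed

lemma norm_add5_le:
  "norm (a + b - c + d + e) \<le> norm a + norm b + norm c + norm d + norm (e::'a::real_normed_vector)"
  using norm_add3_le[of "a + b - c" d e] norm_triangle_ineq4[of "a + b" c] norm_triangle_ineq[of a b]
  by linarith

text \<open>At the time of largest displacement the Lipschitz term accounts for at most half of it,
  because \<open>s * L\<close> is at most 1/2, and can be absorbed. Inserting the resulting bound
  into the derivative of \<open>p t - t s G (p 0)\<close> gives the second-order estimate.\<close>

lemma flow_displacement:
  fixes p :: "real \<Rightarrow> 'a::euclidean_space"
  assumes L: "L-lipschitz_on UNIV G" and s: "0 < s" "s * L \<le> 1/2"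
    and p: "\<And>t. t \<in> {0..1} \<Longrightarrow> (p has_vector_derivative s *\<^sub>R G (p t)) (at t within {0..1})"
  shows "t \<in> {0..1} \<Longrightarrow> norm (p t - p 0) \<le> 2 * s * norm (G (p 0))"
    and "norm (p 1 - p 0 - s *\<^sub>R G (p 0)) \<le> 2 * s\<^sup>2 * L * norm (G (p 0))"
proof -
  have L0: "L \<ge> 0" using L lipschitz_on_nonneg by blast
  have Gp: "norm (G (p t) - G (p 0)) \<le> L * norm (p t - p 0)" for t
    using lipschitz_onD[OF L, of "p t" "p 0"] by (simp add: dist_norm)
  have "continuous_on {0..1} p"
    using p has_vector_derivative_continuous unfolding continuous_on_eq_continuous_within by blast
  then have "continuous_on {0..1} (\<lambda>t. p t - p 0)" by (intro continuous_intros)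
  then obtain t0 where t0: "t0 \<in> {0..1}" "\<And>t. t \<in> {0..1} \<Longrightarrow> norm (p t - p 0) \<le> norm (p t0 - p 0)"
    using continuous_attains_sup[of "{0..1}" "\<lambda>t. norm (p t - p 0)", OF _ _ continuous_on_norm] by auto
  have lip: "(s * norm (G (p 0)) + 1/2 * norm (p t0 - p 0))-lipschitz_on {0..1} p"
  proof (rule has_bounded_vector_derivative_imp_lipschitz[OF p])
    fix t :: real assume t: "t \<in> {0..1}"
    have "norm (G (p t)) \<le> norm (G (p 0)) + L * norm (p t - p 0)"
      using Gp[of t] norm_triangle_sub[of "G (p t)" "G (p 0)"] by linarith
    then have "norm (s *\<^sub>R G (p t)) \<le> s * (norm (G (p 0)) + L * norm (p t - p 0))"
      using s by (simp add: mult_left_mono)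
    also have "\<dots> = s * norm (G (p 0)) + (s * L) * norm (p t - p 0)" by (simp add: algebra_simps)
    also have "\<dots> \<le> s * norm (G (p 0)) + 1/2 * norm (p t0 - p 0)"
      using s L0 t0(2)[OF t] by (intro add_mono mult_mono) auto
    finally show "norm (s *\<^sub>R G (p t)) \<le> s * norm (G (p 0)) + 1/2 * norm (p t0 - p 0)" .
  qed (use s in auto)
  have "norm (p t0 - p 0) \<le> (s * norm (G (p 0)) + 1/2 * norm (p t0 - p 0)) * \<bar>t0\<bar>"
    using lipschitz_onD[OF lip, of t0 0] t0(1) by (simp add: dist_norm)
  also have "\<dots> \<le> s * norm (G (p 0)) + 1/2 * norm (p t0 - p 0)"
    using t0(1) s by (intro mult_left_le) auto
  finally have "norm (p t0 - p 0) \<le> 2 * s * norm (G (p 0))" by simp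
  then have b: "norm (p t - p 0) \<le> 2 * s * norm (G (p 0))" if "t \<in> {0..1}" for t
    using t0(2)[OF that] by linarith
  then show "t \<in> {0..1} \<Longrightarrow> norm (p t - p 0) \<le> 2 * s * norm (G (p 0))" .
  have "(2 * s\<^sup>2 * L * norm (G (p 0)))-lipschitz_on {0..1} (\<lambda>t. p t - t *\<^sub>R (s *\<^sub>R G (p 0)))"
  proof (rule has_bounded_vector_derivative_imp_lipschitz)
    fix t :: real assume t: "t \<in> {0..1}"
    show "((\<lambda>t. p t - t *\<^sub>R (s *\<^sub>R G (p 0))) has_vector_derivative s *\<^sub>R G (p t) - s *\<^sub>R G (p 0)) (at t within {0..1})"
      by (intro has_vector_derivative_diff p[OF t]) (auto intro!: derivative_eq_intros)
    have "norm (s *\<^sub>R G (p t) - s *\<^sub>R G (p 0)) = s * norm (G (p t) - G (p 0))"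
      using s by (simp flip: scaleR_diff_right)
    also have "\<dots> \<le> s * (L * (2 * s * norm (G (p 0))))"
      using s Gp[of t] mult_left_mono[OF b[OF t] L0] by (intro mult_left_mono) auto
    finally show "norm (s *\<^sub>R G (p t) - s *\<^sub>R G (p 0)) \<le> 2 * s\<^sup>2 * L * norm (G (p 0))"
      by (simp add: power2_eq_square algebra_simps)
  qed (use L0 in auto)
  from lipschitz_onD[OF this, of 1 0]
  show "norm (p 1 - p 0 - s *\<^sub>R G (p 0)) \<le> 2 * s\<^sup>2 * L * norm (G (p 0))"
    by (simp add: dist_norm algebra_simps)
qed

text \<open>Conjugating the step along \<open>X\<close> by the flow of \<open>G\<close> over time \<open>s\<close> transports \<open>X\<close> to
  \<open>X + s [G, X] + o(s)\<close>.\<close>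

lemma euler_steps_conjugate:
  fixes G X :: "real^'n::finite \<Rightarrow> real^'n"
  assumes comp: "\<And>\<phi> \<psi>. \<phi> \<in> R \<Longrightarrow> \<psi> \<in> R \<Longrightarrow> \<phi> \<circ> \<psi> \<in> R"
    and L: "L-lipschitz_on UNIV G"
    and flow: "\<And>s. \<bar>s\<bar> * L \<le> 1/2 \<Longrightarrow> \<exists>\<phi>\<in>R. \<forall>x. \<exists>y. y 0 = x \<and> y 1 = \<phi> x \<and>
           (\<forall>t\<in>{0..1}. (y has_vector_derivative s *\<^sub>R G (y t)) (at t within {0..1}))"
    and G: "Ck_on 1 G UNIV" and X: "Ck_on 1 X UNIV" "generated R X" and e: "e > 0"
  shows "\<exists>s0>0. \<forall>s. 0 < s \<and> s < s0 \<longrightarrow> euler_steps R (\<lambda>x. X x + s *\<^sub>R lie_bracket G X x) r (e * s)"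
proof -
  have L0: "L \<ge> 0" using L lipschitz_on_nonneg by blast
  have cG: "continuous_on UNIV G" and cX: "continuous_on UNIV X"
    using Ck_on_Suc_imp_continuous_on[of 0] G X(1) by auto
  have "bounded (G ` cball 0 (r+1))" "bounded (X ` cball 0 (r+1))"
    using continuous_on_subset[OF cG] continuous_on_subset[OF cX]
    by (auto intro!: compact_imp_bounded compact_continuous_image)
  then obtain M1 M2 where "\<forall>x\<in>cball 0 (r+1). norm (G x) \<le> M1" "\<forall>x\<in>cball 0 (r+1). norm (X x) \<le> M2"
    unfolding bounded_iff by blast
  then have M12: "norm x \<le> r+1 \<Longrightarrow> norm (G x) \<le> M1" "norm x \<le> r+1 \<Longrightarrow> norm (X x) \<le> M2" for x
    by auto
  define M where "M = max 1 (max M1 M2)"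
  have M: "M \<ge> 1" "\<And>x. norm x \<le> r+1 \<Longrightarrow> norm (G x) \<le> M" "\<And>x. norm x \<le> r+1 \<Longrightarrow> norm (X x) \<le> M"
    using M12 unfolding M_def by fastforce+
  let ?DG = "\<lambda>x. frechet_derivative G (at x)" and ?DX = "\<lambda>x. frechet_derivative X (at x)"
  obtain K1 where K1: "K1 \<ge> 0" "\<And>x v. norm x \<le> r \<Longrightarrow> norm (?DG x v) \<le> K1 * norm v"
    using frechet_derivative_bounded_on_ball[OF G, of r] by blast
  obtain K2 where K2: "K2 \<ge> 0" "\<And>x v. norm x \<le> r \<Longrightarrow> norm (?DX x v) \<le> K2 * norm v"
    using frechet_derivative_bounded_on_ball[OF X(1), of r] by blast
  define K where "K = max K1 K2"
  have K: "K \<ge> 0" "norm x \<le> r \<Longrightarrow> norm (?DG x v) \<le> K * norm v" "norm x \<le> r \<Longrightarrow> norm (?DX x v) \<le> K * norm v" for x v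
    using K1(1) K1(2)[of x v] K2(2)[of x v] mult_right_mono[of K1 K "norm v"] mult_right_mono[of K2 K "norm v"]
    unfolding K_def by (auto intro: order_trans)
  have linG: "linear (?DG x)" and linX: "linear (?DX x)" for x
    using G X(1) by (auto intro: linear_frechet_derivative)
  \<comment> \<open>The final error is \<open>s h (6 \<omega> M + \<eta> + s C)\<close>. The choices
    of \<omega>, \<eta> and the bound on \<open>s\<close> make each term at most
    \<open>e / 4\<close>; \<open>C\<close> collects the coefficients of second order in
    \<open>s\<close>.\<close>
  define \<omega> where "\<omega> = min 1 (e / (24 * M))"
  define \<eta> where "\<eta> = min 1 (e / 4)"
  define C where "C = 4 * K * L * M + K * (1 + (K + 1) * (2 * M)) + 2 * K * L * M"
  have \<omega>: "0 < \<omega>" "\<omega> \<le> 1" "6 * \<omega> * M \<le> e / 4" using e M(1) by (auto simp: \<omega>_def min_def field_simps)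
  have \<eta>: "0 < \<eta>" "\<eta> \<le> 1" "\<eta> \<le> e / 4" using e by (auto simp: \<eta>_def)
  have C0: "C \<ge> 0" unfolding C_def using K(1) L0 M(1) by (intro add_nonneg_nonneg mult_nonneg_nonneg) auto
  obtain \<rho>1 where \<rho>1: "\<rho>1 > 0" "\<And>x a b. norm x \<le> r \<Longrightarrow> a \<in> ball x \<rho>1 \<Longrightarrow> b \<in> ball x \<rho>1 \<Longrightarrow>
     norm (G a - G b - ?DG x (a - b)) \<le> \<omega> * norm (a - b)"
    using uniform_strict_differentiability[OF G \<omega>(1), of r] by blast
  obtain \<rho>2 where \<rho>2: "\<rho>2 > 0" "\<And>x a b. norm x \<le> r \<Longrightarrow> a \<in> ball x \<rho>2 \<Longrightarrow> b \<in> ball x \<rho>2 \<Longrightarrow>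
     norm (X a - X b - ?DX x (a - b)) \<le> \<omega> * norm (a - b)"
    using uniform_strict_differentiability[OF X(1) \<omega>(1), of r] by blast
  define \<rho> where "\<rho> = min 1 (min \<rho>1 \<rho>2)"
  have \<rho>: "\<rho> > 0" "\<rho> \<le> 1" "\<rho> \<le> \<rho>1" "\<rho> \<le> \<rho>2" using \<rho>1(1) \<rho>2(1) by (auto simp: \<rho>_def)
  \<comment> \<open>The bounds ensure, in turn, that the flow stays within half of \<rho>, that the
    flow of \<open>G\<close> is available, and that \<open>s * C\<close> is at most
    \<open>e / 4\<close>.\<close>
  define s0 where "s0 = min (min 1 (\<rho> / (4 * M))) (min (1 / (2 * (L + 1))) (e / (4 * (C + 1))))"
  have s0: "s0 > 0" using \<rho>(1) M(1) L0 e C0 by (auto simp: s0_def)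
  have "euler_steps R (\<lambda>x. X x + s *\<^sub>R lie_bracket G X x) r (e * s)" if s: "0 < s" "s < s0" for s
  proof -
    have s1: "s < 1" "2 * s * M < \<rho> / 2" using s M(1) by (auto simp: s0_def field_simps)
    have sL: "s * L \<le> 1/2"
    proof -
      have "s * (L + 1) \<le> 1/2" using s L0 by (auto simp: s0_def field_simps)
      then show ?thesis using s by (simp add: distrib_left)
    qed
    have sC: "s * C \<le> e / 4"
    proof -
      have "s * (C + 1) \<le> e / 4" using s C0 by (auto simp: s0_def field_simps)
      then show ?thesis using s by (simp add: distrib_left)
    qed
    obtain \<alpha> where \<alpha>: "\<alpha> \<in> R" "\<And>x. \<exists>y. y 0 = x \<and> y 1 = \<alpha> x \<and>
           (\<forall>t\<in>{0..1}. (y has_vector_derivative s *\<^sub>R G (y t)) (at t within {0..1}))"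
      using flow[of s] s sL by auto
    obtain \<beta> where \<beta>: "\<beta> \<in> R" "\<And>x. \<exists>y. y 0 = x \<and> y 1 = \<beta> x \<and>
           (\<forall>t\<in>{0..1}. (y has_vector_derivative (-s) *\<^sub>R G (y t)) (at t within {0..1}))"
      using flow[of "-s"] s sL by auto
    have "0 < \<eta> * s" using \<eta> s by simp
    then have "euler_steps R X (r+1) (\<eta> * s)" using X(2) unfolding generated_def by simp
    then obtain h1 where h1: "h1 > 0" "\<And>h. 0 < h \<Longrightarrow> h < h1 \<Longrightarrow>
       \<exists>\<phi>\<in>R. \<forall>x. norm x \<le> r+1 \<longrightarrow> norm (\<phi> x - x - h *\<^sub>R X x) \<le> \<eta> * s * h"
      unfolding euler_steps_def by auto
    \<comment> \<open>\<open>h\<close> is made small after \<open>s\<close> is fixed; the defect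
      \<eta> s of the step along \<open>X\<close> already depends on \<open>s\<close>.\<close>
    define h0 where "h0 = min h1 (\<rho> / (8 * M))"
    have h0: "h0 > 0" using h1(1) \<rho>(1) M(1) by (simp add: h0_def)
    have "\<exists>\<phi>\<in>R. \<forall>x. norm x \<le> r \<longrightarrow> norm (\<phi> x - x - h *\<^sub>R (X x + s *\<^sub>R lie_bracket G X x)) \<le> e * s * h"
      if h: "0 < h" "h < h0" for h
    proof -
      have hM: "4 * h * M < \<rho> / 2" using h M(1) by (auto simp: h0_def field_simps)
      obtain \<phi> where \<phi>: "\<phi> \<in> R" "\<And>x. norm x \<le> r+1 \<Longrightarrow> norm (\<phi> x - x - h *\<^sub>R X x) \<le> \<eta> * s * h"
        using h1(2)[of h] h unfolding h0_def by auto
      \<comment> \<open>Flow forward along \<open>G\<close>, step along \<open>X\<close>, flow back.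
        The curve \<open>p\<close> is the way out, \<open>q\<close> the way back from the displaced
        endpoint, and \<open>w\<close> the displacement made in between.\<close>
      have "norm ((\<beta> \<circ> (\<phi> \<circ> \<alpha>)) x - x - h *\<^sub>R (X x + s *\<^sub>R lie_bracket G X x)) \<le> e * s * h" if x: "norm x \<le> r" for x
      proof -
        obtain p where p: "p 0 = x" "p 1 = \<alpha> x" "\<And>t. t\<in>{0..1} \<Longrightarrow> (p has_vector_derivative s *\<^sub>R G (p t)) (at t within {0..1})"
          using \<alpha>(2) by blast
        obtain q where q: "q 0 = \<phi> (p 1)" "q 1 = \<beta> (\<phi> (p 1))" "\<And>t. t\<in>{0..1} \<Longrightarrow> (q has_vector_derivative (-s) *\<^sub>R G (q t)) (at t within {0..1})"
          using \<beta>(2) by blast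
        define y where "y = p 1"
        define w where "w = q 0 - p 1"
        have GxM: "norm (G x) \<le> M" "norm (X x) \<le> M" using M(2,3)[of x] x by auto
        have pd: "norm (p t - x) \<le> 2 * s * M" if "t \<in> {0..1}" for t
        proof -
          have "norm (p t - x) \<le> 2 * s * norm (G x)" using flow_displacement(1)[OF L s(1) sL p(3) that] p(1) by simp
          also have "\<dots> \<le> 2 * s * M" using GxM s by (intro mult_left_mono) auto
          finally show ?thesis .
        qed
        have yd: "norm (y - x - s *\<^sub>R G x) \<le> 2 * s\<^sup>2 * L * M"
        proof -
          have "norm (y - x - s *\<^sub>R G x) \<le> 2 * s\<^sup>2 * L * norm (G x)"
            using flow_displacement(2)[OF L s(1) sL p(3)] p(1) by (simp add: y_def)
          also have "\<dots> \<le> 2 * s\<^sup>2 * L * M" using GxM s L0 by (intro mult_left_mono) auto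
          finally show ?thesis .
        qed
        have yx: "norm (y - x) \<le> 2 * s * M" using pd[of 1] by (simp add: y_def)
        have yr: "norm y \<le> r + 1"
          using norm_triangle_sub[of y x] yx s1 \<rho>(2) x by linarith
        have wX: "norm (w - h *\<^sub>R X y) \<le> \<eta> * s * h"
          using \<phi>(2)[OF yr] by (simp add: w_def y_def q(1))
        have w2: "norm w \<le> 2 * M * h"
        proof -
          have "norm w \<le> norm (h *\<^sub>R X y) + norm (w - h *\<^sub>R X y)" by (rule norm_triangle_sub)
          also have "\<dots> \<le> h * M + \<eta> * s * h" using wX M(3)[OF yr] h by (intro add_mono) (auto simp: mult_left_mono)
          also have "\<eta> * s * h \<le> M * h"
            using mult_mono[of \<eta> 1 s 1] \<eta> s s1 M(1) h by (intro mult_right_mono) auto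
          finally show ?thesis by (simp add: algebra_simps)
        qed
        have 1: "norm (q 1 - x - w + s *\<^sub>R ?DG x w) \<le> s * (2 * \<omega> + 2 * s * K * L) * norm w"
        proof -
          have "norm (q 1 - p 0 - (q 0 - p 1) + s *\<^sub>R ?DG x (q 0 - p 1)) \<le> s * (2 * \<omega> + 2 * s * K * L) * norm (q 0 - p 1)"
          proof (rule backward_flow_estimate[OF L s(1) sL p(3) q(3) linG K(2)[OF x] K(1), where \<rho>=\<rho>])
            fix a b assume "a \<in> ball x \<rho>" "b \<in> ball x \<rho>"
            then show "norm (G a - G b - ?DG x (a - b)) \<le> \<omega> * norm (a - b)" using \<rho>1(2)[OF x] \<rho> by auto
          next
            fix t :: real assume "t \<in> {0..1}"
            then have "norm (p t - x) \<le> 2 * s * M" by (rule pd)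
            then show "norm (p t - x) + 2 * norm (q 0 - p 1) < \<rho>" using w2 hM s1 by (simp add: w_def algebra_simps)
          qed (use \<omega> in auto)
          then show ?thesis by (simp add: w_def p(1))
        qed
        have 2: "norm (X y - X x - ?DX x (y - x)) \<le> \<omega> * (2 * s * M)"
        proof -
          have "2 * s * M < \<rho>" using s1 \<rho> by linarith
          then have "y \<in> ball x \<rho>2" using yx \<rho> by (auto simp: dist_norm norm_minus_commute)
          then have "norm (X y - X x - ?DX x (y - x)) \<le> \<omega> * norm (y - x)"
            using \<rho>2(2)[OF x, of y x] \<rho>2(1) by simp
          also have "\<dots> \<le> \<omega> * (2 * s * M)" using yx \<omega> by (intro mult_left_mono) auto
          finally show ?thesis .
        qed
        have 3: "norm (?DX x (y - x) - s *\<^sub>R ?DX x (G x)) \<le> K * (2 * s\<^sup>2 * L * M)"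
        proof -
          have "norm (?DX x (y - x - s *\<^sub>R G x)) \<le> K * norm (y - x - s *\<^sub>R G x)" by (rule K(3)[OF x])
          also have "\<dots> \<le> K * (2 * s\<^sup>2 * L * M)" using yd K(1) by (rule mult_left_mono)
          finally show ?thesis by (simp add: linear_diff[OF linX] linear_cmul[OF linX])
        qed
        have 4: "norm (X y - X x) \<le> (K + 1) * (2 * s * M)"
        proof -
          have "norm (X y - X x) \<le> norm (?DX x (y - x)) + norm (X y - X x - ?DX x (y - x))" by (rule norm_triangle_sub)
          also have "\<dots> \<le> K * (2 * s * M) + 1 * (2 * s * M)"
          proof (rule add_mono)
            show "norm (?DX x (y - x)) \<le> K * (2 * s * M)"
              using K(3)[OF x, of "y - x"] mult_left_mono[OF yx K(1)] by linarith
            have "\<omega> * (2 * s * M) \<le> 1 * (2 * s * M)" using \<omega> s M(1) by (intro mult_right_mono) auto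
            then show "norm (X y - X x - ?DX x (y - x)) \<le> 1 * (2 * s * M)" using 2 by linarith
          qed
          finally show ?thesis by (simp add: algebra_simps)
        qed
        have 5: "norm (w - h *\<^sub>R X x) \<le> h * s * (1 + (K + 1) * (2 * M))"
        proof -
          have "norm (w - h *\<^sub>R X x) \<le> norm (w - h *\<^sub>R X y) + norm (h *\<^sub>R (X y - X x))"
            using norm_triangle_ineq[of "w - h *\<^sub>R X y" "h *\<^sub>R (X y - X x)"] by (simp add: algebra_simps)
          also have "\<dots> \<le> 1 * s * h + h * ((K + 1) * (2 * s * M))"
          proof (rule add_mono)
            have "\<eta> * s * h \<le> 1 * s * h" using \<eta> s h by (intro mult_right_mono) auto
            then show "norm (w - h *\<^sub>R X y) \<le> 1 * s * h" using wX by linarith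
            show "norm (h *\<^sub>R (X y - X x)) \<le> h * ((K + 1) * (2 * s * M))" using 4 h by (simp add: mult_left_mono)
          qed
          finally show ?thesis by (simp add: algebra_simps)
        qed
        have 6: "norm (s *\<^sub>R (?DG x (w - h *\<^sub>R X x))) \<le> s * (K * (h * s * (1 + (K + 1) * (2 * M))))"
          using K(2)[OF x, of "w - h *\<^sub>R X x"] mult_left_mono[OF 5 K(1)] s by (simp add: mult_left_mono)
        have 7: "norm (q 1 - x - w + s *\<^sub>R ?DG x w) \<le> s * (2 * \<omega> + 2 * s * K * L) * (2 * M * h)"
        proof -
          have "0 \<le> s * (2 * \<omega> + 2 * s * K * L)" using s \<omega> K(1) L0 by (intro mult_nonneg_nonneg add_nonneg_nonneg) auto
          with mult_left_mono[OF w2 this] 1 show ?thesis by linarith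
        qed
        \<comment> \<open>Five sources of error: the backward flow, the step along \<open>X\<close>,
          replacing \<open>w\<close> by \<open>h X x\<close> in the derivative of \<open>G\<close>,
          linearising \<open>X\<close> between \<open>x\<close> and \<open>y\<close>, and replacing
          \<open>y - x\<close> by \<open>s G x\<close>. What is left is X + s (DX G - DG X).\<close>
        define A1 where "A1 = q 1 - x - w + s *\<^sub>R ?DG x w"
        define A2 where "A2 = w - h *\<^sub>R X y"
        define A3 where "A3 = s *\<^sub>R (?DG x (w - h *\<^sub>R X x))"
        define A4 where "A4 = h *\<^sub>R (X y - X x - ?DX x (y - x))"
        define A5 where "A5 = h *\<^sub>R (?DX x (y - x) - s *\<^sub>R ?DX x (G x))"
        have "q 1 - x - h *\<^sub>R (X x + s *\<^sub>R lie_bracket G X x) = A1 + A2 - A3 + A4 + A5"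
          by (simp add: A1_def A2_def A3_def A4_def A5_def lie_bracket_def linear_diff[OF linG] linear_cmul[OF linG] algebra_simps)
        then have "norm (q 1 - x - h *\<^sub>R (X x + s *\<^sub>R lie_bracket G X x)) \<le> norm A1 + norm A2 + norm A3 + norm A4 + norm A5"
          by (simp only: norm_add5_le)
        also have "\<dots> \<le> s * (2 * \<omega> + 2 * s * K * L) * (2 * M * h) + \<eta> * s * h + s * (K * (h * s * (1 + (K + 1) * (2 * M)))) +
            h * (\<omega> * (2 * s * M)) + h * (K * (2 * s\<^sup>2 * L * M))"
          using 7 wX 6 2 3 h unfolding A1_def A2_def A3_def A4_def A5_def
          by (intro add_mono) (simp_all add: mult_left_mono)
        also have "\<dots> = (s * h) * (6 * \<omega> * M + \<eta> + s * C)"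
          by (simp add: C_def power2_eq_square algebra_simps)
        also have "\<dots> \<le> (s * h) * e" using s h \<omega>(3) \<eta>(3) sC e by (intro mult_left_mono) auto
        finally show ?thesis by (simp add: q p(2)[symmetric] mult.commute mult.left_commute)
      qed
      moreover have "\<beta> \<circ> (\<phi> \<circ> \<alpha>) \<in> R" using comp \<alpha>(1) \<beta>(1) \<phi>(1) by blast
      ultimately show ?thesis by blast
    qed
    then show ?thesis unfolding euler_steps_def using h0 by blast
  qed
  then show ?thesis using s0 by blast
qed

text \<open>Composing a conjugated step with one along -X cancels \<open>X\<close> and leaves
  \<open>s [G, X]\<close> with an error proportional to \<open>s\<close>. Dividing by
  \<open>s\<close> turns this into a step along the bracket.\<close>

lemma generated_lie_bracket:
  fixes G X :: "real^'n::finite \<Rightarrow> real^'n"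
  assumes comp: "\<And>\<phi> \<psi>. \<phi> \<in> R \<Longrightarrow> \<psi> \<in> R \<Longrightarrow> \<phi> \<circ> \<psi> \<in> R"
    and L: "L-lipschitz_on UNIV G"
    and flow: "\<And>s. \<bar>s\<bar> * L \<le> 1/2 \<Longrightarrow> \<exists>\<phi>\<in>R. \<forall>x. \<exists>y. y 0 = x \<and> y 1 = \<phi> x \<and>
           (\<forall>t\<in>{0..1}. (y has_vector_derivative s *\<^sub>R G (y t)) (at t within {0..1}))"
    and G: "Ck_on 1 G UNIV" and X: "Ck_on 1 X UNIV" "generated R X" "generated R (\<lambda>x. - X x)"
  shows "generated R (lie_bracket G X)"
  unfolding generated_def
proof (intro allI impI)
  fix r e :: real assume e: "e > 0"
  have cX: "continuous_on UNIV X" and cB: "continuous_on UNIV (lie_bracket G X)"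
    using Ck_on_Suc_imp_continuous_on[of 0 X] X(1) Ck_on_lie_bracket[of 0 G X] G by auto
  obtain s0 where s0: "s0 > 0" "\<And>s. 0 < s \<Longrightarrow> s < s0 \<Longrightarrow>
      euler_steps R (\<lambda>x. X x + s *\<^sub>R lie_bracket G X x) (r+1) (e/3 * s)"
    using euler_steps_conjugate[OF comp L flow G X(1,2), of "e/3" "r+1"] e by auto
  \<comment> \<open>For a given tolerance any one positive value below \<open>s0\<close> serves; no
    limit in \<open>s\<close> has to be taken.\<close>
  define s where "s = s0 / 2"
  have s: "0 < s" "s < s0" using s0(1) by (auto simp: s_def)
  have "euler_steps R (\<lambda>x. (X x + s *\<^sub>R lie_bracket G X x) + - X x) r (s * e)"
  proof (rule euler_steps_add[OF comp s0(2)[OF s]])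
    show "euler_steps R (\<lambda>x. - X x) r (e/3 * s)" using X(3) s e unfolding generated_def by simp
  qed (use cX cB s e in \<open>auto intro!: continuous_intros simp: field_simps\<close>)
  then have "euler_steps R (\<lambda>x. s *\<^sub>R lie_bracket G X x) r (s * e)" by simp
  then show "euler_steps R (lie_bracket G X) r e" by (rule euler_steps_scale) (use s in auto)
qed

lemma generated_flow_field:
  fixes G :: "'a::euclidean_space \<Rightarrow> 'a"
  assumes L: "L-lipschitz_on UNIV G"
    and flow: "\<And>s. 0 < s \<Longrightarrow> s * L \<le> 1/2 \<Longrightarrow> \<exists>\<phi>\<in>R. \<forall>x. \<exists>y. y 0 = x \<and> y 1 = \<phi> x \<and>
           (\<forall>t\<in>{0..1}. (y has_vector_derivative s *\<^sub>R G (y t)) (at t within {0..1}))"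
  shows "generated R G"
  unfolding generated_def
proof (intro allI impI)
  fix r e :: real assume e: "e > 0"
  have L0: "L \<ge> 0" using L lipschitz_on_nonneg by blast
  have "bounded (G ` cball 0 r)"
    using continuous_on_subset[OF lipschitz_on_continuous_on[OF L]]
    by (intro compact_imp_bounded compact_continuous_image) auto
  then obtain M where M: "M > 0" "\<And>x. norm x \<le> r \<Longrightarrow> norm (G x) \<le> M" unfolding bounded_pos by auto
  \<comment> \<open>The flow over time \<open>h\<close> deviates from the straight step by at most
    \<open>2 h^2 L M\<close>; the second bound makes this at most \<open>e h\<close>, the first lets
    the flow exist.\<close>
  define h0 where "h0 = min (1 / (2 * (L + 1))) (e / (2 * (L + 1) * M))"
  have h0: "h0 > 0" using L0 M e by (simp add: h0_def)
  have "\<exists>\<phi>\<in>R. \<forall>x. norm x \<le> r \<longrightarrow> norm (\<phi> x - x - h *\<^sub>R G x) \<le> e * h" if h: "0 < h" "h < h0" for h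
  proof -
    have "h < 1 / (2 * (L + 1))" "h < e / (2 * (L + 1) * M)" using h by (auto simp: h0_def)
    then have "h * (2 * (L + 1)) < 1" "h * (2 * (L + 1) * M) < e" using L0 M by (simp_all add: pos_less_divide_eq)
    then have h1: "h * (L + 1) \<le> 1/2" "2 * (h * (L + 1)) * M \<le> e" by (auto simp: algebra_simps)
    have hL: "h * L \<le> 1/2" "2 * (h * L) * M \<le> e"
    proof -
      have "h * L \<le> h * (L + 1)" using h by (intro mult_left_mono) auto
      moreover from this have "2 * (h * L) * M \<le> 2 * (h * (L + 1)) * M" using M by (intro mult_right_mono) auto
      ultimately show "h * L \<le> 1/2" "2 * (h * L) * M \<le> e" using h1 by linarith+
    qed
    obtain \<phi> where \<phi>: "\<phi> \<in> R" "\<And>x. \<exists>y. y 0 = x \<and> y 1 = \<phi> x \<and>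
           (\<forall>t\<in>{0..1}. (y has_vector_derivative h *\<^sub>R G (y t)) (at t within {0..1}))"
      using flow[OF h(1) hL(1)] by blast
    have "norm (\<phi> x - x - h *\<^sub>R G x) \<le> e * h" if x: "norm x \<le> r" for x
    proof -
      obtain p where p: "p 0 = x" "p 1 = \<phi> x" "\<And>t. t\<in>{0..1} \<Longrightarrow> (p has_vector_derivative h *\<^sub>R G (p t)) (at t within {0..1})"
        using \<phi>(2) by blast
      have "norm (\<phi> x - x - h *\<^sub>R G x) \<le> 2 * h\<^sup>2 * L * norm (G x)"
        using flow_displacement(2)[OF L h(1) hL(1) p(3)] p by simp
      also have "\<dots> \<le> 2 * h\<^sup>2 * L * M" using M(2)[OF x] L0 by (intro mult_left_mono) auto
      also have "\<dots> = (2 * (h * L) * M) * h" by (simp add: power2_eq_square)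
      also have "\<dots> \<le> e * h" using hL h by (intro mult_right_mono) auto
      finally show ?thesis .
    qed
    then show ?thesis using \<phi>(1) by blast
  qed
  then show "euler_steps R G r e" unfolding euler_steps_def using h0 by blast
qed

lemma lie_bracket_uminus_right:
  assumes "X differentiable (at x)" "Y differentiable (at x)"
  shows "lie_bracket X (\<lambda>x. - Y x) x = - lie_bracket X Y x"
proof -
  have "((\<lambda>x. - Y x) has_derivative (\<lambda>v. - frechet_derivative Y (at x) v)) (at x)"
    using assms(2) by (intro derivative_intros) (simp add: frechet_derivative_works[symmetric])
  then have "frechet_derivative (\<lambda>x. - Y x) (at x) = (\<lambda>v. - frechet_derivative Y (at x) v)"
    by (metis frechet_derivative_at)
  then show ?thesis
    using linear_neg[OF linear_frechet_derivative[OF assms(1)]] by (simp add: lie_bracket_def)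
qed

text \<open>Both signs form the induction hypothesis: bracketing \<open>X\<close> consumes steps
  along \<open>X\<close> and along -X. The negative of the new bracket comes from [F_i, -X] =
  -[F_i, X].\<close>

lemma generated_iterated_brackets:
  fixes F :: "'k::finite \<Rightarrow> real^'n::finite \<Rightarrow> real^'n"
  assumes smooth: "\<And>i. smooth_on (F i) UNIV" and lip: "\<And>i. \<exists>L. L-lipschitz_on UNIV (F i)"
    and "X \<in> iterated_brackets F"
  shows "generated (reachable F) X \<and> generated (reachable F) (\<lambda>x. - X x)"
  using assms(3)
proof induction
  case (base i)
  obtain L where L: "L-lipschitz_on UNIV (F i)" using lip by blast
  have L': "L-lipschitz_on UNIV (\<lambda>x. - F i x)" using L by simp
  have "generated (reachable F) (F i)"
    by (rule generated_flow_field[OF L]) (use reachable_small_flow[of L F i, OF L] in auto)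
  moreover have "generated (reachable F) (\<lambda>x. - F i x)"
  proof (rule generated_flow_field[OF L'])
    fix s :: real assume "0 < s" "s * L \<le> 1/2"
    then show "\<exists>\<phi>\<in>reachable F. \<forall>x. \<exists>y. y 0 = x \<and> y 1 = \<phi> x \<and>
           (\<forall>t\<in>{0..1}. (y has_vector_derivative s *\<^sub>R - F i (y t)) (at t within {0..1}))"
      using reachable_small_flow[of L F i "-s", OF L] by simp
  qed
  ultimately show ?case by blast
next
  case (bracket X i)
  obtain L where L: "L-lipschitz_on UNIV (F i)" using lip by blast
  have F1: "Ck_on 1 (F i) UNIV" and X1: "Ck_on 1 X UNIV"
    using smooth smooth_on_iterated_brackets[of F, OF smooth bracket(1)] unfolding smooth_on_def by blast+
  have X1': "Ck_on 1 (\<lambda>x. - X x) UNIV"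
    using Ck_on_bounded_linear_comp[OF bounded_linear_minus[OF bounded_linear_ident] X1] .
  have "lie_bracket (F i) (\<lambda>x. - X x) = (\<lambda>x. - lie_bracket (F i) X x)"
    using F1 X1 by (intro ext lie_bracket_uminus_right) auto
  moreover have "generated (reachable F) (lie_bracket (F i) X)"
    using bracket by (intro generated_lie_bracket[OF reachable_comp L reachable_small_flow[of L F i, OF L] F1 X1]) auto
  moreover have "generated (reachable F) (lie_bracket (F i) (\<lambda>x. - X x))"
    using bracket by (intro generated_lie_bracket[OF reachable_comp L reachable_small_flow[of L F i, OF L] F1 X1']) auto
  ultimately show ?case by simp
qed

text \<open>Scaling is available for positive factors only, so a negative coefficient is moved onto
  -Y and a zero coefficient onto the identity map.\<close>

lemma generated_Lie:
  fixes F :: "'k::finite \<Rightarrow> real^'n::finite \<Rightarrow> real^'n"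
  assumes smooth: "\<And>i. smooth_on (F i) UNIV" and lip: "\<And>i. \<exists>L. L-lipschitz_on UNIV (F i)"
    and "X \<in> Lie F"
  shows "generated (reachable F) X"
proof -
  obtain B c where B: "finite B" "B \<subseteq> iterated_brackets F" "X = (\<lambda>x. \<Sum>Y\<in>B. c Y *\<^sub>R Y x)"
    using assms(3) unfolding Lie_def by blast
  have "generated (reachable F) (\<lambda>x. c Y *\<^sub>R Y x) \<and> continuous_on UNIV (\<lambda>x. c Y *\<^sub>R Y x)" if Y: "Y \<in> B" for Y
  proof
    have YF: "Y \<in> iterated_brackets F" using B Y by blast
    note gen = generated_iterated_brackets[of F Y, OF smooth lip YF]
    show "generated (reachable F) (\<lambda>x. c Y *\<^sub>R Y x)"
    proof (cases "c Y" "0::real" rule: linorder_cases)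
      case less
      then show ?thesis using generated_scale[of "reachable F" "\<lambda>x. - Y x" "- c Y"] gen by simp
    next
      case equal
      then show ?thesis using generated_zero[OF id_reachable] by simp
    next
      case greater
      then show ?thesis using generated_scale gen by blast
    qed
    have "Ck_on 0 Y UNIV" using smooth_on_iterated_brackets[of F, OF smooth YF] unfolding smooth_on_def by blast
    then show "continuous_on UNIV (\<lambda>x. c Y *\<^sub>R Y x)" by (auto intro: continuous_intros)
  qed
  then show ?thesis unfolding B(3) by (intro generated_sum reachable_comp id_reachable B(1))
qed

text \<open>A polynomial stands between the continuous field and the Lie algebra: it is close to
  \<open>Y\<close> on the ball and regular enough for whichever \<open>m\<close> the approximating
  property provides.\<close>

lemma generated_continuous:
  fixes F :: "'k::finite \<Rightarrow> real^'n::finite \<Rightarrow> real^'n"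
  assumes smooth: "\<And>i. smooth_on (F i) UNIV" and lip: "\<And>i. \<exists>L. L-lipschitz_on UNIV (F i)"
    and strong: "Lie_strong_approximating F" and Y: "continuous_on UNIV Y"
  shows "generated (reachable F) Y"
proof (rule generated_limit)
  fix r e :: real assume e: "e > 0"
  obtain m where m: "\<And>Y :: real^'n \<Rightarrow> real^'n. \<And>K. Ck_on m Y UNIV \<Longrightarrow> compact K \<Longrightarrow>
      \<exists>\<delta>>0. (INF X\<in>Lie_bounded \<delta> K F. SUP x\<in>K. ennreal (norm (X x - Y x))) = 0"
    using strong unfolding Lie_strong_approximating_def by blast
  obtain g :: "real^'n \<Rightarrow> real^'n" where g: "polynomial_function g" "\<And>x. x \<in> cball 0 r \<Longrightarrow> norm (Y x - g x) < e/2"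
    using Stone_Weierstrass_polynomial_function[OF compact_cball continuous_on_subset[OF Y], of 0 r "e/2"] e by auto
  obtain \<delta> where "(INF X\<in>Lie_bounded \<delta> (cball 0 r) F. SUP x\<in>cball 0 r. ennreal (norm (X x - g x))) = 0"
    using m[OF Ck_on_polynomial_function[OF g(1)] compact_cball[of 0 r]] by blast
  \<comment> \<open>An infimum equal to 0 lies strictly below \<open>e/2\<close>, so some member of
    the family does too.\<close>
  moreover have "(0::ennreal) < ennreal (e/2)" using e by simp
  ultimately obtain X where X: "X \<in> Lie_bounded \<delta> (cball 0 r) F"
     "(SUP x\<in>cball 0 r. ennreal (norm (X x - g x))) < ennreal (e/2)"
    by (metis (no_types, lifting) INF_less_iff)
  have "norm (X x - Y x) \<le> e" if x: "norm x \<le> r" for x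
  proof -
    have xr: "x \<in> cball 0 r" using x by simp
    have "ennreal (norm (X x - g x)) < ennreal (e/2)"
      using X(2) SUP_upper[OF xr, of "\<lambda>x. ennreal (norm (X x - g x))"] by (rule le_less_trans[rotated])
    then have "norm (X x - g x) < e/2" by (simp add: ennreal_less_iff)
    then show ?thesis using g(2)[OF xr] norm_triangle_ineq4[of "X x - g x" "Y x - g x"] by simp
  qed
  moreover have "generated (reachable F) X"
    using generated_Lie[of F X, OF smooth lip] X(1) unfolding Lie_bounded_def by blast
  ultimately show "\<exists>X. generated (reachable F) X \<and> (\<forall>x. norm x \<le> r \<longrightarrow> norm (X x - Y x) \<le> e)" by blast
qed

section \<open>The Euler scheme\<close>

text \<open>The admissible step length depends on the field and hence on \<open>t\<close>. Finitely
  many times k/n suffice: with \<open>n\<close> large, the Lipschitz bound in time makes the change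
  from \<open>t\<close> to the grid point below it cost at most \<open>e/2\<close>.\<close>

lemma euler_steps_uniform:
  fixes v :: "real \<times> 'a::euclidean_space \<Rightarrow> 'a"
  assumes lip: "\<Lambda>-lipschitz_on UNIV v" and gen: "\<And>t. generated R (\<lambda>x. v (t, x))" and e: "e > 0"
  shows "\<exists>h0>0. \<forall>t\<in>{0..1}. \<forall>h. 0 < h \<and> h < h0 \<longrightarrow>
     (\<exists>\<phi>\<in>R. \<forall>x. norm x \<le> r \<longrightarrow> norm (\<phi> x - x - h *\<^sub>R v (t, x)) \<le> e * h)"
proof -
  have \<Lambda>: "\<Lambda> \<ge> 0" using lip lipschitz_on_nonneg by blast
  obtain P :: nat where "2 * \<Lambda> / e < real P" using reals_Archimedean2 by blast
  then have P: "\<Lambda> / real (Suc P) \<le> e / 2" "0 < real (Suc P)" using e \<Lambda> by (auto simp: field_simps)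
  define n where "n = Suc P"
  have "\<exists>h0>0. \<forall>h. 0 < h \<and> h < h0 \<longrightarrow>
     (\<exists>\<phi>\<in>R. \<forall>x. norm x \<le> r \<longrightarrow> norm (\<phi> x - x - h *\<^sub>R v (real k / real n, x)) \<le> e/2 * h)" for k
    using gen[of "real k / real n"] e unfolding generated_def euler_steps_def by (metis half_gt_zero)
  then obtain h0 where h0: "\<And>k. h0 k > 0" "\<And>k h. 0 < h \<Longrightarrow> h < h0 k \<Longrightarrow>
     \<exists>\<phi>\<in>R. \<forall>x. norm x \<le> r \<longrightarrow> norm (\<phi> x - x - h *\<^sub>R v (real k / real n, x)) \<le> e/2 * h"
    by metis
  define H where "H = Min (h0 ` {0..n})"
  have H: "H > 0" "k \<le> n \<Longrightarrow> H \<le> h0 k" for k using h0(1) by (auto simp: H_def)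
  have "\<exists>\<phi>\<in>R. \<forall>x. norm x \<le> r \<longrightarrow> norm (\<phi> x - x - h *\<^sub>R v (t, x)) \<le> e * h"
    if t: "t \<in> {0..1}" and h: "0 < h" "h < H" for t h
  proof -
    define k where "k = nat \<lfloor>t * real n\<rfloor>"
    have tn: "0 \<le> t * real n" "t * real n \<le> real n" using t by (auto intro: mult_left_le_one_le)
    have k: "real k \<le> t * real n" "t * real n < real k + 1"
      using tn unfolding k_def by (auto simp: of_nat_nat)
    have "k \<le> n" using k(1) tn(2) by linarith
    obtain \<phi> where \<phi>: "\<phi> \<in> R" "\<And>x. norm x \<le> r \<Longrightarrow> norm (\<phi> x - x - h *\<^sub>R v (real k / real n, x)) \<le> e/2 * h"
      using h0(2)[of h k] h H(2)[OF \<open>k \<le> n\<close>] by auto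
    have n0: "real n > 0" by (simp add: n_def)
    have "\<bar>real k / real n - t\<bar> \<le> 1 / real n"
    proof -
      have "real k / real n - t = (real k - t * real n) / real n" using n0 by (simp add: field_simps)
      then show ?thesis using k n0 by (simp add: divide_right_mono)
    qed
    have "norm (\<phi> x - x - h *\<^sub>R v (t, x)) \<le> e * h" if x: "norm x \<le> r" for x
    proof -
      have "norm (v (real k / real n, x) - v (t, x)) \<le> \<Lambda> * \<bar>real k / real n - t\<bar>"
        using lipschitz_onD[OF lip, of "(real k / real n, x)" "(t, x)"] by (simp add: dist_Pair_Pair dist_norm dist_real_def)
      also have "\<dots> \<le> \<Lambda> * (1 / real n)" using \<open>\<bar>real k / real n - t\<bar> \<le> 1 / real n\<close> \<Lambda> by (rule mult_left_mono)
      also have "\<dots> \<le> e/2" using P by (simp add: n_def)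
      finally have d: "norm (v (real k / real n, x) - v (t, x)) \<le> e/2" .
      have "\<phi> x - x - h *\<^sub>R v (t, x) = (\<phi> x - x - h *\<^sub>R v (real k / real n, x)) + h *\<^sub>R (v (real k / real n, x) - v (t, x))"
        by (simp add: algebra_simps)
      also have "norm \<dots> \<le> e/2 * h + h * (e/2)"
        using \<phi>(2)[OF x] d h by (intro order_trans[OF norm_triangle_ineq] add_mono) (simp_all add: mult_left_mono)
      finally show ?thesis by (simp add: algebra_simps)
    qed
    then show ?thesis using \<phi>(1) by blast
  qed
  then show ?thesis using H(1) by blast
qed

text \<open>A discrete Gronwall argument. Along the segment of \<open>x\<close> the field equals
  \<open>w x\<close>, so an exact step stays on the segment. Each actual step adds at most \<eta> h
  and magnifies the earlier error by at most \<open>1 + h \<Lambda>\<close>.\<close>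

lemma euler_scheme:
  fixes v :: "real \<times> 'a::euclidean_space \<Rightarrow> 'a"
  assumes comp: "\<And>\<phi> \<psi>. \<phi> \<in> R \<Longrightarrow> \<psi> \<in> R \<Longrightarrow> \<phi> \<circ> \<psi> \<in> R" and id: "(\<lambda>x. x) \<in> R"
    and lip: "\<Lambda>-lipschitz_on UNIV v" and gen: "\<And>t. generated R (\<lambda>x. v (t, x))"
    and line: "\<And>t x. t \<in> {0..1} \<Longrightarrow> x \<in> A \<Longrightarrow> v (t, x + t *\<^sub>R w x) = w x"
    and bd: "\<And>t x. t \<in> {0..1} \<Longrightarrow> x \<in> A \<Longrightarrow> norm (x + t *\<^sub>R w x) \<le> r"
    and \<epsilon>: "\<epsilon> > 0"
  shows "\<exists>\<phi>\<in>R. \<forall>x\<in>A. norm (\<phi> x - (x + w x)) \<le> \<epsilon>"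
proof -
  have \<Lambda>: "\<Lambda> \<ge> 0" using lip lipschitz_on_nonneg by blast
  \<comment> \<open>Division by \<open>exp \<Lambda>\<close> offsets the accumulated magnification.
    The part 1 of the minimum keeps all iterates in the ball of radius \<open>r + 1\<close> where
    the steps are controlled; the part \<epsilon> is the target.\<close>
  define \<eta> where "\<eta> = min 1 \<epsilon> / exp \<Lambda>"
  have \<eta>: "\<eta> > 0" "exp \<Lambda> * \<eta> \<le> \<epsilon>" "exp \<Lambda> * \<eta> \<le> 1" using \<epsilon> by (auto simp: \<eta>_def)
  obtain h0 where h0: "h0 > 0" "\<And>t h. t\<in>{0..1} \<Longrightarrow> 0 < h \<Longrightarrow> h < h0 \<Longrightarrow>
     \<exists>\<phi>\<in>R. \<forall>x. norm x \<le> r + 1 \<longrightarrow> norm (\<phi> x - x - h *\<^sub>R v (t, x)) \<le> \<eta> * h"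
    using euler_steps_uniform[OF lip gen \<eta>(1), of "r + 1"] by blast
  obtain N :: nat where N: "1 / h0 < real N" using reals_Archimedean2 by blast
  have N0: "0 < real N" using N h0(1) by (meson less_trans zero_less_divide_1_iff)
  define h where "h = 1 / real N"
  have h: "0 < h" "h < h0" "h * real N = 1" using N N0 h0(1) by (auto simp: h_def field_simps)
  have pow: "(1 + h * \<Lambda>) ^ j * (real j * h * \<eta>) \<le> exp \<Lambda> * \<eta>" if "j \<le> N" for j
  proof -
    have "(1 + h * \<Lambda>) ^ j \<le> exp (h * \<Lambda>) ^ j" using h \<Lambda> by (intro power_mono exp_ge_add_one_self) auto
    also have "\<dots> = exp (real j * (h * \<Lambda>))" by (simp add: exp_of_nat_mult)
    also have "\<dots> \<le> exp \<Lambda>"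
    proof -
      have "real j * h \<le> real N * h" using that h by (intro mult_right_mono) auto
      then have "real j * h * \<Lambda> \<le> 1 * \<Lambda>" using h \<Lambda> by (intro mult_right_mono) (auto simp: mult.commute)
      then show ?thesis by (simp add: mult.assoc)
    qed
    finally have "(1 + h * \<Lambda>) ^ j \<le> exp \<Lambda>" .
    moreover have "real j * h * \<eta> \<le> 1 * \<eta>"
    proof (rule mult_right_mono)
      have "real j * h \<le> real N * h" using that h by (intro mult_right_mono) auto
      then show "real j * h \<le> 1" using h by (simp add: mult.commute)
    qed (use \<eta> in auto)
    ultimately show ?thesis using h \<eta> by (intro mult_mono) auto
  qed
  have "\<exists>\<phi>\<in>R. \<forall>x\<in>A. norm (\<phi> x - (x + (real j * h) *\<^sub>R w x)) \<le> (1 + h * \<Lambda>) ^ j * (real j * h * \<eta>)" if "j \<le> N" for j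
    using that
  proof (induction j)
    case 0
    then show ?case using id by (intro bexI[of _ "\<lambda>x. x"]) auto
  next
    case (Suc j)
    then obtain \<phi> where \<phi>: "\<phi> \<in> R" "\<And>x. x\<in>A \<Longrightarrow> norm (\<phi> x - (x + (real j * h) *\<^sub>R w x)) \<le> (1 + h * \<Lambda>) ^ j * (real j * h * \<eta>)"
      by auto
    define t where "t = real j * h"
    have t: "t \<in> {0..1}"
    proof -
      have "real j * h \<le> real N * h" using Suc.prems h by (intro mult_right_mono) auto
      then show ?thesis using h by (auto simp: t_def mult.commute)
    qed
    obtain \<psi> where \<psi>: "\<psi> \<in> R" "\<And>x. norm x \<le> r + 1 \<Longrightarrow> norm (\<psi> x - x - h *\<^sub>R v (t, x)) \<le> \<eta> * h"
      using h0(2)[OF t h(1,2)] by blast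
    have "norm ((\<psi> \<circ> \<phi>) x - (x + (real (Suc j) * h) *\<^sub>R w x)) \<le> (1 + h * \<Lambda>) ^ Suc j * (real (Suc j) * h * \<eta>)" if x: "x \<in> A" for x
    proof -
      define z where "z = \<phi> x"
      define y where "y = x + t *\<^sub>R w x"
      define E where "E = (1 + h * \<Lambda>) ^ j * (real j * h * \<eta>)"
      have zy: "norm (z - y) \<le> E" using \<phi>(2)[OF x] by (simp add: z_def y_def t_def E_def)
      have E1: "E \<le> 1" using pow[of j] Suc.prems \<eta>(3) by (simp add: E_def)
      have "norm y \<le> r" using bd[OF t x] by (simp add: y_def)
      then have "norm z \<le> r + 1" using zy E1 norm_triangle_sub[of z y] by linarith
      then have 1: "norm (\<psi> z - z - h *\<^sub>R v (t, z)) \<le> \<eta> * h" by (rule \<psi>(2))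
      have 2: "norm (v (t, z) - w x) \<le> \<Lambda> * norm (z - y)"
        using lipschitz_onD[OF lip, of "(t, z)" "(t, y)"] line[OF t x] by (simp add: dist_Pair_Pair dist_norm y_def)
      have "(\<psi> \<circ> \<phi>) x - (x + (real (Suc j) * h) *\<^sub>R w x) = (\<psi> z - z - h *\<^sub>R v (t, z)) + (z - y) + h *\<^sub>R (v (t, z) - w x)"
        by (simp add: z_def y_def t_def algebra_simps)
      also have "norm \<dots> \<le> \<eta> * h + norm (z - y) + h * (\<Lambda> * norm (z - y))"
        using 1 2 h by (intro order_trans[OF norm_add3_le] add_mono) (simp_all add: mult_left_mono)
      also have "\<dots> = \<eta> * h + (1 + h * \<Lambda>) * norm (z - y)" by (simp add: algebra_simps)
      also have "\<dots> \<le> \<eta> * h * (1 + h * \<Lambda>) ^ Suc j + (1 + h * \<Lambda>) * E"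
      proof (rule add_mono)
        have "1 \<le> (1 + h * \<Lambda>) ^ Suc j" using h \<Lambda> by (intro one_le_power) auto
        then show "\<eta> * h \<le> \<eta> * h * (1 + h * \<Lambda>) ^ Suc j" using h \<eta> mult_left_mono[of 1 "(1 + h * \<Lambda>) ^ Suc j" "\<eta> * h"] by simp
        show "(1 + h * \<Lambda>) * norm (z - y) \<le> (1 + h * \<Lambda>) * E" using zy h \<Lambda> by (intro mult_left_mono) auto
      qed
      also have "\<dots> = (1 + h * \<Lambda>) ^ Suc j * (real (Suc j) * h * \<eta>)" by (simp add: E_def algebra_simps)
      finally show ?thesis .
    qed
    then show ?case using comp[OF \<psi>(1) \<phi>(1)] by blast
  qed
  from this[of N] obtain \<phi> where \<phi>: "\<phi> \<in> R" "\<And>x. x\<in>A \<Longrightarrow> norm (\<phi> x - (x + (real N * h) *\<^sub>R w x)) \<le> (1 + h * \<Lambda>) ^ N * (real N * h * \<eta>)"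
    by auto
  have "norm (\<phi> x - (x + w x)) \<le> \<epsilon>" if "x \<in> A" for x
    using \<phi>(2)[OF that] pow[of N] \<eta>(2) h(3) by (simp add: mult.commute)
  then show ?thesis using \<phi>(1) by blast
qed

section \<open>Strongly monotone maps\<close>

text \<open>McShane's extension, with the graph of the partial function given by a family indexed by \<open>I\<close>.\<close>

lemma mcshane_extension_real:
  fixes f :: "'i \<Rightarrow> 'a::metric_space" and g :: "'i \<Rightarrow> real"
  assumes g: "\<And>i j. i \<in> I \<Longrightarrow> j \<in> I \<Longrightarrow> g i - g j \<le> L * dist (f i) (f j)" and L: "0 \<le> L" and "I \<noteq> {}"
  shows "\<exists>G. L-lipschitz_on UNIV G \<and> (\<forall>i\<in>I. G (f i) = g i)"
proof -
  obtain i0 where i0: "i0 \<in> I" using \<open>I \<noteq> {}\<close> by blast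
  define G where "G y = (INF i\<in>I. g i + L * dist y (f i))" for y
  have "bdd_below ((\<lambda>i. g i + L * dist y (f i)) ` I)" for y
  proof (rule bdd_belowI2)
    fix i assume i: "i \<in> I"
    have "L * dist (f i0) (f i) \<le> L * (dist y (f i0) + dist y (f i))"
      using dist_triangle3[of "f i0" "f i" y] L by (intro mult_left_mono) auto
    then show "g i0 - L * dist y (f i0) \<le> g i + L * dist y (f i)"
      using g[OF i0 i] by (simp add: algebra_simps)
  qed
  then have lower: "i \<in> I \<Longrightarrow> G y \<le> g i + L * dist y (f i)" for i y
    unfolding G_def by (rule cINF_lower)
  have tri: "G y - G z \<le> L * dist y z" for y z
  proof -
    have "G y - L * dist y z \<le> G z"
      unfolding G_def[of z]
    proof (rule cINF_greatest[OF \<open>I \<noteq> {}\<close>])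
      fix i assume i: "i \<in> I"
      have "L * dist y (f i) \<le> L * (dist y z + dist z (f i))"
        using dist_triangle[of y "f i" z] L by (intro mult_left_mono) auto
      then show "G y - L * dist y z \<le> g i + L * dist z (f i)"
        using lower[OF i, of y] by (simp add: algebra_simps)
    qed
    then show ?thesis by simp
  qed
  have "L-lipschitz_on UNIV G"
  proof (rule lipschitz_onI[OF _ L])
    fix y z
    show "dist (G y) (G z) \<le> L * dist y z"
      using tri[of y z] tri[of z y] by (simp add: dist_real_def abs_le_iff dist_commute)
  qed
  moreover have "G (f j) = g j" if j: "j \<in> I" for j
  proof (rule order.antisym)
    show "G (f j) \<le> g j" using lower[OF j, of "f j"] by simp
    show "g j \<le> G (f j)"
      unfolding G_def
    proof (rule cINF_greatest[OF \<open>I \<noteq> {}\<close>])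
      fix i assume "i \<in> I"
      then show "g j \<le> g i + L * dist (f j) (f i)" using g[OF j, of i] by simp
    qed
  qed
  ultimately show ?thesis by blast
qed

text \<open>Coordinatewise extension multiplies the constant by the dimension; only the existence of
  some Lipschitz constant matters later.\<close>

lemma mcshane_extension:
  fixes f :: "'i \<Rightarrow> 'a::metric_space" and g :: "'i \<Rightarrow> 'b::euclidean_space"
  assumes g: "\<And>i j. i \<in> I \<Longrightarrow> j \<in> I \<Longrightarrow> norm (g i - g j) \<le> L * dist (f i) (f j)" and L: "0 \<le> L"
  shows "\<exists>G \<Lambda>. \<Lambda>-lipschitz_on UNIV G \<and> (\<forall>i\<in>I. G (f i) = g i)"
proof (cases "I = {}")
  case True
  then show ?thesis by (intro exI[of _ "\<lambda>_. 0"] exI[of _ 0]) (auto intro: lipschitz_onI)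
next
  case False
  have "\<exists>G. L-lipschitz_on UNIV G \<and> (\<forall>i\<in>I. G (f i) = g i \<bullet> b)" if b: "b \<in> Basis" for b
  proof (rule mcshane_extension_real[OF _ L False])
    fix i j assume ij: "i \<in> I" "j \<in> I"
    show "g i \<bullet> b - g j \<bullet> b \<le> L * dist (f i) (f j)"
      using g[OF ij] Basis_le_norm[OF b, of "g i - g j"] by (simp add: inner_diff_left)
  qed
  then obtain G where G: "\<And>b. b \<in> Basis \<Longrightarrow> L-lipschitz_on UNIV (G b)"
     "\<And>b i. b \<in> Basis \<Longrightarrow> i \<in> I \<Longrightarrow> G b (f i) = g i \<bullet> b" by metis
  define H where "H y = (\<Sum>b\<in>Basis. G b y *\<^sub>R b)" for y
  have "(real DIM('b) * L)-lipschitz_on UNIV H"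
  proof (rule lipschitz_onI)
    fix y z
    have "dist (H y) (H z) = norm (\<Sum>b\<in>Basis. (G b y - G b z) *\<^sub>R b)"
      by (simp add: H_def dist_norm sum_subtractf scaleR_diff_left)
    also have "\<dots> \<le> (\<Sum>b\<in>(Basis::'b set). L * dist y z)"
    proof (rule sum_norm_le)
      fix b :: 'b assume b: "b \<in> Basis"
      show "norm ((G b y - G b z) *\<^sub>R b) \<le> L * dist y z"
        using lipschitz_onD[OF G(1)[OF b], of y z] b by (simp add: dist_real_def)
    qed
    finally show "dist (H y) (H z) \<le> real DIM('b) * L * dist y z" by simp
  qed (use L in auto)
  moreover have "H (f i) = g i" if "i \<in> I" for i
    using that G(2) by (simp add: H_def euclidean_representation)
  ultimately show ?thesis by blast
qed

text \<open>Strong monotonicity keeps the segments \<open>t \<mapsto> x + t (S x - x)\<close> apart, so their velocity is a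
  Lipschitz function of time and position.\<close>

lemma segment_velocity_field:
  fixes S :: "'a::euclidean_space \<Rightarrow> 'a"
  assumes bA: "bounded A" and M: "\<And>x y. x \<in> A \<Longrightarrow> y \<in> A \<Longrightarrow> norm (S x - S y) \<le> M * norm (x - y)" "0 \<le> M"
    and c: "0 < c" "c \<le> 1" "\<And>x y. x \<in> A \<Longrightarrow> y \<in> A \<Longrightarrow> c * (norm (x - y))\<^sup>2 \<le> (S x - S y) \<bullet> (x - y)"
  shows "\<exists>v \<Lambda>. \<Lambda>-lipschitz_on UNIV v \<and> (\<forall>t\<in>{0..1}. \<forall>x\<in>A. v (t, x + t *\<^sub>R (S x - x)) = S x - x)"
    and "\<exists>r. \<forall>t\<in>{0..1}. \<forall>x\<in>A. norm (x + t *\<^sub>R (S x - x)) \<le> r"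
proof -
  define w where "w x = S x - x" for x
  obtain B where B: "\<And>x. x \<in> A \<Longrightarrow> norm x \<le> B" using bA unfolding bounded_iff by blast
  have wl: "norm (w x - w y) \<le> (M + 1) * norm (x - y)" if "x \<in> A" "y \<in> A" for x y
    using M(1)[OF that] norm_triangle_ineq4[of "S x - S y" "x - y"]
    by (simp add: w_def algebra_simps)
  have "\<exists>W\<ge>0. \<forall>x\<in>A. norm (w x) \<le> W"
  proof (cases "A = {}")
    case False
    then obtain a where a: "a \<in> A" by blast
    have "norm (w x) \<le> norm (w a) + (M + 1) * (2 * B)" if x: "x \<in> A" for x
    proof -
      have "norm (x - a) \<le> 2 * B" using B[OF x] B[OF a] norm_triangle_ineq4[of x a] by linarith
      then have "(M + 1) * norm (x - a) \<le> (M + 1) * (2 * B)" using M(2) by (intro mult_left_mono) auto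
      then show ?thesis using wl[OF x a] norm_triangle_sub[of "w x" "w a"] by linarith
    qed
    moreover have "B \<ge> 0" using B[OF a] norm_ge_zero order_trans by blast
    ultimately show ?thesis using M(2) by (intro exI[of _ "norm (w a) + (M + 1) * (2 * B)"]) auto
  qed auto
  then obtain W where W: "W \<ge> 0" "\<And>x. x \<in> A \<Longrightarrow> norm (w x) \<le> W" by blast
  define \<gamma> where "\<gamma> p = snd p + fst p *\<^sub>R w (snd p)" for p :: "real \<times> 'a"
  \<comment> \<open>Pairing with \<open>x - y\<close> gives at least the factor
    \<open>(1 - t) + t c\<close>, which is at least \<open>c\<close> because \<open>c\<close> is at
    most 1.\<close>
  have sep: "c * norm (x - y) \<le> norm (\<gamma> (t, x) - \<gamma> (t, y))" if t: "t \<in> {0..1}" and x: "x \<in> A" and y: "y \<in> A" for t x y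
  proof (cases "x = y")
    case False
    have "\<gamma> (t, x) - \<gamma> (t, y) = (1 - t) *\<^sub>R (x - y) + t *\<^sub>R (S x - S y)"
      by (simp add: \<gamma>_def w_def algebra_simps)
    then have "(\<gamma> (t, x) - \<gamma> (t, y)) \<bullet> (x - y) = (1 - t) * (norm (x - y))\<^sup>2 + t * ((S x - S y) \<bullet> (x - y))"
      by (simp add: inner_add_left power2_norm_eq_inner)
    moreover have "t * (c * (norm (x - y))\<^sup>2) \<le> t * ((S x - S y) \<bullet> (x - y))"
      using c(3)[OF x y] t by (intro mult_left_mono) auto
    moreover have "(1 - t) * (c * (norm (x - y))\<^sup>2) \<le> (1 - t) * (norm (x - y))\<^sup>2"
      using t c by (intro mult_left_mono) (auto intro: mult_left_le_one_le)
    ultimately have "c * (norm (x - y))\<^sup>2 \<le> (\<gamma> (t, x) - \<gamma> (t, y)) \<bullet> (x - y)" by (simp add: algebra_simps)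
    also have "\<dots> \<le> norm (\<gamma> (t, x) - \<gamma> (t, y)) * norm (x - y)" by (rule norm_cauchy_schwarz)
    finally have "(c * norm (x - y)) * norm (x - y) \<le> norm (\<gamma> (t, x) - \<gamma> (t, y)) * norm (x - y)"
      by (simp add: power2_eq_square)
    then show ?thesis using False by simp
  qed simp
  define \<Lambda> where "\<Lambda> = (M + 1) / c * (1 + W)"
  have \<Lambda>: "\<Lambda> \<ge> 0" using M(2) c W by (simp add: \<Lambda>_def)
  have wlip: "norm (w (snd p) - w (snd q)) \<le> \<Lambda> * dist (fst p, \<gamma> p) (fst q, \<gamma> q)"
    if p: "p \<in> {0..1} \<times> A" and q: "q \<in> {0..1} \<times> A" for p q
  proof -
    obtain t x s y where pq: "p = (t, x)" "q = (s, y)" by (metis surj_pair)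
    have mem: "t \<in> {0..1}" "s \<in> {0..1}" "x \<in> A" "y \<in> A" using p q pq by auto
    define \<Delta> where "\<Delta> = dist (t, \<gamma> p) (s, \<gamma> q)"
    have D: "\<bar>t - s\<bar> \<le> \<Delta>" "norm (\<gamma> p - \<gamma> q) \<le> \<Delta>"
      using dist_fst_le[of "(t, \<gamma> p)" "(s, \<gamma> q)"] dist_snd_le[of "(t, \<gamma> p)" "(s, \<gamma> q)"]
      by (auto simp: \<Delta>_def dist_real_def dist_norm)
    \<comment> \<open>Separation is known at equal times only. Moving along one segment from time
      \<open>s\<close> to \<open>t\<close> costs at most \<open>W\<close> times the time
      difference.\<close>
    have "norm (\<gamma> (s, y) - \<gamma> (t, y)) \<le> W * \<Delta>"
    proof -
      have "\<gamma> (s, y) - \<gamma> (t, y) = (s - t) *\<^sub>R w y" by (simp add: \<gamma>_def algebra_simps)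
      then have "norm (\<gamma> (s, y) - \<gamma> (t, y)) = \<bar>t - s\<bar> * norm (w y)" by (simp add: abs_minus_commute)
      also have "\<dots> \<le> \<Delta> * W" using D(1) W(2)[OF mem(4)] by (intro mult_mono) auto
      finally show ?thesis by (simp add: mult.commute)
    qed
    then have "c * norm (x - y) \<le> \<Delta> + W * \<Delta>"
      using sep[OF mem(1,3,4)] D(2) norm_triangle_ineq[of "\<gamma> (t, x) - \<gamma> (s, y)" "\<gamma> (s, y) - \<gamma> (t, y)"]
      by (simp add: pq)
    then have "norm (x - y) \<le> (1 + W) * \<Delta> / c" using c(1) by (simp add: field_simps)
    then have "(M + 1) * norm (x - y) \<le> (M + 1) * ((1 + W) * \<Delta> / c)" using M(2) by (intro mult_left_mono) auto
    then show ?thesis using wl[OF mem(3,4)] by (simp add: pq \<Lambda>_def \<Delta>_def)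
  qed
  obtain v \<Lambda>' where v: "\<Lambda>'-lipschitz_on UNIV v" "\<forall>p\<in>{0..1} \<times> A. v (fst p, \<gamma> p) = w (snd p)"
    using mcshane_extension[of "{0..1} \<times> A" "\<lambda>p. w (snd p)" \<Lambda> "\<lambda>p. (fst p, \<gamma> p)", OF wlip \<Lambda>] by auto
  have "v (t, x + t *\<^sub>R (S x - x)) = S x - x" if "t \<in> {0..1}" "x \<in> A" for t x
    using bspec[OF v(2), of "(t, x)"] that by (simp add: \<gamma>_def w_def)
  then show "\<exists>v \<Lambda>. \<Lambda>-lipschitz_on UNIV v \<and> (\<forall>t\<in>{0..1}. \<forall>x\<in>A. v (t, x + t *\<^sub>R (S x - x)) = S x - x)"
    by (intro exI[of _ v] exI[of _ \<Lambda>'] conjI v(1) ballI)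
  have "norm (x + t *\<^sub>R (S x - x)) \<le> B + W" if t: "t \<in> {0..1}" and x: "x \<in> A" for t x
  proof -
    have "norm (t *\<^sub>R w x) \<le> W"
      using t W(2)[OF x] mult_left_le_one_le[of "norm (w x)" t] by simp
    then show ?thesis using B[OF x] norm_triangle_ineq[of x "t *\<^sub>R w x"] by (simp add: w_def)
  qed
  then show "\<exists>r. \<forall>t\<in>{0..1}. \<forall>x\<in>A. norm (x + t *\<^sub>R (S x - x)) \<le> r" by blast
qed

lemma strongly_monotone_approximable:
  fixes S :: "'a::euclidean_space \<Rightarrow> 'a"
  assumes comp: "\<And>\<phi> \<psi>. \<phi> \<in> R \<Longrightarrow> \<psi> \<in> R \<Longrightarrow> \<phi> \<circ> \<psi> \<in> R" and id: "(\<lambda>x. x) \<in> R"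
    and gen: "\<And>Y. continuous_on UNIV Y \<Longrightarrow> generated R Y"
    and bA: "bounded A" and M: "\<And>x y. x \<in> A \<Longrightarrow> y \<in> A \<Longrightarrow> norm (S x - S y) \<le> M * norm (x - y)" "0 \<le> M"
    and c: "0 < c" "c \<le> 1" "\<And>x y. x \<in> A \<Longrightarrow> y \<in> A \<Longrightarrow> c * (norm (x - y))\<^sup>2 \<le> (S x - S y) \<bullet> (x - y)"
    and \<epsilon>: "\<epsilon> > 0"
  shows "\<exists>\<phi>\<in>R. \<forall>x\<in>A. norm (\<phi> x - S x) \<le> \<epsilon>"
proof -
  obtain v \<Lambda> where v: "\<Lambda>-lipschitz_on UNIV v"
      "\<And>t x. t\<in>{0..1} \<Longrightarrow> x\<in>A \<Longrightarrow> v (t, x + t *\<^sub>R (S x - x)) = S x - x"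
    using segment_velocity_field(1)[OF bA M c] by blast
  obtain r where r: "\<And>t x. t\<in>{0..1} \<Longrightarrow> x\<in>A \<Longrightarrow> norm (x + t *\<^sub>R (S x - x)) \<le> r"
    using segment_velocity_field(2)[OF bA M c] by blast
  have "continuous_on UNIV (\<lambda>x. v (t, x))" for t
    by (intro continuous_on_compose2[OF lipschitz_on_continuous_on[OF v(1)]] continuous_intros) auto
  then have "generated R (\<lambda>x. v (t, x))" for t by (rule gen)
  from euler_scheme[OF comp id v(1) this v(2) r \<epsilon>] show ?thesis by simp
qed

section \<open>Mollification of monotone maps\<close>

lemma lborel_integral_shift:
  fixes f :: "'a::euclidean_space \<Rightarrow> 'b::{banach, second_countable_topology}"
  assumes "f \<in> borel_measurable borel"
  shows "(\<integral>z. f z \<partial>lborel) = (\<integral>w. f (c + w) \<partial>lborel)"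
proof -
  have "(\<integral>z. f z \<partial>lborel) = (\<integral>z. f z \<partial>distr lborel borel ((+) c))" by (simp add: lborel_distr_plus)
  also have "\<dots> = (\<integral>w. f (c + w) \<partial>lborel)" by (rule integral_distr) (use assms in auto)
  finally show ?thesis .
qed

text \<open>Mollification by a cone-shaped kernel preserves monotonicity. The domain is first contracted
  towards an interior point, so that the averages only involve values of \<open>T\<close> on \<open>\<Omega>\<close>.\<close>

lemma monotone_lipschitz_approximation:
  fixes T :: "'a::euclidean_space \<Rightarrow> 'a"
  assumes \<Omega>: "open \<Omega>" "bounded \<Omega>" "convex \<Omega>" "\<Omega> \<noteq> {}" and T: "continuous_on (closure \<Omega>) T"
    and mono: "\<And>x y. x \<in> \<Omega> \<Longrightarrow> y \<in> \<Omega> \<Longrightarrow> 0 \<le> (T x - T y) \<bullet> (x - y)" and e: "0 < e"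
  shows "\<exists>S M c. 0 \<le> M \<and> 0 < c \<and> c \<le> 1 \<and> (\<forall>x\<in>\<Omega>. norm (S x - T x) \<le> e) \<and>
    (\<forall>x\<in>\<Omega>. \<forall>y\<in>\<Omega>. norm (S x - S y) \<le> M * norm (x - y) \<and>
       c * (norm (x - y))\<^sup>2 \<le> (S x - S y) \<bullet> (x - y))"
proof -
  obtain x0 where x0: "x0 \<in> \<Omega>" using \<Omega> by blast
  obtain \<rho> where \<rho>: "\<rho> > 0" "ball x0 \<rho> \<subseteq> \<Omega>" using \<Omega>(1) x0 by (meson open_contains_ball)
  have cl: "compact (closure \<Omega>)" using \<Omega>(2) by (simp add: compact_closure)
  obtain B where B: "B > 0" "\<And>x. x \<in> \<Omega> \<Longrightarrow> norm x \<le> B" using \<Omega>(2) unfolding bounded_pos by blast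
  have "bounded (T ` closure \<Omega>)" by (intro compact_imp_bounded compact_continuous_image T cl)
  then obtain BT where BT: "BT > 0" "\<And>x. x \<in> \<Omega> \<Longrightarrow> norm (T x) \<le> BT"
    unfolding bounded_pos using closure_subset by blast
  obtain \<delta> where \<delta>: "\<delta> > 0" "\<And>x y. x \<in> \<Omega> \<Longrightarrow> y \<in> \<Omega> \<Longrightarrow> norm (y - x) < \<delta> \<Longrightarrow> norm (T y - T x) < e/2"
    using compact_uniformly_continuous[OF T cl] e closure_subset[of \<Omega>]
    unfolding uniformly_continuous_on_def dist_norm by (meson half_gt_zero subsetD)
  \<comment> \<open>\<theta> is at once the contraction ratio, the scale of the kernel and the
    multiple of the identity added at the end. The second bound keeps the averaged points within
    \<delta> of \<open>x\<close>, the third keeps the added multiple below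
    \<open>e/2\<close>.\<close>
  define \<theta> where "\<theta> = min (1/2) (min (\<delta> / (2 * (2 * B + \<rho>))) (e / (2 * B)))"
  have \<theta>: "0 < \<theta>" "\<theta> \<le> 1/2" "\<theta> * (2 * B + \<rho>) < \<delta>" "\<theta> * B \<le> e/2"
  proof -
    show "0 < \<theta>" using \<delta> B \<rho> e by (auto simp: \<theta>_def)
    show "\<theta> \<le> 1/2" unfolding \<theta>_def by (rule min.cobounded1)
    have pos: "0 < 2 * B + \<rho>" using B \<rho> by simp
    have "\<theta> \<le> \<delta> / (2 * (2 * B + \<rho>))" by (simp add: \<theta>_def)
    then have "\<theta> * (2 * (2 * B + \<rho>)) \<le> \<delta>" using pos by (simp add: pos_le_divide_eq)
    moreover have "\<theta> * (2 * (2 * B + \<rho>)) = 2 * (\<theta> * (2 * B + \<rho>))" by simp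
    ultimately show "\<theta> * (2 * B + \<rho>) < \<delta>" using mult_pos_pos[OF \<open>0 < \<theta>\<close> pos] by linarith
    have "\<theta> \<le> e / (2 * B)" by (simp add: \<theta>_def)
    then show "\<theta> * B \<le> e/2" using B by (simp add: pos_le_divide_eq)
  qed
  \<comment> \<open>The cone is supported on the \<theta>-scaled copy of
    \<open>ball x0 \<rho>\<close>, so for \<open>w\<close> in its support
    \<open>w + (1 - \<theta>) x\<close> is a convex combination of \<open>x\<close> and a point of
    that ball. The extension \<tau> by zero makes the integrands measurable on the whole
    space.\<close>
  define \<kappa> where "\<kappa> z = max 0 (\<theta> * \<rho> - norm (z - \<theta> *\<^sub>R x0))" for z
  define \<tau> where "\<tau> y = indicator \<Omega> y *\<^sub>R T y" for y
  have \<kappa>0: "\<kappa> z \<ge> 0" "\<kappa> z \<le> \<theta> * \<rho>" for z using \<theta> \<rho> by (auto simp: \<kappa>_def)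
  have \<kappa>m [measurable]: "\<kappa> \<in> borel_measurable borel"
    unfolding \<kappa>_def by measurable
  have \<tau>m [measurable]: "\<tau> \<in> borel_measurable borel"
    unfolding \<tau>_def using \<Omega>(1) continuous_on_subset[OF T closure_subset]
    by (intro borel_measurable_continuous_on_indicator) auto
  have \<tau>b: "norm (\<tau> y) \<le> BT" for y using BT by (auto simp: \<tau>_def indicator_def)
  have inside: "w + (1 - \<theta>) *\<^sub>R x \<in> \<Omega>" "norm (w + (1 - \<theta>) *\<^sub>R x - x) < \<delta>"
    if k: "\<kappa> w \<noteq> 0" and x: "x \<in> \<Omega>" for w x
  proof -
    have wn: "norm (w - \<theta> *\<^sub>R x0) < \<theta> * \<rho>" using k by (auto simp: \<kappa>_def max_def split: if_splits)
    define z where "z = (1 / \<theta>) *\<^sub>R w"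
    have w: "w = \<theta> *\<^sub>R z" using \<theta> by (simp add: z_def)
    have "norm (\<theta> *\<^sub>R (z - x0)) < \<theta> * \<rho>" using wn by (simp add: w scaleR_diff_right)
    then have "norm (z - x0) < \<rho>" using \<theta> by simp
    then have "z \<in> \<Omega>" using \<rho>(2) by (auto simp: dist_norm norm_minus_commute)
    then have "(1 - \<theta>) *\<^sub>R x + \<theta> *\<^sub>R z \<in> \<Omega>" using \<Omega>(3) x \<theta> by (intro convexD) auto
    then show "w + (1 - \<theta>) *\<^sub>R x \<in> \<Omega>" by (simp add: w add.commute)
    have eq: "w + (1 - \<theta>) *\<^sub>R x - x = (w - \<theta> *\<^sub>R x0) + \<theta> *\<^sub>R (x0 - x)" by (simp add: algebra_simps)
    have "norm (w + (1 - \<theta>) *\<^sub>R x - x) \<le> norm (w - \<theta> *\<^sub>R x0) + norm (\<theta> *\<^sub>R (x0 - x))"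
      unfolding eq by (rule norm_triangle_ineq)
    also have "\<dots> = norm (w - \<theta> *\<^sub>R x0) + \<theta> * norm (x0 - x)" using \<theta> by simp
    also have "\<dots> < \<theta> * \<rho> + \<theta> * (2 * B)"
    proof (rule add_less_le_mono[OF wn])
      have "norm (x0 - x) \<le> 2 * B" using B(2)[OF x] B(2)[OF x0] norm_triangle_ineq4[of x0 x] by linarith
      then show "\<theta> * norm (x0 - x) \<le> \<theta> * (2 * B)" using \<theta> by (intro mult_left_mono) auto
    qed
    also have "\<dots> < \<delta>" using \<theta>(3) by (simp add: algebra_simps)
    finally show "norm (w + (1 - \<theta>) *\<^sub>R x - x) < \<delta>" .
  qed
  have \<kappa>i: "integrable lborel \<kappa>"
  proof (rule Bochner_Integration.integrable_bound)
    show "integrable lborel (\<lambda>z. (\<theta> * \<rho>) * indicator (cball (\<theta> *\<^sub>R x0) (\<theta> * \<rho>)) z)"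
      by (intro integrable_mult_right integrable_real_indicator emeasure_bounded_finite) auto
    show "AE z in lborel. norm (\<kappa> z) \<le> norm (\<theta> * \<rho> * indicator (cball (\<theta> *\<^sub>R x0) (\<theta> * \<rho>)) z :: real)"
      using \<theta> \<rho> by (intro AE_I2) (auto simp: \<kappa>_def indicator_def dist_norm norm_minus_commute)
  qed simp
  define Z where "Z = (\<integral>z. \<kappa> z \<partial>lborel)"
  have Z: "Z > 0"
  proof -
    \<comment> \<open>On the concentric ball of half the radius the cone has at least half its
      height.\<close>
    have "0 < \<theta> * \<rho> / 2 * measure lborel (ball (\<theta> *\<^sub>R x0) (\<theta> * \<rho> / 2))"
      using \<theta> \<rho> by (intro mult_pos_pos content_ball_pos) auto
    also have "\<dots> = (\<integral>z. \<theta> * \<rho> / 2 * indicator (ball (\<theta> *\<^sub>R x0) (\<theta> * \<rho> / 2)) z \<partial>lborel)"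
      by simp
    also have "\<dots> \<le> Z"
      unfolding Z_def
    proof (rule integral_mono[OF _ \<kappa>i])
      show "integrable lborel (\<lambda>z. \<theta> * \<rho> / 2 * indicator (ball (\<theta> *\<^sub>R x0) (\<theta> * \<rho> / 2)) z :: real)"
        by (intro integrable_mult_right integrable_real_indicator emeasure_bounded_finite) auto
      fix z :: 'a
      show "\<theta> * \<rho> / 2 * indicator (ball (\<theta> *\<^sub>R x0) (\<theta> * \<rho> / 2)) z \<le> \<kappa> z"
      proof (cases "z \<in> ball (\<theta> *\<^sub>R x0) (\<theta> * \<rho> / 2)")
        case True
        then have "norm (z - \<theta> *\<^sub>R x0) < \<theta> * \<rho> / 2" by (simp add: dist_norm norm_minus_commute)
        then have "\<theta> * \<rho> / 2 \<le> \<kappa> z" unfolding \<kappa>_def by linarith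
        then show ?thesis using True by simp
      qed (simp add: \<kappa>0)
    qed
    finally show ?thesis .
  qed
  \<comment> \<open>The shift \<open>w\<close> is the same for all \<open>x\<close>, so
    \<open>W x - W y\<close> averages differences of \<open>T\<close> at pairs of points differing
    by \<open>(1 - \<theta>) (x - y)\<close>: each contributes nonnegatively.\<close>
  define W where "W x = (1 / Z) *\<^sub>R (\<integral>w. \<kappa> w *\<^sub>R \<tau> (w + (1 - \<theta>) *\<^sub>R x) \<partial>lborel)" for x
  have Wi: "integrable lborel (\<lambda>w. \<kappa> w *\<^sub>R \<tau> (w + (1 - \<theta>) *\<^sub>R x))" for x
  proof (rule Bochner_Integration.integrable_bound)
    show "integrable lborel (\<lambda>w. \<kappa> w * BT)" using \<kappa>i by simp
    show "AE w in lborel. norm (\<kappa> w *\<^sub>R \<tau> (w + (1 - \<theta>) *\<^sub>R x)) \<le> norm (\<kappa> w * BT)"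
      using \<kappa>0 \<tau>b BT(1) by (intro AE_I2) (simp add: mult_left_mono)
  qed measurable
  have Wmono: "0 \<le> (W x - W y) \<bullet> (x - y)" if x: "x \<in> \<Omega>" and y: "y \<in> \<Omega>" for x y
  proof -
    let ?d = "\<lambda>w. \<kappa> w *\<^sub>R \<tau> (w + (1 - \<theta>) *\<^sub>R x) - \<kappa> w *\<^sub>R \<tau> (w + (1 - \<theta>) *\<^sub>R y)"
    have "W x - W y = (1 / Z) *\<^sub>R (\<integral>w. ?d w \<partial>lborel)"
      unfolding W_def by (simp add: Bochner_Integration.integral_diff[OF Wi Wi] scaleR_diff_right)
    then have "(W x - W y) \<bullet> (x - y) = (1 / Z) * ((\<integral>w. ?d w \<partial>lborel) \<bullet> (x - y))" by simp
    also have "(\<integral>w. ?d w \<partial>lborel) \<bullet> (x - y) = (\<integral>w. ?d w \<bullet> (x - y) \<partial>lborel)"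
      by (rule integral_inner_left[symmetric]) (intro Bochner_Integration.integrable_diff Wi)
    also have "0 \<le> (1 / Z) * (\<integral>w. ?d w \<bullet> (x - y) \<partial>lborel)"
    proof (intro mult_nonneg_nonneg Bochner_Integration.integral_nonneg)
      fix w
      show "0 \<le> ?d w \<bullet> (x - y)"
      proof (cases "\<kappa> w = 0")
        case False
        have in2: "w + (1 - \<theta>) *\<^sub>R x \<in> \<Omega>" "w + (1 - \<theta>) *\<^sub>R y \<in> \<Omega>" using inside[OF False] x y by auto
        have "0 \<le> (T (w + (1 - \<theta>) *\<^sub>R x) - T (w + (1 - \<theta>) *\<^sub>R y)) \<bullet> ((1 - \<theta>) *\<^sub>R (x - y))"
          using mono[OF in2] by (simp add: algebra_simps)
        then have "0 \<le> (1 - \<theta>) * ((T (w + (1 - \<theta>) *\<^sub>R x) - T (w + (1 - \<theta>) *\<^sub>R y)) \<bullet> (x - y))"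
          by simp
        then have "0 \<le> (T (w + (1 - \<theta>) *\<^sub>R x) - T (w + (1 - \<theta>) *\<^sub>R y)) \<bullet> (x - y)"
          using \<theta> by (simp add: zero_le_mult_iff)
        then have "0 \<le> \<kappa> w * ((T (w + (1 - \<theta>) *\<^sub>R x) - T (w + (1 - \<theta>) *\<^sub>R y)) \<bullet> (x - y))"
          using \<kappa>0 by (intro mult_nonneg_nonneg)
        then show ?thesis using in2 by (simp add: \<tau>_def flip: scaleR_diff_right)
      qed simp
    qed (use Z in auto)
    finally show ?thesis .
  qed
  have Wclose: "norm (W x - T x) \<le> e/2" if x: "x \<in> \<Omega>" for x
  proof -
    have "T x = (1 / Z) *\<^sub>R (\<integral>w. \<kappa> w *\<^sub>R T x \<partial>lborel)"
      using Z \<kappa>i by (simp add: Z_def)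
    then have "W x - T x = (1 / Z) *\<^sub>R ((\<integral>w. \<kappa> w *\<^sub>R \<tau> (w + (1 - \<theta>) *\<^sub>R x) \<partial>lborel) - (\<integral>w. \<kappa> w *\<^sub>R T x \<partial>lborel))"
      unfolding W_def scaleR_diff_right by simp
    also have "\<dots> = (1 / Z) *\<^sub>R (\<integral>w. \<kappa> w *\<^sub>R \<tau> (w + (1 - \<theta>) *\<^sub>R x) - \<kappa> w *\<^sub>R T x \<partial>lborel)"
      by (subst Bochner_Integration.integral_diff[OF Wi]) (use \<kappa>i in auto)
    finally have "norm (W x - T x) = (1 / Z) * norm (\<integral>w. \<kappa> w *\<^sub>R \<tau> (w + (1 - \<theta>) *\<^sub>R x) - \<kappa> w *\<^sub>R T x \<partial>lborel)"
      using Z by simp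
    also have "\<dots> \<le> (1 / Z) * (\<integral>w. \<kappa> w * (e/2) \<partial>lborel)"
    proof (intro mult_left_mono Bochner_Integration.integral_norm_bound_integral)
      show "integrable lborel (\<lambda>w. \<kappa> w *\<^sub>R \<tau> (w + (1 - \<theta>) *\<^sub>R x) - \<kappa> w *\<^sub>R T x)"
        by (intro Bochner_Integration.integrable_diff Wi integrable_scaleR_left \<kappa>i)
      show "integrable lborel (\<lambda>w. \<kappa> w * (e/2))" using \<kappa>i by simp
      fix w
      show "norm (\<kappa> w *\<^sub>R \<tau> (w + (1 - \<theta>) *\<^sub>R x) - \<kappa> w *\<^sub>R T x) \<le> \<kappa> w * (e/2)"
      proof (cases "\<kappa> w = 0")
        case False
        have "norm (T (w + (1 - \<theta>) *\<^sub>R x) - T x) \<le> e/2"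
          using \<delta>(2)[OF x inside(1)[OF False x] inside(2)[OF False x]] by simp
        from mult_left_mono[OF this \<kappa>0(1)[of w]] show ?thesis
          using \<kappa>0[of w] inside(1)[OF False x] by (simp add: \<tau>_def flip: scaleR_diff_right)
      qed simp
    qed (use Z in auto)
    also have "\<dots> = e/2" using Z \<kappa>i by (simp add: Z_def)
    finally show ?thesis .
  qed
  \<comment> \<open>After the substitution \<open>x\<close> enters through the cone instead of
    \<open>T\<close>. The cone is 1-Lipschitz, which is what makes \<open>W\<close>
    Lipschitz.\<close>
  have shift: "(\<integral>w. \<kappa> w *\<^sub>R \<tau> (w + (1 - \<theta>) *\<^sub>R x) \<partial>lborel) = (\<integral>z. \<kappa> (z - (1 - \<theta>) *\<^sub>R x) *\<^sub>R \<tau> z \<partial>lborel)" for x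
    by (subst lborel_integral_shift[of "\<lambda>z. \<kappa> (z - (1 - \<theta>) *\<^sub>R x) *\<^sub>R \<tau> z" "(1 - \<theta>) *\<^sub>R x"]) (auto simp: add.commute)
  have \<Omega>fin: "emeasure lborel \<Omega> < \<infinity>" using \<Omega>(2) by (rule emeasure_bounded_finite)
  have \<Omega>s: "\<Omega> \<in> sets borel" using \<Omega>(1) by simp
  have ki: "integrable lborel (\<lambda>z. \<kappa> (z - (1 - \<theta>) *\<^sub>R x) *\<^sub>R \<tau> z)" for x
  proof (rule Bochner_Integration.integrable_bound)
    show "integrable lborel (\<lambda>z. (\<theta> * \<rho> * BT) * indicator \<Omega> z)"
      using \<Omega>fin \<Omega>s by (intro integrable_mult_right integrable_real_indicator) auto
    show "AE z in lborel. norm (\<kappa> (z - (1 - \<theta>) *\<^sub>R x) *\<^sub>R \<tau> z) \<le> norm (\<theta> * \<rho> * BT * indicator \<Omega> z :: real)"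
    proof (rule AE_I2)
      fix z
      show "norm (\<kappa> (z - (1 - \<theta>) *\<^sub>R x) *\<^sub>R \<tau> z) \<le> norm (\<theta> * \<rho> * BT * indicator \<Omega> z :: real)"
        using \<kappa>0[of "z - (1 - \<theta>) *\<^sub>R x"] \<tau>b[of z] \<theta> \<rho> BT(1)
        by (cases "z \<in> \<Omega>") (auto simp: \<tau>_def abs_mult intro!: mult_mono)
    qed
  qed measurable
  define M where "M = (1 / Z) * (BT * measure lborel \<Omega>)"
  have M: "M \<ge> 0" using Z BT by (simp add: M_def)
  have Wlip: "norm (W x - W y) \<le> M * norm (x - y)" for x y
  proof -
    have "W x - W y = (1 / Z) *\<^sub>R (\<integral>z. \<kappa> (z - (1 - \<theta>) *\<^sub>R x) *\<^sub>R \<tau> z - \<kappa> (z - (1 - \<theta>) *\<^sub>R y) *\<^sub>R \<tau> z \<partial>lborel)"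
      unfolding W_def shift by (simp add: Bochner_Integration.integral_diff[OF ki ki] scaleR_diff_right)
    then have "norm (W x - W y) = (1 / Z) * norm (\<integral>z. \<kappa> (z - (1 - \<theta>) *\<^sub>R x) *\<^sub>R \<tau> z - \<kappa> (z - (1 - \<theta>) *\<^sub>R y) *\<^sub>R \<tau> z \<partial>lborel)"
      using Z by simp
    also have "\<dots> \<le> (1 / Z) * (\<integral>z. (norm (x - y) * BT) * indicator \<Omega> z \<partial>lborel)"
    proof (intro mult_left_mono Bochner_Integration.integral_norm_bound_integral)
      show "integrable lborel (\<lambda>z. \<kappa> (z - (1 - \<theta>) *\<^sub>R x) *\<^sub>R \<tau> z - \<kappa> (z - (1 - \<theta>) *\<^sub>R y) *\<^sub>R \<tau> z)"
        by (intro Bochner_Integration.integrable_diff ki)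
      show "integrable lborel (\<lambda>z. (norm (x - y) * BT) * indicator \<Omega> z)"
        using \<Omega>fin \<Omega>s by (intro integrable_mult_right integrable_real_indicator) auto
      fix z
      have "\<bar>\<kappa> (z - (1 - \<theta>) *\<^sub>R x) - \<kappa> (z - (1 - \<theta>) *\<^sub>R y)\<bar> \<le> norm (x - y)"
      proof -
        let ?a = "z - (1 - \<theta>) *\<^sub>R x - \<theta> *\<^sub>R x0" and ?b = "z - (1 - \<theta>) *\<^sub>R y - \<theta> *\<^sub>R x0"
        have "\<bar>norm ?a - norm ?b\<bar> \<le> norm (?a - ?b)" by (rule norm_triangle_ineq3)
        also have "?a - ?b = (1 - \<theta>) *\<^sub>R (y - x)" by (simp add: algebra_simps)
        also have "norm \<dots> \<le> norm (x - y)" using \<theta> by (simp add: norm_minus_commute mult_left_le_one_le)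
        finally show ?thesis unfolding \<kappa>_def by (simp add: max_def abs_if split: if_splits)
      qed
      then show "norm (\<kappa> (z - (1 - \<theta>) *\<^sub>R x) *\<^sub>R \<tau> z - \<kappa> (z - (1 - \<theta>) *\<^sub>R y) *\<^sub>R \<tau> z) \<le> norm (x - y) * BT * indicator \<Omega> z"
        using \<tau>b[of z] by (cases "z \<in> \<Omega>") (auto simp: \<tau>_def intro!: mult_mono simp flip: scaleR_diff_left)
    qed (use Z in auto)
    also have "\<dots> = M * norm (x - y)" by (simp add: M_def)
    finally show ?thesis .
  qed
  \<comment> \<open>The added multiple of the identity contributes the strong monotonicity constant
    \<theta>.\<close>
  define S where "S x = W x + \<theta> *\<^sub>R x" for x
  have "norm (S x - T x) \<le> e" if x: "x \<in> \<Omega>" for x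
  proof -
    have "norm (S x - T x) \<le> norm (W x - T x) + norm (\<theta> *\<^sub>R x)"
      using norm_triangle_ineq[of "W x - T x" "\<theta> *\<^sub>R x"] by (simp add: S_def algebra_simps)
    moreover have "norm (\<theta> *\<^sub>R x) \<le> \<theta> * B" using \<theta> B(2)[OF x] by (simp add: mult_left_mono)
    ultimately show ?thesis using Wclose[OF x] \<theta>(4) by linarith
  qed
  moreover have "norm (S x - S y) \<le> (M + \<theta>) * norm (x - y)" for x y
  proof -
    have "S x - S y = (W x - W y) + \<theta> *\<^sub>R (x - y)" by (simp add: S_def algebra_simps)
    then have "norm (S x - S y) \<le> norm (W x - W y) + \<theta> * norm (x - y)"
      using norm_triangle_ineq[of "W x - W y" "\<theta> *\<^sub>R (x - y)"] \<theta> by simp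
    then show ?thesis using Wlip[of x y] by (simp add: algebra_simps)
  qed
  moreover have "\<theta> * (norm (x - y))\<^sup>2 \<le> (S x - S y) \<bullet> (x - y)" if "x \<in> \<Omega>" "y \<in> \<Omega>" for x y
  proof -
    have "S x - S y = (W x - W y) + \<theta> *\<^sub>R (x - y)" by (simp add: S_def algebra_simps)
    then have "(S x - S y) \<bullet> (x - y) = (W x - W y) \<bullet> (x - y) + \<theta> * (norm (x - y))\<^sup>2"
      by (simp add: inner_add_left power2_norm_eq_inner)
    then show ?thesis using Wmono[OF that] by simp
  qed
  ultimately show ?thesis
    using M \<theta> by (intro exI[of _ S] exI[of _ "M + \<theta>"] exI[of _ \<theta>]) auto
qed

section \<open>Monotonicity of optimal maps\<close>

text \<open>Exchanging the targets of \<open>x\<close> and \<open>y\<close> on the symmetric set where \<open>S\<close> fails to be monotone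
  gives another coupling, as the push-forward of \<open>\<mu> \<times> \<mu>\<close>; it is strictly cheaper unless that set is
  null.\<close>

lemma optimal_transport_map_AE_monotone:
  fixes \<mu> \<nu> :: "(real^'n::finite) measure"
  assumes \<mu>: "prob_space \<mu>" "sets \<mu> = sets borel" and opt: "optimal_transport_map \<mu> \<nu> S"
    and B\<mu>: "AE x in \<mu>. norm x \<le> B" and B\<nu>: "AE y in \<nu>. norm y \<le> B"
  shows "AE x in \<mu>. AE y in \<mu>. 0 \<le> (S x - S y) \<bullet> (x - y)"
proof -
  interpret \<mu>: prob_space \<mu> by fact
  interpret P: pair_prob_space \<mu> \<mu> ..
  define M where "M = \<mu> \<Otimes>\<^sub>M \<mu>"
  interpret M: prob_space M unfolding M_def by (rule P.prob_space_axioms)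
  have setsM: "sets M = sets borel" unfolding M_def
    by (subst borel_prod[symmetric]) (intro sets_pair_measure_cong \<mu>(2))
  have spM: "space M = UNIV" using setsM sets_eq_imp_space_eq by fastforce
  have mM: "measurable M N = measurable borel N" for N :: "'c measure"
    by (rule measurable_cong_sets[OF setsM refl])
  have mMB: "measurable M borel = borel_measurable (borel \<Otimes>\<^sub>M borel)"
    by (simp add: mM borel_prod)
  have mmu: "measurable \<mu> N = measurable borel N" for N :: "'c measure"
    by (rule measurable_cong_sets[OF \<mu>(2) refl])
  have Sm [measurable]: "S \<in> borel_measurable borel" using opt unfolding optimal_transport_map_def by blast
  have fstM: "fst \<in> measurable M borel" and sndM: "snd \<in> measurable M borel" unfolding mMB by measurable
  have dfst: "distr M borel fst = \<mu>"
  proof -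
    have "distr M borel fst = distr M \<mu> fst" by (rule distr_cong) (simp_all add: \<mu>(2))
    then show ?thesis by (simp add: M_def \<mu>.distr_pair_fst)
  qed
  define sw where "sw p = (snd p, fst p)" for p :: "(real^'n) \<times> (real^'n)"
  have swM: "sw \<in> measurable M M"
    unfolding M_def sw_def by measurable
  have dsw: "distr M M sw = M"
  proof -
    have "sw = (\<lambda>(x, y). (y, x))" by (auto simp: sw_def)
    then show ?thesis unfolding M_def using P.distr_pair_swap by simp
  qed
  have dsnd: "distr M borel snd = \<mu>"
  proof -
    have "distr M borel snd = distr (distr M M sw) borel fst"
      by (subst distr_distr[OF fstM swM]) (simp add: comp_def sw_def)
    then show ?thesis by (simp add: dsw dfst)
  qed
  let ?m = "\<lambda>p. (S (fst p) - S (snd p)) \<bullet> (fst p - snd p)"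
  have mm: "?m \<in> borel_measurable M" unfolding mMB by measurable
  \<comment> \<open>The product of two copies of \<mu> and the set \<open>N\<close> are both
    invariant under the swap \<open>sw\<close>.\<close>
  define N where "N = {p. ?m p < 0}"
  have Ns: "N \<in> sets M"
    using mm spM unfolding N_def by (metis (no_types, lifting) Collect_cong UNIV_I borel_measurable_less borel_measurable_const)
  have swN: "sw p \<in> N \<longleftrightarrow> p \<in> N" for p
    by (simp add: N_def sw_def inner_diff_left inner_diff_right algebra_simps)
  \<comment> \<open>\<open>q\<close> names the point whose target is used: on \<open>N\<close> the
    first point takes the target of the second. By the invariance under \<open>sw\<close>,
    \<open>q\<close> has the same law as \<open>fst\<close>, so the second marginal is
    preserved.\<close>
  define q where "q p = (if p \<in> N then snd p else fst p)" for p
  have qM: "q \<in> measurable M borel"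
    unfolding q_def using Ns by (intro measurable_If_set sndM fstM) (auto simp: spM)
  have dq: "distr M borel q = \<mu>"
  proof (rule measure_eqI)
    fix A assume "A \<in> sets (distr M borel q)"
    then have A: "A \<in> sets borel" by simp
    have f: "fst -` A \<in> sets M" and s: "snd -` A \<in> sets M"
      using measurable_sets[OF fstM A] measurable_sets[OF sndM A] by (auto simp: spM)
    have "sw -` (N \<inter> fst -` A) \<inter> space M = N \<inter> snd -` A" using swN by (auto simp: spM sw_def)
    then have eq: "emeasure M (N \<inter> snd -` A) = emeasure M (N \<inter> fst -` A)"
      using emeasure_distr[OF swM, of "N \<inter> fst -` A"] Ns f by (simp add: dsw)
    have "q -` A \<inter> space M = (N \<inter> snd -` A) \<union> (fst -` A - N)" by (auto simp: spM q_def split: if_splits)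
    then have "emeasure (distr M borel q) A = emeasure M ((N \<inter> snd -` A) \<union> (fst -` A - N))"
      by (subst emeasure_distr[OF qM A]) simp
    also have "\<dots> = emeasure M (N \<inter> snd -` A) + emeasure M (fst -` A - N)"
      using Ns f s by (intro plus_emeasure[symmetric]) auto
    also have "\<dots> = emeasure M (N \<inter> fst -` A) + emeasure M (fst -` A - N)" by (simp add: eq)
    also have "\<dots> = emeasure M ((N \<inter> fst -` A) \<union> (fst -` A - N))"
      using Ns f by (intro plus_emeasure) auto
    also have "(N \<inter> fst -` A) \<union> (fst -` A - N) = fst -` A \<inter> space M" by (auto simp: spM)
    also have "emeasure M (fst -` A \<inter> space M) = emeasure (distr M borel fst) A"
      by (rule emeasure_distr[OF fstM A, symmetric])
    finally show "emeasure (distr M borel q) A = emeasure \<mu> A" by (simp add: dfst)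
  qed (simp add: \<mu>(2))
  have gS: "(\<lambda>x. (x, S x)) \<in> measurable \<mu> borel" unfolding mmu by measurable
  have d\<nu>: "distr \<mu> borel S = \<nu>"
  proof -
    have "distr (distr \<mu> borel (\<lambda>x. (x, S x))) borel snd = \<nu>"
      using opt unfolding optimal_transport_map_def couplings_def by blast
    moreover have "distr (distr \<mu> borel (\<lambda>x. (x, S x))) borel snd = distr \<mu> borel S"
      by (subst distr_distr[OF _ gS]) (simp_all add: comp_def borel_measurable_continuous_onI continuous_on_snd)
    ultimately show ?thesis by simp
  qed
  define G where "G p = (fst p, S (q p))" for p
  have SqM: "(\<lambda>p. S (q p)) \<in> measurable M borel" using measurable_compose[OF qM Sm] .
  have GM: "G \<in> measurable M borel"
    unfolding G_def borel_prod[symmetric] by (intro measurable_Pair fstM SqM)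
  have fb: "fst \<in> borel_measurable (borel :: ((real^'n) \<times> (real^'n)) measure)"
    and sb: "snd \<in> borel_measurable (borel :: ((real^'n) \<times> (real^'n)) measure)"
    by (simp_all add: borel_measurable_continuous_onI continuous_on_fst continuous_on_snd)
  have coup: "distr M borel G \<in> couplings \<mu> \<nu>"
  proof -
    have "distr (distr M borel G) borel fst = \<mu>"
      by (subst distr_distr[OF fb GM]) (simp add: comp_def G_def dfst)
    moreover have "distr (distr M borel G) borel snd = \<nu>"
    proof -
      have "distr (distr M borel G) borel snd = distr M borel (\<lambda>p. S (q p))"
        by (subst distr_distr[OF sb GM]) (simp add: comp_def G_def)
      also have "\<dots> = distr (distr M borel q) borel S"
        by (subst distr_distr[OF Sm qM]) (simp add: comp_def)
      finally show ?thesis by (simp add: dq d\<nu>)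
    qed
    ultimately show ?thesis unfolding couplings_def using M.prob_space_distr[OF GM] by simp
  qed
  define a where "a p = (norm (fst p - S (fst p)))\<^sup>2" for p :: "(real^'n) \<times> (real^'n)"
  define b where "b p = (norm (fst p - S (q p)))\<^sup>2" for p
  have SfM: "(\<lambda>p. S (fst p)) \<in> borel_measurable M" and SsM: "(\<lambda>p. S (snd p)) \<in> borel_measurable M"
    using measurable_compose[OF fstM Sm] measurable_compose[OF sndM Sm] by auto
  have am: "a \<in> borel_measurable M" and bm: "b \<in> borel_measurable M"
    unfolding a_def b_def using fstM SfM SqM by measurable
  have cm: "(\<lambda>(x, y). ennreal ((norm (x - y))\<^sup>2)) \<in> borel_measurable (borel :: ((real^'n) \<times> (real^'n)) measure)"
    unfolding borel_prod[symmetric] by measurable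
  have "transport_cost (distr \<mu> borel (\<lambda>x. (x, S x))) \<le> transport_cost (distr M borel G)"
    using opt coup unfolding optimal_transport_map_def by blast
  also have "transport_cost (distr M borel G) = (\<integral>\<^sup>+p. ennreal (b p) \<partial>M)"
    unfolding transport_cost_def by (subst nn_integral_distr[OF GM]) (simp_all add: cm G_def b_def)
  also have "transport_cost (distr \<mu> borel (\<lambda>x. (x, S x))) = (\<integral>\<^sup>+x. ennreal ((norm (x - S x))\<^sup>2) \<partial>\<mu>)"
    unfolding transport_cost_def by (subst nn_integral_distr[OF gS]) (simp_all add: cm)
  also have "\<dots> = (\<integral>\<^sup>+x. ennreal ((norm (x - S x))\<^sup>2) \<partial>distr M borel fst)" by (simp add: dfst)
  also have "\<dots> = (\<integral>\<^sup>+p. ennreal (a p) \<partial>M)"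
    unfolding a_def by (rule nn_integral_distr[OF fstM]) measurable
  finally have le: "(\<integral>\<^sup>+p. ennreal (a p) \<partial>M) \<le> (\<integral>\<^sup>+p. ennreal (b p) \<partial>M)" .
  \<comment> \<open>Bounded supports make both costs finite integrals, which may then be
    subtracted.\<close>
  have BS: "AE x in \<mu>. norm (S x) \<le> B"
    using B\<nu> unfolding d\<nu>[symmetric] by (rule AE_distrD[rotated]) (simp add: mmu)
  have "AE p in M. norm (fst p) \<le> B" "AE p in M. norm (S (fst p)) \<le> B"
    by (rule AE_distrD[OF fstM, unfolded dfst, OF B\<mu>], rule AE_distrD[OF fstM, unfolded dfst, OF BS])
  moreover have "AE p in M. norm (S (snd p)) \<le> B"
    by (rule AE_distrD[OF sndM, unfolded dsnd, OF BS])
  ultimately have bd: "AE p in M. norm (a p) \<le> (2 * B)\<^sup>2 \<and> norm (b p) \<le> (2 * B)\<^sup>2"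
  proof eventually_elim
    case (elim p)
    have "norm (fst p - z) \<le> 2 * B" if "norm z \<le> B" for z
      using elim(1) that norm_triangle_ineq4[of "fst p" z] by linarith
    then have "(norm (fst p - z))\<^sup>2 \<le> (2 * B)\<^sup>2" if "norm z \<le> B" for z
      using that by (intro power_mono) auto
    then show ?case using elim by (auto simp: a_def b_def q_def)
  qed
  have ai: "integrable M a" and bi: "integrable M b"
    using bd by (auto intro!: M.integrable_const_bound[where B="(2 * B)\<^sup>2"] am bm elim: eventually_mono)
  have a0: "0 \<le> a p" and b0: "0 \<le> b p" for p by (simp_all add: a_def b_def)
  have "ennreal (\<integral>p. a p \<partial>M) \<le> ennreal (\<integral>p. b p \<partial>M)"
    using le nn_integral_eq_integral[OF ai AE_I2[OF a0]] nn_integral_eq_integral[OF bi AE_I2[OF b0]] by simp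
  then have "(\<integral>p. a p \<partial>M) \<le> (\<integral>p. b p \<partial>M)"
    using b0 by (subst (asm) ennreal_le_iff) (auto intro: Bochner_Integration.integral_nonneg)
  then have ab: "(\<integral>p. a p - b p \<partial>M) \<le> 0" using ai bi by simp
  have fi: "integrable M (\<lambda>p. a p - b p)" using ai bi by simp
  \<comment> \<open>Optimality bounds the integral of \<open>a - b\<close> by 0; adding the swapped
    copy keeps this sign and makes the integrand pointwise nonnegative.\<close>
  have fsi: "integrable M (\<lambda>p. a (sw p) - b (sw p))"
    using integrable_distr[OF swM, of "\<lambda>p. a p - b p"] fi by (simp add: dsw)
  have "(\<integral>p. a (sw p) - b (sw p) \<partial>M) = (\<integral>p. a p - b p \<partial>distr M M sw)"
    by (rule integral_distr[symmetric, OF swM]) (use am bm in measurable)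
  then have sum0: "(\<integral>p. (a p - b p) + (a (sw p) - b (sw p)) \<partial>M) \<le> 0"
    using ab fi fsi by (simp add: dsw)
  \<comment> \<open>Expanding the squares for the pair (x, y), the squared norms cancel and only the
    mixed terms -2 (S x - S y) . (x - y) remain. A nonnegative function with integral at most 0
    vanishes almost everywhere, so \<open>N\<close> is null.\<close>
  have key: "(a p - b p) + (a (sw p) - b (sw p)) = (if p \<in> N then - 2 * ?m p else 0)" for p
    using swN[of p] by (simp add: a_def b_def q_def sw_def power2_norm_eq_inner inner_diff_left inner_diff_right inner_commute algebra_simps)
  have nn: "0 \<le> (a p - b p) + (a (sw p) - b (sw p))" for p
    unfolding key by (auto simp: N_def)
  have "(\<integral>p. (a p - b p) + (a (sw p) - b (sw p)) \<partial>M) = 0"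
    by (intro order_antisym sum0 Bochner_Integration.integral_nonneg nn)
  then have "AE p in M. (a p - b p) + (a (sw p) - b (sw p)) = 0"
    using integral_nonneg_eq_0_iff_AE[of M "\<lambda>p. (a p - b p) + (a (sw p) - b (sw p))"] nn fi fsi by simp
  then have "AE p in M. 0 \<le> ?m p"
    by eventually_elim (auto simp: key N_def split: if_splits)
  then have "AE p in \<mu> \<Otimes>\<^sub>M \<mu>. 0 \<le> ?m p" unfolding M_def .
  from P.AE_pair[OF this] show ?thesis by simp
qed

lemma AE_emeasure_pos_ex:
  assumes "AE x in M. Q x" "A \<in> sets M" "0 < emeasure M A"
  shows "\<exists>x\<in>A. Q x"
proof (rule ccontr)
  assume "\<not> (\<exists>x\<in>A. Q x)"
  then have "AE x in M. x \<notin> A" using assms(1) by (auto elim: eventually_mono)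
  then have "A \<in> null_sets M" using assms(2) by (simp add: AE_iff_null_sets)
  then show False using assms(3) by auto
qed

text \<open>A failure of monotonicity would persist on a product of small balls.\<close>

lemma AE_monotone_imp_monotone:
  fixes \<mu> :: "'a::euclidean_space measure" and T :: "'a \<Rightarrow> 'a"
  assumes \<mu>: "sets \<mu> = sets borel" and \<Omega>: "open \<Omega>" and T: "continuous_on \<Omega> T"
    and pos: "\<And>x r. 0 < r \<Longrightarrow> ball x r \<subseteq> \<Omega> \<Longrightarrow> 0 < emeasure \<mu> (ball x r)"
    and ae: "AE x in \<mu>. AE y in \<mu>. 0 \<le> (T x - T y) \<bullet> (x - y)"
    and x: "x \<in> \<Omega>" and y: "y \<in> \<Omega>"
  shows "0 \<le> (T x - T y) \<bullet> (x - y)"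
proof (rule ccontr)
  assume neg: "\<not> 0 \<le> (T x - T y) \<bullet> (x - y)"
  let ?m = "\<lambda>p. (T (fst p) - T (snd p)) \<bullet> (fst p - snd p)"
  define N where "N = ?m -` {..<0} \<inter> (\<Omega> \<times> \<Omega>)"
  have c: "continuous_on (\<Omega> \<times> \<Omega>) ?m"
    by (intro continuous_intros continuous_on_compose2[OF T]) auto
  have "open N"
    using continuous_open_preimage[OF c, of "{..<0}"] \<Omega> by (simp add: N_def open_Times Int_commute)
  moreover have "(x, y) \<in> N" using neg x y by (simp add: N_def)
  ultimately obtain U V where UV: "open U" "open V" "(x, y) \<in> U \<times> V" "U \<times> V \<subseteq> N"
    by (rule open_prod_elim)
  obtain r where r: "r > 0" "ball x r \<subseteq> U" using UV by (meson mem_Sigma_iff open_contains_ball)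
  obtain s where s: "s > 0" "ball y s \<subseteq> V" using UV by (meson mem_Sigma_iff open_contains_ball)
  have sub: "(a, b) \<in> N" if "a \<in> ball x r" "b \<in> ball y s" for a b using that r s UV by blast
  have "ball x r \<subseteq> \<Omega>" "ball y s \<subseteq> \<Omega>"
    using sub[of _ y] sub[of x _] r(1) s(1) by (auto simp: N_def)
  then have p: "0 < emeasure \<mu> (ball x r)" "0 < emeasure \<mu> (ball y s)" using pos r(1) s(1) by blast+
  obtain a where a: "a \<in> ball x r" "AE b in \<mu>. 0 \<le> (T a - T b) \<bullet> (a - b)"
    using AE_emeasure_pos_ex[OF ae _ p(1)] \<mu> by auto
  obtain b where b: "b \<in> ball y s" "0 \<le> (T a - T b) \<bullet> (a - b)"
    using AE_emeasure_pos_ex[OF a(2) _ p(2)] \<mu> by auto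
  show False using sub[OF a(1) b(1)] b(2) by (simp add: N_def)
qed

section \<open>Measures with densities and the continuous optimal map\<close>

lemma smooth_upto_closure_imp_continuous_on:
  "smooth_upto_closure f U \<Longrightarrow> continuous_on U f"
  unfolding smooth_upto_closure_def smooth_on_def using Ck_on.simps(1) by blast

lemma borel_measurable_restricted_density:
  fixes \<rho> :: "'a::euclidean_space \<Rightarrow> real"
  assumes "open U" "continuous_on U \<rho>"
  shows "(\<lambda>x. ennreal (\<rho> x) * indicator U x) \<in> borel_measurable lborel"
proof -
  have "(\<lambda>x. indicator U x *\<^sub>R \<rho> x) \<in> borel_measurable borel"
    using assms by (intro borel_measurable_continuous_on_indicator) auto
  then have "(\<lambda>x. ennreal (indicator U x *\<^sub>R \<rho> x)) \<in> borel_measurable lborel" by simp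
  moreover have "(\<lambda>x. ennreal (\<rho> x) * indicator U x) = (\<lambda>x. ennreal (indicator U x *\<^sub>R \<rho> x))"
    by (auto simp: indicator_def)
  ultimately show ?thesis by simp
qed

text \<open>Boundedness of the domains gives the almost sure norm bounds behind the exchange
  argument. The lower bound on the first density gives every ball inside the domain positive mass,
  so almost everywhere monotonicity extends to all points by continuity.\<close>

lemma continuous_optimal_transport_map_monotone:
  fixes \<Omega>\<^sub>1 \<Omega>\<^sub>2 :: "(real^'n::finite) set"
  assumes \<Omega>1: "open \<Omega>\<^sub>1" "bounded \<Omega>\<^sub>1" and \<Omega>2: "open \<Omega>\<^sub>2" "bounded \<Omega>\<^sub>2"
    and \<mu>: "\<mu> = density lborel (\<lambda>x. ennreal (\<rho>\<^sub>\<mu> x) * indicator \<Omega>\<^sub>1 x)" "prob_space \<mu>"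
    and \<nu>: "\<nu> = density lborel (\<lambda>x. ennreal (\<rho>\<^sub>\<nu> x) * indicator \<Omega>\<^sub>2 x)"
    and C: "0 < C" "\<And>x. x \<in> \<Omega>\<^sub>1 \<Longrightarrow> 1 / C \<le> \<rho>\<^sub>\<mu> x"
    and \<rho>: "continuous_on \<Omega>\<^sub>1 \<rho>\<^sub>\<mu>" "continuous_on \<Omega>\<^sub>2 \<rho>\<^sub>\<nu>"
    and T: "continuous_optimal_transport_map \<mu> \<nu> \<Omega>\<^sub>1 \<Omega>\<^sub>2 T"
    and xy: "x \<in> \<Omega>\<^sub>1" "y \<in> \<Omega>\<^sub>1"
  shows "0 \<le> (T x - T y) \<bullet> (x - y)"
proof -
  note m\<mu> = borel_measurable_restricted_density[OF \<Omega>1(1) \<rho>(1)]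
  note m\<nu> = borel_measurable_restricted_density[OF \<Omega>2(1) \<rho>(2)]
  have s\<mu>: "sets \<mu> = sets borel" by (simp add: \<mu>(1))
  obtain S where S: "optimal_transport_map \<mu> \<nu> S" "AE x in \<mu>. T x = S x"
    using T unfolding continuous_optimal_transport_map_def by blast
  obtain B where B: "\<And>x. x \<in> \<Omega>\<^sub>1 \<union> \<Omega>\<^sub>2 \<Longrightarrow> norm x \<le> B"
    using bounded_Un[THEN iffD2, OF conjI, OF \<Omega>1(2) \<Omega>2(2)] unfolding bounded_iff by blast
  have "AE x in \<mu>. norm x \<le> B"
    unfolding \<mu>(1) AE_density[OF m\<mu>] using B by (intro AE_I2) (auto simp: indicator_def split: if_splits)
  moreover have "AE x in \<nu>. norm x \<le> B"
    unfolding \<nu> AE_density[OF m\<nu>] using B by (intro AE_I2) (auto simp: indicator_def split: if_splits)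
  ultimately have aeS: "AE x in \<mu>. AE y in \<mu>. 0 \<le> (S x - S y) \<bullet> (x - y)"
    by (rule optimal_transport_map_AE_monotone[OF \<mu>(2) s\<mu> S(1)])
  have aeT: "AE x in \<mu>. AE y in \<mu>. 0 \<le> (T x - T y) \<bullet> (x - y)"
    using aeS S(2)
  proof eventually_elim
    case (elim x)
    show ?case using elim(1) S(2) by eventually_elim (simp add: elim(2))
  qed
  show ?thesis
  proof (rule AE_monotone_imp_monotone[OF s\<mu> \<Omega>1(1) _ _ aeT xy])
    show "continuous_on \<Omega>\<^sub>1 T"
      using T closure_subset unfolding continuous_optimal_transport_map_def by (blast intro: continuous_on_subset)
    fix x :: "real^'n" and r :: real assume r: "0 < r" "ball x r \<subseteq> \<Omega>\<^sub>1"
    have "emeasure lborel (ball x r) \<noteq> 0"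
      using content_ball_pos[OF r(1), of x] by (auto simp: measure_def)
    \<comment> \<open>The mass of the ball is at least \<open>1 / C\<close> times its
      volume.\<close>
    then have "0 < ennreal (1 / C) * emeasure lborel (ball x r)"
      using C(1) by (simp add: ennreal_zero_less_mult_iff zero_less_iff_neq_zero)
    also have "\<dots> = (\<integral>\<^sup>+z. ennreal (1 / C) * indicator (ball x r) z \<partial>lborel)"
      by (simp add: nn_integral_cmult_indicator)
    also have "\<dots> \<le> (\<integral>\<^sup>+z. ennreal (\<rho>\<^sub>\<mu> z) * indicator \<Omega>\<^sub>1 z * indicator (ball x r) z \<partial>lborel)"
      using r(2) C(2) by (intro nn_integral_mono) (auto simp: indicator_def intro!: ennreal_leI)
    also have "\<dots> = emeasure \<mu> (ball x r)"
      unfolding \<mu>(1) by (rule emeasure_density[symmetric, OF m\<mu>]) simp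
    finally show "0 < emeasure \<mu> (ball x r)" .
  qed
qed

theorem corollary2p3:
  fixes \<Omega>\<^sub>1 \<Omega>\<^sub>2 :: "(real^'n::finite) set"
    and \<mu> \<nu> :: "(real^'n) measure"
    and \<rho>\<^sub>\<mu> \<rho>\<^sub>\<nu> :: "real^'n \<Rightarrow> real"
    and T :: "real^'n \<Rightarrow> real^'n"
    and F :: "'k::finite \<Rightarrow> real^'n \<Rightarrow> real^'n"
    and C \<epsilon> :: real
  assumes "open \<Omega>\<^sub>1" "bounded \<Omega>\<^sub>1" "smooth_uniformly_convex \<Omega>\<^sub>1"
    and "open \<Omega>\<^sub>2" "bounded \<Omega>\<^sub>2" "smooth_uniformly_convex \<Omega>\<^sub>2"
    and "\<mu> = density lborel (\<lambda>x. ennreal (\<rho>\<^sub>\<mu> x) * indicator \<Omega>\<^sub>1 x)" "prob_space \<mu>"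
    and "\<nu> = density lborel (\<lambda>x. ennreal (\<rho>\<^sub>\<nu> x) * indicator \<Omega>\<^sub>2 x)" "prob_space \<nu>"
    and "C > 1"
    and "\<And>x. x \<in> \<Omega>\<^sub>1 \<Longrightarrow> C \<ge> \<rho>\<^sub>\<mu> x \<and> \<rho>\<^sub>\<mu> x \<ge> 1 / C"
    and "\<And>x. x \<in> \<Omega>\<^sub>2 \<Longrightarrow> C \<ge> \<rho>\<^sub>\<nu> x \<and> \<rho>\<^sub>\<nu> x \<ge> 1 / C"
    and "smooth_upto_closure \<rho>\<^sub>\<mu> \<Omega>\<^sub>1" "smooth_upto_closure \<rho>\<^sub>\<nu> \<Omega>\<^sub>2"
    and "continuous_optimal_transport_map \<mu> \<nu> \<Omega>\<^sub>1 \<Omega>\<^sub>2 T"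
    and "\<And>i. smooth_on (F i) UNIV"
    and "\<And>i. \<exists>L. L-lipschitz_on UNIV (F i)"
    and "Lie_strong_approximating F"
    and "\<epsilon> > 0"
  shows "\<exists>u :: real \<Rightarrow> real^'k. L2_control u \<and>
           (SUP x\<in>\<Omega>\<^sub>1. ennreal (norm (T x - flow F u x))) \<le> ennreal \<epsilon>"
proof -
  have "\<exists>\<phi>\<in>reachable F. \<forall>x\<in>\<Omega>\<^sub>1. norm (T x - \<phi> x) \<le> \<epsilon>"
  \<comment> \<open>The mollification contracts towards a point of the domain; over the empty set
    the identity map serves.\<close>
  proof (cases "\<Omega>\<^sub>1 = {}")
    case True
    then show ?thesis using id_reachable by blast
  next
    case False
    have mono: "0 \<le> (T x - T y) \<bullet> (x - y)" if "x \<in> \<Omega>\<^sub>1" "y \<in> \<Omega>\<^sub>1" for x y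
      by (rule continuous_optimal_transport_map_monotone[OF assms(1,2,4,5,7,8,9) _ _ _ _ assms(16) that, where C=C])
        (use assms(11,12) smooth_upto_closure_imp_continuous_on[OF assms(14)]
          smooth_upto_closure_imp_continuous_on[OF assms(15)] in auto)
    have conv: "convex \<Omega>\<^sub>1" using assms(3) unfolding smooth_uniformly_convex_def by blast
    have Tc: "continuous_on (closure \<Omega>\<^sub>1) T"
      using assms(16) unfolding continuous_optimal_transport_map_def by blast
    \<comment> \<open>One half is spent on replacing \<open>T\<close> by a strongly monotone map,
      the other on reaching that map.\<close>
    have "\<epsilon>/2 > 0" using assms(20) by simp
    from monotone_lipschitz_approximation[OF assms(1,2) conv False Tc mono this]
    obtain S M c where S: "0 \<le> M" "0 < c" "c \<le> 1" "\<And>x. x \<in> \<Omega>\<^sub>1 \<Longrightarrow> norm (S x - T x) \<le> \<epsilon>/2"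
        "\<And>x y. x \<in> \<Omega>\<^sub>1 \<Longrightarrow> y \<in> \<Omega>\<^sub>1 \<Longrightarrow> norm (S x - S y) \<le> M * norm (x - y)"
        "\<And>x y. x \<in> \<Omega>\<^sub>1 \<Longrightarrow> y \<in> \<Omega>\<^sub>1 \<Longrightarrow> c * (norm (x - y))\<^sup>2 \<le> (S x - S y) \<bullet> (x - y)"
      by blast
    obtain \<phi> where \<phi>: "\<phi> \<in> reachable F" "\<And>x. x \<in> \<Omega>\<^sub>1 \<Longrightarrow> norm (\<phi> x - S x) \<le> \<epsilon>/2"
      using strongly_monotone_approximable[OF reachable_comp id_reachable
          generated_continuous[of F, OF assms(17,18,19)] assms(2) S(5,1,2,3,6) \<open>\<epsilon>/2 > 0\<close>] by blast
    have "norm (T x - \<phi> x) \<le> \<epsilon>" if x: "x \<in> \<Omega>\<^sub>1" for x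
      using S(4)[OF x] \<phi>(2)[OF x] norm_triangle_ineq4[of "T x - S x" "\<phi> x - S x"]
      by (simp add: norm_minus_commute)
    then show ?thesis using \<phi>(1) by blast
  qed
  then obtain \<phi> where \<phi>: "\<phi> \<in> reachable F" "\<And>x. x \<in> \<Omega>\<^sub>1 \<Longrightarrow> norm (T x - \<phi> x) \<le> \<epsilon>" by blast
  obtain u where "L2_control u" "flow F u = \<phi>"
    using reachableD[of F \<phi>, OF assms(18) \<phi>(1)] by blast
  moreover from this have "(SUP x\<in>\<Omega>\<^sub>1. ennreal (norm (T x - flow F u x))) \<le> ennreal \<epsilon>"
    by (intro SUP_least ennreal_leI) (simp add: \<phi>(2))
  ultimately show ?thesis by blast
qed

end
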